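(* Let $N=5$, and let $\varrho$ be the regular representation of $\mathcal{K}_{\Gamma_0(5)}$ over $\mathcal{K}$ with respect to the ordered basis $$\{f_1,\dots,f_6\}=\{1,\ x_P+x_{2P},\ x_Px_{2P},\ x_P^2+x_{2P}^2,\ x_P^2x_{2P}^2,\ x_P^3+x_{2P}^3\}.$$ Then $$\varrho(a')=\begin{pmatrix}-19a&40b&-30a^2&-60a^2&72a^3-448b^2&-1600ab\\0&a&120b&120b&-512ab&-1160a^2\\0&0&41a&0&-192a^2&3960b\\-30&0&0&-79a&-18a^2&1320b\\0&0&-90&-420&365a&0\\0&-40&0&0&184b&321a\end{pmatrix},$$ $$\varrho(b')=\begin{pmatrix}-55b&-210a^2&-2632ab/3&-11032ab/3&13888a^2b/3&1554a^3-12320b^2\\-42a&505b&-1946a^2/3&-8036a^2/3&7658a^3/3-3360b^2&-13104ab\\0&56a&2185b&9240b&-9576ab&-5096a^2\\0&-182a&840b&3025b&-2632ab&-994a^2\\0&-1050&0&0&4705b&7770a\\-70&0&658a/3&2212a/3&-2842a^2/3&5265b\end{pmatrix}.$$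
   Context: $q=e^{2\pi i\tau}$; $\mathcal{M}_\kappa(\Gamma)$ is the space of weight $\kappa$ modular forms for $\Gamma$, $\mathcal{R}_\Gamma=\bigoplus_{\kappa\ge0}\mathcal{M}_\kappa(\Gamma)$, and $\mathcal{K}_\Gamma$ is the field of fractions of the integral domain $\mathcal{R}_\Gamma$; $\mathcal{R}=\mathcal{R}_{SL(2,\mathbf{Z})}$, $\mathcal{K}=\mathcal{K}_{SL(2,\mathbf{Z})}$. One has $\mathcal{R}=\mathbf{C}[a,b]$, a polynomial ring, where $$a(\tau)=-\tfrac13\Bigl(1+240\sum_{n\ge1}\sigma_3(n)q^n\Bigr)\ (\text{weight }4),\qquad b(\tau)=\tfrac{2}{27}\Bigl(1-504\sum_{n\ge1}\sigma_5(n)q^n\Bigr)\ (\text{weight }6).$$ For $\ell=1,2$ let $x_{\ell P}(\tau)=-\pi^{-2}\wp(\ell/5;\mathbf{Z}+\mathbf{Z}\tau)$, a weight $2$ modular form for $\{\pm I\}\cdot\Gamma_1(5)$; these are the $x$-coordinates of $P$ and $2P$ for a point $P$ of order $5$ on $y^2=x^3+ax+b$. Symmetric polynomials in $x_P,x_{2P}$ lie in $\mathcal{R}_{\Gamma_0(5)}$, and the elements $f_1,\dots,f_6$ form a basis of the degree $6$ extension $\mathcal{K}_{\Gamma_0(5)}/\mathcal{K}$. The regular representation $\varrho$ sends $f\in\mathcal{K}_{\Gamma_0(5)}$ to the matrix $(\varrho(f)_{ij})$ over $\mathcal{K}$ with $f f_j=\sum_i\varrho(f)_{ij}f_i$ (columns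 are the coordinates of $f f_j$). Here $a'(\tau)=5^4a(5\tau)$ and $b'(\tau)=5^6b(5\tau)$, elements of $\mathcal{R}_{\Gamma_0(5)}$. *)

theory Defs
  imports
    "HOL-Complex_Analysis.Complex_Analysis"
    "HOL-Computational_Algebra.Fraction_Field"
    "HOL-Computational_Algebra.Polynomial"
    "Jordan_Normal_Form.Determinant"
begin

section \<open>Holomorphic functions on the upper half-plane\<close>

definition upper_half_plane :: "complex set" where
  "upper_half_plane = {\<tau>. Im \<tau> > 0}"

text \<open>Elements are total functions, normalised to \<open>0\<close> off the upper half-plane so that
  equality in the type is equality on the upper half-plane.\<close>

typedef uhp_fun =
  "{f :: complex \<Rightarrow> complex. f holomorphic_on upper_half_plane \<and> (\<forall>\<tau>. \<tau> \<notin> upper_half_plane \<longrightarrow> f \<tau> = 0)}"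
  by (rule exI[of _ "\<lambda>_. 0"]) auto

setup_lifting type_definition_uhp_fun

instantiation uhp_fun :: comm_ring_1
begin

lift_definition zero_uhp_fun :: uhp_fun is "\<lambda>_. 0" by auto

lift_definition one_uhp_fun :: uhp_fun is "\<lambda>\<tau>. if \<tau> \<in> upper_half_plane then 1 else 0"
  by (auto cong: holomorphic_cong)

lift_definition plus_uhp_fun :: "uhp_fun \<Rightarrow> uhp_fun \<Rightarrow> uhp_fun" is "\<lambda>f g \<tau>. f \<tau> + g \<tau>"
  by (auto intro: holomorphic_intros)

lift_definition minus_uhp_fun :: "uhp_fun \<Rightarrow> uhp_fun \<Rightarrow> uhp_fun" is "\<lambda>f g \<tau>. f \<tau> - g \<tau>"
  by (auto intro: holomorphic_intros)

lift_definition uminus_uhp_fun :: "uhp_fun \<Rightarrow> uhp_fun" is "\<lambda>f \<tau>. - f \<tau>"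
  by (auto intro: holomorphic_intros)

lift_definition times_uhp_fun :: "uhp_fun \<Rightarrow> uhp_fun \<Rightarrow> uhp_fun" is "\<lambda>f g \<tau>. f \<tau> * g \<tau>"
  by (auto intro: holomorphic_intros)

instance
proof
  show "(0 :: uhp_fun) \<noteq> 1"
    by transfer (auto simp: fun_eq_iff upper_half_plane_def intro!: exI[of _ \<i>])
qed (transfer; auto simp: fun_eq_iff algebra_simps)+

end

lemma open_upper_half_plane: "open upper_half_plane"
  unfolding upper_half_plane_def by (rule open_halfspace_Im_gt)

lemma connected_upper_half_plane: "connected upper_half_plane"
  unfolding upper_half_plane_def by (intro convex_connected convex_halfspace_Im_gt)

instance uhp_fun :: idom
proof
  fix f g :: uhp_fun
  assume "f \<noteq> 0" "g \<noteq> 0"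
  then show "f * g \<noteq> 0"
  proof transfer
    fix f g :: "complex \<Rightarrow> complex"
    assume f: "f holomorphic_on upper_half_plane \<and> (\<forall>\<tau>. \<tau> \<notin> upper_half_plane \<longrightarrow> f \<tau> = 0)"
      and g: "g holomorphic_on upper_half_plane \<and> (\<forall>\<tau>. \<tau> \<notin> upper_half_plane \<longrightarrow> g \<tau> = 0)"
      and nz: "f \<noteq> (\<lambda>_. 0)" "g \<noteq> (\<lambda>_. 0)"
    from nz f obtain z where z: "z \<in> upper_half_plane" "f z \<noteq> 0" by (metis ext)
    show "(\<lambda>\<tau>. f \<tau> * g \<tau>) \<noteq> (\<lambda>_. 0)"
    proof
      assume eq: "(\<lambda>\<tau>. f \<tau> * g \<tau>) = (\<lambda>_. 0)"
      define U where "U = upper_half_plane \<inter> f -` (- {0})"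
      have "continuous_on upper_half_plane f"
        using f holomorphic_on_imp_continuous_on by blast
      then have "open U"
        unfolding U_def by (intro continuous_open_preimage open_upper_half_plane) auto
      have "g w = 0" if "w \<in> upper_half_plane" for w
      proof (rule analytic_continuation_open[of U upper_half_plane g "\<lambda>_. 0"])
        show "g u = 0" if "u \<in> U" for u
          using that fun_cong[OF eq, of u] by (auto simp: U_def)
      qed (use z \<open>open U\<close> f g that open_upper_half_plane connected_upper_half_plane
            in \<open>auto simp: U_def\<close>)
      with g nz(2) show False by (metis ext)
    qed
  qed
qed

text \<open>Meaningful only for functions holomorphic on the upper half-plane.\<close>

definition uhp_restrict :: "(complex \<Rightarrow> complex) \<Rightarrow> uhp_fun" where
  "uhp_restrict f = Abs_uhp_fun (\<lambda>\<tau>. if \<tau> \<in> upper_half_plane then f \<tau> else 0)"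


section \<open>Modular forms\<close>

definition SL2Z :: "int mat set" where
  "SL2Z = {\<gamma> \<in> carrier_mat 2 2. Determinant.det \<gamma> = 1}"

definition Gamma0 :: "int \<Rightarrow> int mat set" where
  "Gamma0 N = {\<gamma> \<in> SL2Z. N dvd \<gamma> $$ (1, 0)}"

definition mobius_act :: "int mat \<Rightarrow> complex \<Rightarrow> complex" where
  "mobius_act \<gamma> \<tau> =
     (of_int (\<gamma> $$ (0, 0)) * \<tau> + of_int (\<gamma> $$ (0, 1))) /
     (of_int (\<gamma> $$ (1, 0)) * \<tau> + of_int (\<gamma> $$ (1, 1)))"

definition slash :: "nat \<Rightarrow> (complex \<Rightarrow> complex) \<Rightarrow> int mat \<Rightarrow> complex \<Rightarrow> complex" where
  "slash k f \<gamma> \<tau> =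
     f (mobius_act \<gamma> \<tau>) / (of_int (\<gamma> $$ (1, 0)) * \<tau> + of_int (\<gamma> $$ (1, 1))) ^ k"

text \<open>The last condition is holomorphy at all cusps.\<close>

definition modular_forms :: "nat \<Rightarrow> int mat set \<Rightarrow> uhp_fun set" where
  "modular_forms k \<Gamma> = {f.
     (\<forall>\<gamma>\<in>\<Gamma>. \<forall>\<tau>\<in>upper_half_plane. slash k (Rep_uhp_fun f) \<gamma> \<tau> = Rep_uhp_fun f \<tau>) \<and>
     (\<forall>\<gamma>\<in>SL2Z. \<exists>B. \<exists>C>0. \<forall>\<tau>. Im \<tau> \<ge> C \<longrightarrow> norm (slash k (Rep_uhp_fun f) \<gamma> \<tau>) \<le> B)}"

text \<open>The direct sum of the spaces of weight \<open>k\<close> modular forms, \<open>k \<ge> 0\<close>: a finitely supported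
  sequence of forms, the one at index \<open>k\<close> having weight \<open>k\<close>, is a polynomial over
  \<^typ>\<open>uhp_fun\<close>, and the product of polynomials is the product of the graded ring. Thus all
  these rings lie in the integral domain \<^typ>\<open>uhp_fun poly\<close>, and their fraction fields
  in \<^typ>\<open>uhp_fun poly fract\<close>.\<close>

definition modular_ring :: "int mat set \<Rightarrow> uhp_fun poly set" where
  "modular_ring \<Gamma> = {p. \<forall>k. coeff p k \<in> modular_forms k \<Gamma>}"

definition modular_field :: "int mat set \<Rightarrow> uhp_fun poly fract set" where
  "modular_field \<Gamma> =
     {Fraction_Field.Fract p q | p q. p \<in> modular_ring \<Gamma> \<and> q \<in> modular_ring \<Gamma> \<and> q \<noteq> 0}"

text \<open>A function on the upper half-plane as a homogeneous element of weight \<open>k\<close>.\<close>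

definition homog :: "nat \<Rightarrow> (complex \<Rightarrow> complex) \<Rightarrow> uhp_fun poly fract" where
  "homog k f = Fraction_Field.Fract (monom (uhp_restrict f) k) 1"


section \<open>The regular representation\<close>

text \<open>Multiplication by \<open>f \<in> L\<close> in the ordered \<open>K\<close>-basis \<open>fs\<close> of \<open>L\<close>; column \<open>j\<close> holds the
  coordinates of \<open>f * fs ! j\<close>. The matrix is specified as the unique one over \<open>K\<close> with this
  property, so an evaluation of it rests on the \<open>K\<close>-linear independence of \<open>fs\<close>.\<close>

definition regular_rep :: "'a::field set \<Rightarrow> 'a set \<Rightarrow> 'a list \<Rightarrow> 'a \<Rightarrow> 'a mat" where
  "regular_rep L K fs f =
     (if f \<in> L
      then THE M. M \<in> carrier_mat (length fs) (length fs) \<and> elements_mat M \<subseteq> K \<and>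
             (\<forall>j<length fs. f * fs ! j = (\<Sum>i<length fs. M $$ (i, j) * fs ! i))
      else undefined)"


section \<open>The forms involved\<close>

definition nome :: "complex \<Rightarrow> complex" where
  "nome \<tau> = exp (2 * of_real pi * \<i> * \<tau>)"

definition divisor_sum :: "nat \<Rightarrow> nat \<Rightarrow> nat" where
  "divisor_sum k n = (\<Sum>d | d dvd n. d ^ k)"

definition a_form :: "complex \<Rightarrow> complex" where
  "a_form \<tau> = - (1/3) * (1 + 240 * (\<Sum>\<^sub>\<infinity>n\<in>{1..}. of_nat (divisor_sum 3 n) * nome \<tau> ^ n))"

definition b_form :: "complex \<Rightarrow> complex" where
  "b_form \<tau> = 2/27 * (1 - 504 * (\<Sum>\<^sub>\<infinity>n\<in>{1..}. of_nat (divisor_sum 5 n) * nome \<tau> ^ n))"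

definition weierstrass_p :: "complex \<Rightarrow> complex set \<Rightarrow> complex" where
  "weierstrass_p z \<Lambda> = 1 / z\<^sup>2 + (\<Sum>\<^sub>\<infinity>\<omega>\<in>\<Lambda> - {0}. 1 / (z - \<omega>)\<^sup>2 - 1 / \<omega>\<^sup>2)"

definition std_lattice :: "complex \<Rightarrow> complex set" where
  "std_lattice \<tau> = {of_int m + of_int n * \<tau> | m n. True}"

definition x_form :: "nat \<Rightarrow> complex \<Rightarrow> complex" where
  "x_form l \<tau> = - (1 / of_real pi ^ 2) * weierstrass_p (of_nat l / 5) (std_lattice \<tau>)"

end

theory Submission
  imports Defs "HOL-Real_Asymp.Real_Asymp"
begin

text \<open>Write \<open>P = z + L\<close> for a point of order 5 on the torus of a lattice \<open>L\<close>. Summing over the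
  lattice \<open>L + \<int> z\<close> coset by coset expresses its Eisenstein series of weights 4 and 6
  through derivatives of \<open>\<wp>\<close> at \<open>P\<close> and \<open>2 P\<close>. By the differential equation this gives the formulas
  \<open>a' = - 19 a - 30 (x\<^sub>P\<^sup>2 + x\<^sub>2\<^sub>P\<^sup>2)\<close> and
  \<open>b' = - 55 b - 42 a (x\<^sub>P + x\<^sub>2\<^sub>P) - 70 (x\<^sub>P\<^sup>3 + x\<^sub>2\<^sub>P\<^sup>3)\<close>. The addition and
  duplication formulas for \<open>\<plusminus>P\<close>, \<open>2 P\<close> yield two relations between \<open>x\<^sub>P + x\<^sub>2\<^sub>P\<close>,
  \<open>x\<^sub>P x\<^sub>2\<^sub>P\<close>, \<open>a\<close> and \<open>b\<close>, and the columns of both matrices hold modulo these relations.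

  The coordinates are unique because the six functions are linearly independent over the modular
  functions of level 1: transporting a relation by representatives of the six cosets of
  \<open>\<Gamma>\<^sub>0(5)\<close> shows that it is orthogonal to six vectors, each with first entry 1, which are
  eigenvectors of the transposed matrix of \<open>a'\<close>. The eigenvalues are the conjugates of \<open>a'\<close>,
  and these are pairwise distinct near the cusp by their q-expansions.\<close>

section \<open>Infinite sums of holomorphic functions\<close>

text \<open>The forms are defined by q-series, while points of order five are governed by lattice
  sums. The bridge is Lipschitz' formula for each row of the lattice, with the values of zeta at 4
  and 6. All of it is read off from pi cot (pi z): its derivatives are sums over the integers
  through the polygamma functions, series in q through the geometric series, and polynomials in the
  cotangent, whose behaviour at 0 yields the zeta values. The definite description in
  \<open>regular_rep\<close> is the main obstacle: column identities do not determine it until the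
  basis is known to be independent. The matrix of a' itself settles this. Its columns rest on the
  two relations and the formula for a', so they hold in the fraction field and also for complex
  numbers at every point of order five of a fixed lattice, where they become eigenvector equations.
  Hence the matrices live over any field of characteristic 0. The modular group acts through
  lattices: each slash of a' or b' is a multiple of the Eisenstein series of a lattice between L and
  L/5, which yields invariance and boundedness at the cusps together.\<close>

lemma infsum_holomorphic_uniform:
  fixes f :: "'i \<Rightarrow> complex \<Rightarrow> complex"
  assumes A: "open A" and f: "\<And>i. i \<in> I \<Longrightarrow> f i holomorphic_on A"
    and M: "\<And>i z. i \<in> I \<Longrightarrow> z \<in> A \<Longrightarrow> norm (f i z) \<le> M i" "M summable_on I"
    and z: "z \<in> A"
  shows "(\<lambda>z. \<Sum>\<^sub>\<infinity>i\<in>I. f i z) analytic_on {z}"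
    and "((\<lambda>i. (deriv ^^ m) (f i) z) has_sum (deriv ^^ m) (\<lambda>z. \<Sum>\<^sub>\<infinity>i\<in>I. f i z) z) I"
proof -
  let ?F = "finite_subsets_at_top I"
  \<comment> \<open>Convergence is uniform along the filter of finite subsets of the index set, so
    no enumeration of lattice points is chosen; derivatives of every order pass to this
    limit.\<close>
  have ul: "uniform_limit A (\<lambda>X y. \<Sum>i\<in>X. f i y) (\<lambda>y. \<Sum>\<^sub>\<infinity>i\<in>I. f i y) ?F"
    by (rule Weierstrass_m_test_general[OF M(1) M(2)])
  have ev: "eventually (\<lambda>X. finite X \<and> X \<subseteq> I) ?F"
    by (simp add: eventually_finite_subsets_at_top_weakI)
  have hol: "eventually (\<lambda>X. (\<lambda>y. \<Sum>i\<in>X. f i y) holomorphic_on A) ?F"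
    using ev by eventually_elim (use f in \<open>auto intro!: holomorphic_on_sum\<close>)
  obtain r where r: "r > 0" "cball z r \<subseteq> A"
    using A z by (meson open_contains_cball)
  have "(\<lambda>y. \<Sum>\<^sub>\<infinity>i\<in>I. f i y) holomorphic_on ball z r"
  proof (rule holomorphic_uniform_limit[OF _ uniform_limit_on_subset[OF ul r(2)]])
    show "\<forall>\<^sub>F X in ?F. continuous_on (cball z r) (\<lambda>y. \<Sum>i\<in>X. f i y) \<and> (\<lambda>y. \<Sum>i\<in>X. f i y) holomorphic_on ball z r"
      using hol
      by eventually_elim
        (meson ball_subset_cball holomorphic_on_imp_continuous_on holomorphic_on_subset r(2))
  qed auto
  then show "(\<lambda>z. \<Sum>\<^sub>\<infinity>i\<in>I. f i z) analytic_on {z}"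
    using r(1) by (metis centre_in_ball holomorphic_on_imp_analytic_at open_ball)
  have "((\<lambda>X. (deriv ^^ m) (\<lambda>y. \<Sum>i\<in>X. f i y) z) \<longlongrightarrow> (deriv ^^ m) (\<lambda>z. \<Sum>\<^sub>\<infinity>i\<in>I. f i z) z) ?F"
    by (rule higher_deriv_complex_uniform_limit[OF ul hol _ A z]) auto
  moreover have "(deriv ^^ m) (\<lambda>y. \<Sum>i\<in>X. f i y) z = (\<Sum>i\<in>X. (deriv ^^ m) (f i) z)"
    if "finite X" "X \<subseteq> I" for X
    using that
  proof (induction X rule: finite_induct)
    case (insert x X)
    have "(deriv ^^ m) (\<lambda>y. f x y + (\<Sum>i\<in>X. f i y)) z = (deriv ^^ m) (f x) z + (deriv ^^ m) (\<lambda>y. \<Sum>i\<in>X. f i y) z"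
      using insert by (intro higher_deriv_add[OF _ _ A z] holomorphic_on_sum f) auto
    with insert show ?case by simp
  qed simp
  then have "eventually (\<lambda>X. (deriv ^^ m) (\<lambda>y. \<Sum>i\<in>X. f i y) z = (\<Sum>i\<in>X. (deriv ^^ m) (f i) z)) ?F"
    using ev by (rule eventually_mono[rotated]) auto
  ultimately show "((\<lambda>i. (deriv ^^ m) (f i) z) has_sum (deriv ^^ m) (\<lambda>z. \<Sum>\<^sub>\<infinity>i\<in>I. f i z) z) I"
    unfolding has_sum_def by (rule Lim_transform_eventually)
qed

text \<open>Lattice points near z spoil a uniform bound but are finite in number. On a compact disc
  around z each of their terms is bounded by continuity, and changing finitely many majorants keeps
  them summable.\<close>

lemma infsum_holomorphic_cofinite:
  fixes f :: "'i \<Rightarrow> complex \<Rightarrow> complex"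
  assumes A: "open A" and f: "\<And>i. i \<in> I \<Longrightarrow> f i holomorphic_on A"
    and F: "finite F"
    and M: "\<And>i z. i \<in> I - F \<Longrightarrow> z \<in> A \<Longrightarrow> norm (f i z) \<le> M i" "M summable_on (I - F)"
    and z: "z \<in> A"
  shows "(\<lambda>z. \<Sum>\<^sub>\<infinity>i\<in>I. f i z) analytic_on {z}"
    and "((\<lambda>i. (deriv ^^ m) (f i) z) has_sum (deriv ^^ m) (\<lambda>z. \<Sum>\<^sub>\<infinity>i\<in>I. f i z) z) I"
proof -
  obtain r where r: "r > 0" "cball z r \<subseteq> A"
    using A z by (meson open_contains_cball)
  have "\<exists>B. \<forall>y\<in>cball z r. norm (f i y) \<le> B" if "i \<in> I" for i
  proof -
    have "compact (f i ` cball z r)"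
      using f[OF that] r by (meson compact_cball compact_continuous_image holomorphic_on_imp_continuous_on holomorphic_on_subset)
    then show ?thesis by (meson bounded_iff compact_imp_bounded imageI)
  qed
  then obtain B where B: "\<And>i y. i \<in> I \<Longrightarrow> y \<in> cball z r \<Longrightarrow> norm (f i y) \<le> B i" by metis
  define M' where "M' i = (if i \<in> F then B i else M i)" for i
  have "M' summable_on (I - F)"
    using M(2) by (rule summable_on_cong[THEN iffD1, rotated]) (auto simp: M'_def)
  then have "M' summable_on ((I - F) \<union> (I \<inter> F))"
    by (rule summable_on_union) (use F in \<open>simp add: summable_on_finite\<close>)
  moreover have "(I - F) \<union> (I \<inter> F) = I" by auto
  ultimately have M': "M' summable_on I" by simp
  have bd: "norm (f i y) \<le> M' i" if "i \<in> I" "y \<in> ball z r" for i y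
    using that B[of i y] M(1)[of i y] subsetD[OF r(2), of y] by (auto simp: M'_def)
  have fb: "f i holomorphic_on ball z r" if "i \<in> I" for i
    using f[OF that] r(2) by (meson ball_subset_cball holomorphic_on_subset)
  show "(\<lambda>z. \<Sum>\<^sub>\<infinity>i\<in>I. f i z) analytic_on {z}"
    "((\<lambda>i. (deriv ^^ m) (f i) z) has_sum (deriv ^^ m) (\<lambda>z. \<Sum>\<^sub>\<infinity>i\<in>I. f i z) z) I"
    using infsum_holomorphic_uniform[OF open_ball fb bd M'] r(1) by auto
qed

lemma DERIV_divide_power:
  fixes c z C :: complex
  assumes "z \<noteq> c"
  shows "((\<lambda>z. C / (z - c) ^ Suc n) has_field_derivative - C * of_nat (Suc n) / (z - c) ^ Suc (Suc n)) (at z)"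
proof -
  define w where "w = z - c"
  have w: "w \<noteq> 0" using assms by (simp add: w_def)
  have "((\<lambda>z. C / (z - c) ^ Suc n) has_field_derivative
      - (C * (of_nat (Suc n) * w ^ n)) / (w ^ Suc n * w ^ Suc n)) (at z)"
    using w unfolding w_def by (auto intro!: derivative_eq_intros simp del: power_Suc of_nat_Suc)
  also have "- (C * (of_nat (Suc n) * w ^ n)) / (w ^ Suc n * w ^ Suc n) = - C * of_nat (Suc n) / w ^ Suc (Suc n)"
    using w by (simp add: divide_simps)
  finally show ?thesis unfolding w_def .
qed

lemma higher_deriv_inverse_power:
  fixes c z :: complex
  assumes "z \<noteq> c"
  shows "(deriv ^^ m) (\<lambda>z. 1 / (z - c) ^ Suc k) z
    = (-1) ^ m * of_nat (pochhammer (Suc k) m) / (z - c) ^ (Suc k + m)"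
  using assms
proof (induction m arbitrary: z)
  case (Suc m)
  have "(deriv ^^ Suc m) (\<lambda>z. 1 / (z - c) ^ Suc k) z = deriv ((deriv ^^ m) (\<lambda>z. 1 / (z - c) ^ Suc k)) z"
    by simp
  also have "\<dots> = deriv (\<lambda>z. (-1) ^ m * of_nat (pochhammer (Suc k) m) / (z - c) ^ (Suc k + m)) z"
  proof (rule deriv_cong_ev)
    have "eventually (\<lambda>w. w \<in> - {c}) (nhds z)"
      using Suc.prems by (intro eventually_nhds_in_open) auto
    then show "\<forall>\<^sub>F x in nhds z. (deriv ^^ m) (\<lambda>z. 1 / (z - c) ^ Suc k) x =
       (- 1) ^ m * of_nat (pochhammer (Suc k) m) / (x - c) ^ (Suc k + m)"
      by eventually_elim (use Suc.IH in auto)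
  qed simp
  also have "\<dots> = (-1) ^ Suc m * of_nat (pochhammer (Suc k) (Suc m)) / (z - c) ^ (Suc k + Suc m)"
    using Suc.prems
    using DERIV_imp_deriv[OF DERIV_divide_power, of z c "(-1) ^ m * of_nat (pochhammer (Suc k) m)" "k + m"]
    by (simp add: pochhammer_rec' algebra_simps)
  finally show ?case .
qed simp

section \<open>Eisenstein series and the Weierstrass function of a lattice\<close>

text \<open>For S = L and k \<ge> 3 this is (-1)^k / (k-1)! times the derivative of order k - 2 of
  the Weierstrass function. The set is a parameter because expansions at 0 use L - {0}, where the
  pole at 0 is removed.\<close>

definition eis_fun :: "complex set \<Rightarrow> nat \<Rightarrow> complex \<Rightarrow> complex" where
  "eis_fun S k z = (\<Sum>\<^sub>\<infinity>\<omega>\<in>S. 1 / (z - \<omega>) ^ k)"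

definition eis :: "complex set \<Rightarrow> nat \<Rightarrow> complex" where
  "eis L k = (\<Sum>\<^sub>\<infinity>\<omega>\<in>L - {0}. 1 / \<omega> ^ k)"

definition wp_reg :: "complex set \<Rightarrow> complex \<Rightarrow> complex" where
  "wp_reg L z = (\<Sum>\<^sub>\<infinity>\<omega>\<in>L - {0}. 1 / (z - \<omega>)\<^sup>2 - 1 / \<omega>\<^sup>2)"

lemma weierstrass_p_eq: "weierstrass_p z L = 1 / z\<^sup>2 + wp_reg L z"
  unfolding weierstrass_p_def wp_reg_def ..

text \<open>No basis is fixed. Summability of the inverse cubes supplies discreteness as well as the
  majorants of the series in z, and cocompactness supplies the boundedness in Liouville's
  theorem.\<close>

locale complex_lattice =
  fixes L :: "complex set"
  assumes zero_in [simp, intro]: "0 \<in> L"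
    and diff_in: "x \<in> L \<Longrightarrow> y \<in> L \<Longrightarrow> x - y \<in> L"
    and summable_inverse_cube: "(\<lambda>\<omega>. 1 / norm \<omega> ^ 3) summable_on (L - {0})"
    and cocompact: "\<exists>R. \<forall>z. \<exists>\<omega>\<in>L. norm (z - \<omega>) \<le> R"
begin

lemma uminus_in: "x \<in> L \<Longrightarrow> - x \<in> L"
  using diff_in[of 0 x] by simp

lemma add_in: "x \<in> L \<Longrightarrow> y \<in> L \<Longrightarrow> x + y \<in> L"
  using diff_in[of x "- y"] uminus_in by auto

lemma uminus_in_iff [simp]: "- x \<in> L \<longleftrightarrow> x \<in> L"
  using uminus_in by force

lemma add_in_iff: "\<omega> \<in> L \<Longrightarrow> z + \<omega> \<in> L \<longleftrightarrow> z \<in> L"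
  using diff_in[of "z + \<omega>" \<omega>] add_in by auto

lemma summable_inverse_cube_subset:
  assumes "S \<subseteq> L - {0}"
  shows "(\<lambda>\<omega>. C / norm \<omega> ^ 3) summable_on S"
proof -
  have "(\<lambda>\<omega>. C * (1 / norm \<omega> ^ 3)) summable_on S"
    by (intro summable_on_cmult_right summable_on_subset_banach[OF summable_inverse_cube assms])
  then show ?thesis by simp
qed

text \<open>Discreteness comes from convergence: infinitely many points in a ball of radius r would
  each contribute at least 1/r^3 to the sum.\<close>

lemma finite_ball: "finite {\<omega>\<in>L. norm \<omega> \<le> r}"
proof -
  have "finite {\<omega>\<in>L-{0}. norm \<omega> \<le> r}"
  proof (cases "r > 0")
    case True
    let ?S = "{\<omega>\<in>L-{0}. norm \<omega> \<le> r}"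
    have "(\<lambda>\<omega>. 1 / norm \<omega> ^ 3) summable_on ?S"
      by (rule summable_on_subset_banach[OF summable_inverse_cube]) auto
    then have "(\<lambda>\<omega>::complex. 1 / r ^ 3) summable_on ?S"
    proof (rule summable_on_comparison_test)
      fix \<omega> assume "\<omega> \<in> ?S"
      then have "norm \<omega> > 0" "norm \<omega> ^ 3 \<le> r ^ 3" by (auto intro: power_mono)
      then show "1 / r ^ 3 \<le> 1 / norm \<omega> ^ 3"
        by (intro divide_left_mono) (auto intro!: mult_pos_pos simp: True)
    qed (use True in simp)
    moreover have "1 / r ^ 3 \<noteq> 0" using True by simp
    ultimately show ?thesis
      using infsum_diverge_constant by blast
  next
    case False
    have "\<not> norm \<omega> \<le> r" if "\<omega> \<noteq> 0" for \<omega> :: complex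
      using that False zero_less_norm_iff[of \<omega>] by linarith
    then have "{\<omega>\<in>L-{0}. norm \<omega> \<le> r} = {}" by blast
    then show ?thesis by (metis finite.emptyI)
  qed
  then have "finite (insert 0 {\<omega>\<in>L-{0}. norm \<omega> \<le> r})" by (rule finite.insertI)
  moreover have "{\<omega>\<in>L. norm \<omega> \<le> r} \<subseteq> insert 0 {\<omega>\<in>L-{0}. norm \<omega> \<le> r}" by blast
  ultimately show ?thesis by (rule finite_subset[rotated])
qed

lemma isolated: "\<exists>e>0. \<forall>\<omega>\<in>L. \<omega> \<noteq> z \<longrightarrow> e \<le> dist z \<omega>"
proof -
  obtain d where d: "d > 0" "\<forall>x\<in>{\<omega>\<in>L. norm \<omega> \<le> norm z + 1}. x \<noteq> z \<longrightarrow> d \<le> dist z x"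
    using finite_set_avoid[OF finite_ball[of "norm z + 1"], of z] by metis
  have "min d 1 \<le> dist z \<omega>" if "\<omega> \<in> L" "\<omega> \<noteq> z" for \<omega>
  proof (cases "norm \<omega> \<le> norm z + 1")
    case True
    then have "d \<le> dist z \<omega>" using d(2) that by simp
    then show ?thesis by linarith
  next
    case False
    then show ?thesis
      using norm_triangle_ineq2[of \<omega> z] by (simp add: dist_norm norm_minus_commute)
  qed
  moreover have "min d 1 > 0" using d(1) by simp
  ultimately show ?thesis by metis
qed

lemma open_compl:
  assumes "S \<subseteq> L"
  shows "open (- S)"
proof (rule openI)
  fix z assume z: "z \<in> - S"
  obtain e where e: "e > 0" "\<forall>\<omega>\<in>L. \<omega> \<noteq> z \<longrightarrow> e \<le> dist z \<omega>" using isolated by blast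
  then have "ball z e \<subseteq> - S"
    using z assms by (fastforce simp: subset_iff)
  then show "\<exists>T>0. ball z T \<subseteq> - S" using e by blast
qed

lemma countable: "countable L"
proof -
  have "\<exists>n::nat. norm \<omega> \<le> real n" for \<omega> :: complex
    by (rule real_arch_simple)
  then have "L = (\<Union>n::nat. {\<omega>\<in>L. norm \<omega> \<le> real n})" by blast
  moreover have "countable (\<Union>n::nat. {\<omega>\<in>L. norm \<omega> \<le> real n})"
    by (rule countable_UN) (rule countableI_type, rule countable_finite, rule finite_ball)
  ultimately show ?thesis by (rule ssubst)
qed

lemma eis_fun_sum:
  assumes S: "S \<subseteq> L" and z: "z \<notin> S" and k: "k \<ge> 3"
  shows "eis_fun S k analytic_on {z}"
    and "((\<lambda>\<omega>. (deriv ^^ m) (\<lambda>z. 1 / (z - \<omega>) ^ k) z) has_sum (deriv ^^ m) (eis_fun S k) z) S"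
proof -
  define R where "R = norm z + 1"
  define A where "A = ball 0 R - S"
  define F where "F = {\<omega>\<in>L. norm \<omega> \<le> 2 * R}"
  have R: "R \<ge> 1" by (simp add: R_def)
  have A: "open A" unfolding A_def Diff_eq by (intro open_Int open_ball open_compl S)
  \<comment> \<open>For |y| < R and |\<omega>| > 2R the distance |y - \<omega>| is at least
    |\<omega>|/2, hence the factor 8 = 2^3. It also exceeds 1 because R \<ge> 1, which allows the
    exponent k to be lowered to 3.\<close>
  have bd: "norm (1 / (y - \<omega>) ^ k) \<le> 8 / norm \<omega> ^ 3" if "\<omega> \<in> S - F" "y \<in> A" for \<omega> y
  proof -
    have w: "norm \<omega> > 2 * R" using that S by (auto simp: F_def)
    have y: "norm y < R" using that by (auto simp: A_def)
    have 1: "norm (y - \<omega>) \<ge> norm \<omega> / 2"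
      using norm_triangle_ineq2[of \<omega> y] w y by (simp add: norm_minus_commute)
    have "(norm \<omega> / 2) ^ 3 \<le> norm (y - \<omega>) ^ 3" using 1 by (intro power_mono) auto
    also have "\<dots> \<le> norm (y - \<omega>) ^ k"
      using 1 w R k by (intro power_increasing) auto
    finally have "1 / norm (y - \<omega>) ^ k \<le> 1 / (norm \<omega> / 2) ^ 3"
      using w R 1 by (intro divide_left_mono mult_pos_pos zero_less_power) (auto simp del: zero_less_norm_iff)
    then show ?thesis by (simp add: norm_divide norm_power power_divide)
  qed
  have summ: "(\<lambda>\<omega>. 8 / norm \<omega> ^ 3) summable_on (S - F)"
    using S R by (intro summable_inverse_cube_subset) (auto simp: F_def)
  have hol: "(\<lambda>y. 1 / (y - \<omega>) ^ k) holomorphic_on A" if "\<omega> \<in> S" for \<omega>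
    using that by (intro holomorphic_intros) (auto simp: A_def)
  have zA: "z \<in> A" using z by (auto simp: A_def R_def)
  have "finite F" unfolding F_def by (rule finite_ball)
  note * = infsum_holomorphic_cofinite[OF A hol \<open>finite F\<close> bd summ zA]
  show "eis_fun S k analytic_on {z}" using *(1) unfolding eis_fun_def .
  show "((\<lambda>\<omega>. (deriv ^^ m) (\<lambda>z. 1 / (z - \<omega>) ^ k) z) has_sum (deriv ^^ m) (eis_fun S k) z) S"
    using *(2) unfolding eis_fun_def .
qed

lemma eis_fun_has_sum:
  assumes "S \<subseteq> L" "z \<notin> S" "k \<ge> 3"
  shows "((\<lambda>\<omega>. 1 / (z - \<omega>) ^ k) has_sum eis_fun S k z) S"
  using eis_fun_sum(2)[OF assms, of 0] by simp

lemma eis_fun_deriv: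
  assumes "S \<subseteq> L" "z \<notin> S" "k \<ge> 3"
  shows "(eis_fun S k has_field_derivative - of_nat k * eis_fun S (Suc k) z) (at z)"
proof -
  obtain k' where k: "k = Suc k'" using assms by (cases k) auto
  have "(deriv ^^ 1) (\<lambda>z. 1 / (z - \<omega>) ^ k) z = - of_nat k * (1 / (z - \<omega>) ^ Suc k)" if "\<omega> \<in> S" for \<omega>
  proof -
    have "z \<noteq> \<omega>" using that assms by auto
    then show ?thesis using higher_deriv_inverse_power[of z \<omega> 1 k'] by (simp add: k)
  qed
  note eq = this
  have "((\<lambda>\<omega>. - of_nat k * (1 / (z - \<omega>) ^ Suc k)) has_sum (deriv ^^ 1) (eis_fun S k) z) S"
    by (rule iffD1[OF has_sum_cong[OF eq] eis_fun_sum(2)[OF assms, of 1]])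
  then have "((\<lambda>\<omega>. - of_nat k * (1 / (z - \<omega>) ^ Suc k)) has_sum deriv (eis_fun S k) z) S" by simp
  moreover have "((\<lambda>\<omega>. - of_nat k * (1 / (z - \<omega>) ^ Suc k)) has_sum - of_nat k * eis_fun S (Suc k) z) S"
    using assms by (intro has_sum_cmult_right eis_fun_has_sum) auto
  ultimately have "deriv (eis_fun S k) z = - of_nat k * eis_fun S (Suc k) z"
    by (rule has_sum_unique)
  moreover have "eis_fun S k field_differentiable (at z)"
    using eis_fun_sum(1)[OF assms] by (rule analytic_on_imp_differentiable_at) simp
  ultimately show ?thesis
    using field_differentiable_derivI by fastforce
qed

lemma eis_fun_insert:
  assumes "z \<notin> L" "k \<ge> 3"
  shows "eis_fun L k z = 1 / z ^ k + eis_fun (L - {0}) k z"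
proof -
  have "((\<lambda>\<omega>. 1 / (z - \<omega>) ^ k) has_sum 1 / (z - 0) ^ k + eis_fun (L - {0}) k z) (insert 0 (L - {0}))"
    using assms by (intro has_sum_insert eis_fun_has_sum) auto
  then have "((\<lambda>\<omega>. 1 / (z - \<omega>) ^ k) has_sum 1 / z ^ k + eis_fun (L - {0}) k z) L"
    by (simp add: insert_absorb)
  then show ?thesis unfolding eis_fun_def by (rule infsumI)
qed

lemma eis_fun_periodic:
  assumes "\<omega> \<in> L"
  shows "eis_fun L k (z + \<omega>) = eis_fun L k z"
  unfolding eis_fun_def
  by (rule infsum_reindex_bij_witness[of _ "\<lambda>w. w + \<omega>" "\<lambda>w. w - \<omega>"]) (use assms in \<open>auto simp: algebra_simps intro: add_in diff_in\<close>)

lemma eis_fun_uminus: "eis_fun L k (- z) = (-1) ^ k * eis_fun L k z"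
proof -
  have eq: "1 / (- x) ^ k = (-1) ^ k * (1 / x ^ k)" for x :: complex
    unfolding power_minus[of x] by (cases "even k") auto
  have "eis_fun L k (- z) = (\<Sum>\<^sub>\<infinity>\<omega>\<in>L. 1 / (- (z - \<omega>)) ^ k)"
    unfolding eis_fun_def
  proof (rule infsum_reindex_bij_witness[of _ uminus uminus])
    show "1 / (- (z - (- \<omega>))) ^ k = 1 / (- z - \<omega>) ^ k" for \<omega>
      by (rule arg_cong[of _ _ "\<lambda>u. 1 / u ^ k"]) simp
  qed (simp_all only: minus_minus uminus_in_iff)
  also have "\<dots> = (-1) ^ k * eis_fun L k z"
    unfolding eis_fun_def eq by (rule infsum_cmult_right')
  finally show ?thesis .
qed

lemma eis_has_sum:
  assumes "k \<ge> 3"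
  shows "((\<lambda>\<omega>. 1 / \<omega> ^ k) has_sum eis L k) (L - {0})"
proof -
  have eq: "(-1) ^ k * (1 / (0 - \<omega>) ^ k) = 1 / \<omega> ^ k" for \<omega> :: complex
    by (cases "even k") simp_all
  have "(\<lambda>\<omega>. (-1) ^ k * (1 / (0 - \<omega>) ^ k)) summable_on (L - {0})"
    using assms by (intro summable_on_cmult_right has_sum_imp_summable[OF eis_fun_has_sum]) auto
  then have "(\<lambda>\<omega>. 1 / \<omega> ^ k) summable_on (L - {0})" unfolding eq .
  then show ?thesis unfolding eis_def by (rule has_sum_infsum)
qed

lemma eis_odd:
  assumes "odd k"
  shows "eis L k = 0"
proof -
  have "eis L k = (\<Sum>\<^sub>\<infinity>\<omega>\<in>L - {0}. - (1 / \<omega> ^ k))"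
    unfolding eis_def
    by (rule infsum_reindex_bij_witness[of _ uminus uminus]) (use assms in simp_all)
  also have "\<dots> = - eis L k"
    unfolding eis_def by (rule infsum_uminus)
  finally have "2 * eis L k = 0"
    by (simp only: eq_neg_iff_add_eq_0 mult_2)
  then show ?thesis by simp
qed

lemma eis_fun_at_0: "even k \<Longrightarrow> eis_fun (L - {0}) k 0 = eis L k"
  unfolding eis_fun_def eis_def by simp

end

section \<open>Derivatives, parity and periods of the Weierstrass function\<close>

context complex_lattice
begin

lemma wp_reg_sum:
  assumes z: "z \<notin> L - {0}"
  shows "wp_reg L analytic_on {z}"
    and "((\<lambda>\<omega>. (deriv ^^ m) (\<lambda>z. 1 / (z - \<omega>)\<^sup>2 - 1 / \<omega>\<^sup>2) z) has_sum (deriv ^^ m) (wp_reg L) z) (L - {0})"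
proof -
  define R where "R = norm z + 1"
  define A where "A = ball 0 R - (L - {0})"
  define F where "F = {\<omega>\<in>L. norm \<omega> \<le> 2 * R}"
  have R: "R \<ge> 1" by (simp add: R_def)
  have "open (ball 0 R \<inter> - (L - {0}))" by (intro open_Int open_ball open_compl) blast
  then have A: "open A" by (simp add: A_def Diff_eq)
  \<comment> \<open>Over a common denominator the difference is y (2 \<omega> - y) / (\<omega>^2 (y
    - \<omega>)^2), which decays like an inverse cube; 10 R arises from |2 \<omega> - y| \<le> (5/2)
    |\<omega>| and |y - \<omega>| \<ge> |\<omega>|/2.\<close>
  have bd: "norm (1 / (y - \<omega>)\<^sup>2 - 1 / \<omega>\<^sup>2) \<le> (10 * R) / norm \<omega> ^ 3" if "\<omega> \<in> (L - {0}) - F" "y \<in> A" for \<omega> y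
  proof -
    have w: "norm \<omega> > 2 * R" using that by (auto simp: F_def)
    have y: "norm y < R" using that by (auto simp: A_def)
    have 1: "norm (y - \<omega>) \<ge> norm \<omega> / 2"
      using norm_triangle_ineq2[of \<omega> y] w y by (simp add: norm_minus_commute)
    have nz: "norm \<omega> > 0" "norm (y - \<omega>) > 0" using 1 w R by linarith+
    then have nz': "\<omega> \<noteq> 0" "y - \<omega> \<noteq> 0" by auto
    then have "1 / (y - \<omega>)\<^sup>2 - 1 / \<omega>\<^sup>2 = y * (2 * \<omega> - y) / (\<omega>\<^sup>2 * (y - \<omega>)\<^sup>2)"
      by (simp add: divide_simps) (simp add: algebra_simps power2_eq_square)
    then have "norm (1 / (y - \<omega>)\<^sup>2 - 1 / \<omega>\<^sup>2) = norm y * norm (2 * \<omega> - y) / (norm \<omega> ^ 2 * norm (y - \<omega>) ^ 2)"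
      by (simp add: norm_divide norm_mult norm_power)
    also have "\<dots> \<le> (R * (5/2 * norm \<omega>)) / (norm \<omega> ^ 2 * (norm \<omega> / 2) ^ 2)"
    proof (rule frac_le)
      have "norm (2 * \<omega> - y) \<le> 2 * norm \<omega> + norm y"
        using norm_triangle_ineq4[of "2 * \<omega>" y] by (simp add: norm_mult)
      then show "norm y * norm (2 * \<omega> - y) \<le> R * (5/2 * norm \<omega>)"
        using w y R by (intro mult_mono) auto
      show "(norm \<omega>)\<^sup>2 * (norm \<omega> / 2)\<^sup>2 \<le> (norm \<omega>)\<^sup>2 * (norm (y - \<omega>))\<^sup>2"
        using 1 by (intro mult_left_mono power_mono) auto
      show "0 < (norm \<omega>)\<^sup>2 * (norm \<omega> / 2)\<^sup>2" using nz by simp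
    qed (use nz R in simp)
    also have "\<dots> = (10 * R) / norm \<omega> ^ 3"
      using nz by (simp add: power2_eq_square power3_eq_cube)
    finally show ?thesis .
  qed
  have summ: "(\<lambda>\<omega>. (10 * R) / norm \<omega> ^ 3) summable_on ((L - {0}) - F)"
    by (intro summable_inverse_cube_subset) blast
  have hol: "(\<lambda>y. 1 / (y - \<omega>)\<^sup>2 - 1 / \<omega>\<^sup>2) holomorphic_on A" if "\<omega> \<in> L - {0}" for \<omega>
    using that by (intro holomorphic_intros) (auto simp: A_def)
  have zA: "z \<in> A" using z by (auto simp: A_def R_def)
  have "finite F" unfolding F_def by (rule finite_ball)
  note * = infsum_holomorphic_cofinite[OF A hol \<open>finite F\<close> bd summ zA]
  show "wp_reg L analytic_on {z}" using *(1) unfolding wp_reg_def .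
  show "((\<lambda>\<omega>. (deriv ^^ m) (\<lambda>z. 1 / (z - \<omega>)\<^sup>2 - 1 / \<omega>\<^sup>2) z) has_sum (deriv ^^ m) (wp_reg L) z) (L - {0})"
    using *(2) unfolding wp_reg_def .
qed

lemma wp_reg_higher_deriv:
  assumes z: "z \<notin> L - {0}" and m: "m > 0"
  shows "(deriv ^^ m) (wp_reg L) z = (-1) ^ m * fact (Suc m) * eis_fun (L - {0}) (m + 2) z"
proof -
  have eq: "(deriv ^^ m) (\<lambda>z. 1 / (z - \<omega>)\<^sup>2 - 1 / \<omega>\<^sup>2) z = (-1) ^ m * fact (Suc m) * (1 / (z - \<omega>) ^ (m + 2))"
    if "\<omega> \<in> L - {0}" for \<omega>
  proof -
    have ne: "z \<noteq> \<omega>" using that z by auto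
    have "(deriv ^^ m) (\<lambda>z. 1 / (z - \<omega>)\<^sup>2 - 1 / \<omega>\<^sup>2) z
      = (deriv ^^ m) (\<lambda>z. 1 / (z - \<omega>)\<^sup>2) z - (deriv ^^ m) (\<lambda>z. 1 / \<omega>\<^sup>2) z"
      by (rule higher_deriv_diff[of _ "- {\<omega>}"]) (use ne in \<open>auto intro!: holomorphic_intros\<close>)
    also have "(deriv ^^ m) (\<lambda>z. 1 / \<omega>\<^sup>2) z = 0" using m by simp
    also have "(deriv ^^ m) (\<lambda>z. 1 / (z - \<omega>)\<^sup>2) z = (-1) ^ m * of_nat (pochhammer (Suc 1) m) / (z - \<omega>) ^ (Suc 1 + m)"
      using higher_deriv_inverse_power[OF ne, of m 1] by (simp add: numeral_2_eq_2)
    also have "pochhammer (Suc 1) m = fact (Suc m)"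
      using pochhammer_rec[of "1::nat" m] by (simp add: pochhammer_fact)
    finally show ?thesis by (simp add: distrib_right)
  qed
  have "((\<lambda>\<omega>. (-1) ^ m * fact (Suc m) * (1 / (z - \<omega>) ^ (m + 2))) has_sum (deriv ^^ m) (wp_reg L) z) (L - {0})"
    by (rule iffD1[OF has_sum_cong[OF eq] wp_reg_sum(2)[OF z, of m]])
  moreover have "((\<lambda>\<omega>. (-1) ^ m * fact (Suc m) * (1 / (z - \<omega>) ^ (m + 2))) has_sum
      (-1) ^ m * fact (Suc m) * eis_fun (L - {0}) (m + 2) z) (L - {0})"
    using m z by (intro has_sum_cmult_right eis_fun_has_sum) auto
  ultimately show ?thesis by (rule has_sum_unique)
qed

abbreviation "\<P> z \<equiv> weierstrass_p z L"
abbreviation "G \<equiv> eis L"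
abbreviation "E \<equiv> eis_fun L"

lemma wp_deriv:
  assumes z: "z \<notin> L"
  shows "((\<lambda>z. \<P> z) has_field_derivative - 2 * E 3 z) (at z)"
proof -
  have "wp_reg L field_differentiable (at z)"
    using wp_reg_sum(1)[of z] z by (intro analytic_on_imp_differentiable_at[of _ "{z}"]) auto
  then have "(wp_reg L has_field_derivative - 2 * eis_fun (L - {0}) 3 z) (at z)"
    using wp_reg_higher_deriv[of z 1] z field_differentiable_derivI[of "wp_reg L" z]
    by (simp add: numeral_3_eq_3)
  moreover have "((\<lambda>z. 1 / (z - 0) ^ Suc 1) has_field_derivative - 1 * of_nat (Suc 1) / (z - 0) ^ Suc (Suc 1)) (at z)"
    by (rule DERIV_divide_power) (use z zero_in in auto)
  ultimately have "((\<lambda>z. 1 / (z - 0) ^ Suc 1 + wp_reg L z) has_field_derivative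
      - 1 * of_nat (Suc 1) / (z - 0) ^ Suc (Suc 1) + - 2 * eis_fun (L - {0}) 3 z) (at z)"
    by (intro DERIV_add)
  moreover have "- 1 * of_nat (Suc 1) / (z - 0) ^ Suc (Suc 1) + - 2 * eis_fun (L - {0}) 3 z = - 2 * E 3 z"
    using eis_fun_insert[OF z, of 3] by (simp add: eval_nat_numeral)
  moreover have "(\<lambda>z. 1 / (z - 0) ^ Suc 1 + wp_reg L z) = (\<lambda>z. \<P> z)"
    by (simp add: weierstrass_p_eq power2_eq_square)
  ultimately show ?thesis by simp
qed

lemma E_deriv: "z \<notin> L \<Longrightarrow> k \<ge> 3 \<Longrightarrow> (E k has_field_derivative - of_nat k * E (Suc k) z) (at z)"
  by (rule eis_fun_deriv) auto

lemma wp_uminus: "\<P> (- z) = \<P> z"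
proof -
  have "wp_reg L (- z) = wp_reg L z"
    unfolding wp_reg_def
    by (rule infsum_reindex_bij_witness[of _ uminus uminus]) (simp_all add: power2_commute add.commute)
  then show ?thesis by (simp add: weierstrass_p_eq)
qed

lemma open_compl_L: "open (- L)" by (rule open_compl) blast

lemma connected_compl: "countable S \<Longrightarrow> connected (- S :: complex set)"
  by (intro path_connected_imp_connected path_connected_complement_countable) auto

text \<open>The derivative is visibly periodic, so the increment is a constant c on the complement
  of L, which is connected because L is countable. Evenness then forces c = - c.\<close>

lemma wp_periodic:
  assumes w: "\<omega> \<in> L" and z: "z \<notin> L"
  shows "\<P> (z + \<omega>) = \<P> z"
proof -
  have d: "((\<lambda>z. \<P> (z + \<omega>) - \<P> z) has_field_derivative 0) (at z)" if "z \<notin> L" for z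
  proof -
    have "z + \<omega> \<notin> L" using that w by (simp add: add_in_iff)
    then have "((\<lambda>z. \<P> (z + \<omega>)) has_field_derivative - 2 * E 3 (z + \<omega>)) (at z)"
      by (intro iffD1[OF DERIV_shift wp_deriv])
    then have "((\<lambda>z. \<P> (z + \<omega>)) has_field_derivative - 2 * E 3 z) (at z)"
      by (simp only: eis_fun_periodic[OF w])
    from DERIV_diff[OF this wp_deriv[OF that]] show ?thesis by simp
  qed
  have "(\<lambda>z. \<P> (z + \<omega>) - \<P> z) constant_on (- L)"
    by (rule has_field_derivative_0_imp_constant_on[OF d])
      (use connected_compl[OF countable] open_compl_L in auto)
  then obtain c where c: "\<And>z. z \<notin> L \<Longrightarrow> \<P> (z + \<omega>) - \<P> z = c"
    by (force simp: constant_on_def)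
  \<comment> \<open>The point \<open>- (z + \<omega>)\<close> plays the role of the half period -
    \<omega>/2, which could itself lie in L.\<close>
  have "- (z + \<omega>) \<notin> L" using z w by (simp only: uminus_in_iff add_in_iff not_False_eq_True)
  then have "\<P> (- (z + \<omega>) + \<omega>) - \<P> (- (z + \<omega>)) = c" by (rule c)
  moreover have "- (z + \<omega>) + \<omega> = - z" by simp
  ultimately have "\<P> z - \<P> (z + \<omega>) = c" by (simp only: wp_uminus)
  with c[OF z] have "2 * (\<P> z - \<P> (z + \<omega>)) = 0"
    by (simp add: algebra_simps)
  then show ?thesis by simp
qed

end

section \<open>Expansions at 0 and identities between elliptic functions\<close>

context complex_lattice
begin

lemma eventually_notin_L: "eventually (\<lambda>z. z \<notin> L) (at z0)"
proof -
  obtain e where e: "e > 0" "\<forall>\<omega>\<in>L. \<omega> \<noteq> z0 \<longrightarrow> e \<le> dist z0 \<omega>" using isolated by blast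
  have "z \<notin> L" if "z \<noteq> z0" "dist z z0 < e" for z
    using e(2) that by (metis dist_commute not_less)
  then show ?thesis
    unfolding eventually_at using e(1) by (intro exI[of _ e]) auto
qed

lemma eis_fun_0: "k \<ge> 3 \<Longrightarrow> eis_fun (L - {0}) k 0 = G k"
  using eis_fun_at_0[of k] eis_odd[of k]
proof (cases "even k")
  case False
  have "eis_fun (L - {0}) k 0 = (\<Sum>\<^sub>\<infinity>\<omega>\<in>L - {0}. - (1 / \<omega> ^ k))"
    unfolding eis_fun_def by (rule infsum_cong) (use False in simp)
  also have "\<dots> = - G k" unfolding eis_def by (rule infsum_uminus)
  finally show ?thesis using False eis_odd by simp
qed simp

text \<open>For n > 0 the Taylor coefficient of \<open>wp_reg L\<close> at z^n is (n + 1)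
  \<open>G (n + 2)\<close> up to sign. It vanishes for odd n by the symmetry of L, so 3
  \<open>G 4\<close> and 5 \<open>G 6\<close> are the first terms that occur.\<close>

lemma tendsto_wp_reg:
  "((\<lambda>z. (wp_reg L z - 3 * G 4 * z ^ 2) / z ^ 4) \<longlongrightarrow> 5 * G 6) (at 0)"
proof -
  define F where "F = fps_expansion (wp_reg L) 0"
  have an: "wp_reg L analytic_on {0}" by (rule wp_reg_sum) simp
  have F: "wp_reg L has_fps_expansion F"
    unfolding F_def by (rule analytic_at_imp_has_fps_expansion_0[OF an])
  have nth: "fps_nth F n = (-1) ^ n * of_nat (Suc n) * G (n + 2)" if "n > 0" for n
  proof -
    have "fps_nth F n = (-1) ^ n * fact (Suc n) * G (n + 2) / fact n"
      using fps_nth_fps_expansion[OF F, of n] wp_reg_higher_deriv[of 0 n] eis_fun_0[of "n + 2"] that by simp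
    then show ?thesis by (simp add: fact_Suc del: of_nat_Suc)
  qed
  have nth0: "fps_nth F 0 = 0"
    using fps_nth_fps_expansion[OF F, of 0] by (simp add: wp_reg_def)
  define F' where "F' = F - fps_const (3 * G 4) * fps_X ^ 2"
  have nth': "fps_nth F' n = (if n = 2 then 0 else fps_nth F n)" for n
    using nth[of 2] by (auto simp: F'_def)
  have F': "(\<lambda>z. wp_reg L z - 3 * G 4 * z ^ 2) has_fps_expansion F'"
    unfolding F'_def by (intro fps_expansion_intros F)
  have "fps_nth F' n = 0" if "n < 4" for n
  proof -
    from that consider "n = 0" | "n = 1" | "n = 2" | "n = 3" by linarith
    then show ?thesis
      using nth0 nth[of 1] nth[of 3] eis_odd[of "Suc (Suc (Suc 0))"] eis_odd[of 5] by cases (auto simp: nth')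
  qed
  moreover have "fps_nth F' 4 = 5 * G 6" using nth[of 4] by (simp add: nth')
  ultimately show ?thesis
  proof (cases "F' = 0")
    \<comment> \<open>The zero series has subdegree 0, so the shift by 4 does not cover it and the
      limit is read off directly.\<close>
    case True
    then have "G 6 = 0" using \<open>fps_nth F' 4 = 5 * G 6\<close> by simp
    have "eventually (\<lambda>z. wp_reg L z - 3 * G 4 * z ^ 2 = 0) (nhds 0)"
      using F' True by (simp add: has_fps_expansion_0_iff)
    then have "eventually (\<lambda>z. (wp_reg L z - 3 * G 4 * z ^ 2) / z ^ 4 = 0) (at 0)"
      by (auto simp: eventually_at_filter elim: eventually_mono)
    then show ?thesis using \<open>G 6 = 0\<close> by (simp add: tendsto_eventually)
  next
    case False
    then have "subdegree F' \<ge> 4"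
      using \<open>\<And>n. n < 4 \<Longrightarrow> fps_nth F' n = 0\<close> by (intro subdegree_geI) auto
    have 1: "(\<lambda>z. if z = 0 then 5 * G 6 else (wp_reg L z - 3 * G 4 * z ^ 2) / z ^ 4) has_fps_expansion fps_shift 4 F'"
      by (rule has_fps_expansion_shift[OF F' \<open>subdegree F' \<ge> 4\<close>]) (simp add: \<open>fps_nth F' 4 = 5 * G 6\<close>)
    have "((\<lambda>z. if z = 0 then 5 * G 6 else (wp_reg L z - 3 * G 4 * z ^ 2) / z ^ 4) \<longlongrightarrow> 5 * G 6) (at 0)"
      using has_fps_expansion_imp_continuous[OF 1, of UNIV] by (simp add: continuous_within)
    then show ?thesis
      by (rule Lim_transform_eventually) (auto simp: eventually_at_filter)
  qed
qed

lemma tendsto_eis_fun_0: "k \<ge> 3 \<Longrightarrow> (eis_fun (L - {0}) k \<longlongrightarrow> G k) (at 0)"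
  using eis_fun_sum(1)[of "L - {0}" 0 k] eis_fun_0[of k] analytic_at_imp_isCont
  by (fastforce simp: isCont_def)

text \<open>By periodicity a finite limit at 0 removes the singularity at every lattice point, and
  the extension takes all its values on a compact disc, so Liouville's theorem applies. An identity
  between elliptic functions is thereby reduced to one limit at 0.\<close>

lemma elliptic_constant:
  assumes hol: "h holomorphic_on (- L)"
    and per: "\<And>z \<omega>. z \<notin> L \<Longrightarrow> \<omega> \<in> L \<Longrightarrow> h (z + \<omega>) = h z"
    and lim: "(h \<longlongrightarrow> c) (at 0)"
    and z: "z \<notin> L"
  shows "h z = c"
proof -
  define H where "H z = (if z \<in> L then c else h z)" for z
  have per': "H (z + \<omega>) = H z" if "\<omega> \<in> L" for z \<omega>
    using that per by (simp add: H_def add_in_iff)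
  have ev0: "eventually (\<lambda>z. h z = H z) (at 0)"
    using eventually_notin_L[of 0] by eventually_elim (simp add: H_def)
  have lim0: "(H \<longlongrightarrow> c) (at 0)"
    using lim ev0 by (rule Lim_transform_eventually)
  have cont: "isCont H \<omega>" if "\<omega> \<in> L" for \<omega>
  proof -
    have "H \<omega> = c" using that by (simp add: H_def)
    then have "((\<lambda>z. H (z + \<omega>)) \<longlongrightarrow> H \<omega>) (at 0)"
      using lim0 by (simp only: per'[OF that])
    then show ?thesis by (simp add: isCont_def LIM_offset_zero_iff add.commute)
  qed
  have hol': "H holomorphic_on (- L)"
    using hol by (rule holomorphic_transform) (simp add: H_def)
  have an: "H analytic_on {w}" for w
  proof (cases "w \<in> L")
    case False
    then show ?thesis
      using hol' open_compl_L by (meson ComplI holomorphic_on_imp_analytic_at)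
  next
    case True
    obtain e where e: "e > 0" "\<forall>\<omega>\<in>L. \<omega> \<noteq> w \<longrightarrow> e \<le> dist w \<omega>" using isolated by blast
    have "z \<notin> L" if "z \<in> ball w e - {w}" for z
    proof
      assume "z \<in> L"
      with e that have "e \<le> dist w z" by blast
      with that show False by simp
    qed
    then have sub: "ball w e - {w} \<subseteq> - L" by blast
    have holp: "H holomorphic_on (ball w e - {w})"
      using hol' sub by (rule holomorphic_on_subset)
    have "continuous_on (ball w e) H"
    proof (rule continuous_at_imp_continuous_on, rule ballI)
      fix x assume "x \<in> ball w e"
      show "isCont H x"
      proof (cases "x = w")
        case False
        then show ?thesis
          using \<open>x \<in> ball w e\<close> holomorphic_on_imp_continuous_on[OF holp]
            continuous_on_eq_continuous_at[OF open_delete[OF open_ball[of w e]], of w H]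
          by blast
      qed (use cont True in simp)
    qed
    then have "H holomorphic_on (ball w e)"
      by (rule no_isolated_singularity[OF _ holp]) simp_all
    then show ?thesis using e(1) by (meson centre_in_ball holomorphic_on_imp_analytic_at open_ball)
  qed
  note an = this
  have holU: "H holomorphic_on UNIV"
  proof (rule analytic_imp_holomorphic)
    show "H analytic_on UNIV" by (subst analytic_on_analytic_at) (use an in blast)
  qed
  obtain R where R: "\<And>z. \<exists>\<omega>\<in>L. norm (z - \<omega>) \<le> R" using cocompact by blast
  have "compact (H ` cball 0 R)"
    using holU by (intro compact_continuous_image holomorphic_on_imp_continuous_on) (auto intro: holomorphic_on_subset)
  moreover have "range H \<subseteq> H ` cball 0 R"
  proof safe
    fix z
    obtain \<omega> where w: "\<omega> \<in> L" "norm (z - \<omega>) \<le> R" using R by blast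
    have "H z = H (z - \<omega>)" using per'[OF w(1), of "z - \<omega>"] by simp
    then show "H z \<in> H ` cball 0 R" using w(2) by (intro image_eqI[of _ _ "z - \<omega>"]) auto
  qed
  ultimately have "bounded (range H)" by (meson bounded_subset compact_imp_bounded)
  then have "H constant_on UNIV" using holU by (intro Liouville_theorem)
  then obtain d where d: "\<And>z. H z = d" unfolding constant_on_def by blast
  have "H 0 = c" by (simp add: H_def)
  then have "H z = c" using d by metis
  then show ?thesis using z by (simp add: H_def)
qed

lemma wp_holomorphic: "(\<lambda>z. \<P> z) holomorphic_on (- L)"
  using wp_deriv open_compl_L by (subst holomorphic_on_open) auto

lemma E_holomorphic: "k \<ge> 3 \<Longrightarrow> E k holomorphic_on (- L)"
  using E_deriv open_compl_L by (subst holomorphic_on_open) auto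

lemma eventually_wp_reg_expand:
  obtains \<rho> where "(\<rho> \<longlongrightarrow> 5 * G 6) (at 0)"
    and "\<And>z. z \<noteq> 0 \<Longrightarrow> \<P> z = 1 / z ^ 2 + 3 * G 4 * z ^ 2 + z ^ 4 * \<rho> z"
proof
  show "((\<lambda>z. (wp_reg L z - 3 * G 4 * z ^ 2) / z ^ 4) \<longlongrightarrow> 5 * G 6) (at 0)" by (rule tendsto_wp_reg)
qed (simp add: weierstrass_p_eq)

text \<open>The poles of order 4 cancel. The constant term at 0 of the square of the Weierstrass
  function is 6 \<open>G 4\<close> and that of \<open>E 4\<close> is \<open>G 4\<close>, whence the
  coefficient 5.\<close>

lemma E4_eq:
  assumes z: "z \<notin> L"
  shows "E 4 z = (\<P> z)\<^sup>2 - 5 * G 4"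
proof -
  obtain \<rho> where r: "(\<rho> \<longlongrightarrow> 5 * G 6) (at 0)"
    "\<And>z. z \<noteq> 0 \<Longrightarrow> \<P> z = 1 / z ^ 2 + 3 * G 4 * z ^ 2 + z ^ 4 * \<rho> z"
    using eventually_wp_reg_expand by blast
  have "((\<lambda>z. 6 * G 4 + 2 * z ^ 2 * \<rho> z + (3 * G 4 * z ^ 2 + z ^ 4 * \<rho> z) ^ 2 - eis_fun (L - {0}) 4 z)
      \<longlongrightarrow> 6 * G 4 + 2 * 0 ^ 2 * (5 * G 6) + (3 * G 4 * 0 ^ 2 + 0 ^ 4 * (5 * G 6)) ^ 2 - G 4) (at 0)"
    by (intro tendsto_intros r tendsto_eis_fun_0) simp
  then have lim: "((\<lambda>z. 6 * G 4 + 2 * z ^ 2 * \<rho> z + (3 * G 4 * z ^ 2 + z ^ 4 * \<rho> z) ^ 2 - eis_fun (L - {0}) 4 z)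
      \<longlongrightarrow> 5 * G 4) (at 0)" by simp
  have "(\<P> z)\<^sup>2 - E 4 z = 5 * G 4"
  proof (rule elliptic_constant[OF _ _ _ z])
    show "(\<lambda>z. (\<P> z)\<^sup>2 - E 4 z) holomorphic_on (- L)"
      by (intro holomorphic_intros wp_holomorphic E_holomorphic) simp
    show "(\<P> (z + \<omega>))\<^sup>2 - E 4 (z + \<omega>) = (\<P> z)\<^sup>2 - E 4 z" if "z \<notin> L" "\<omega> \<in> L" for z \<omega>
      using that by (simp add: wp_periodic eis_fun_periodic)
    show "((\<lambda>z. (\<P> z)\<^sup>2 - E 4 z) \<longlongrightarrow> 5 * G 4) (at 0)"
      using lim
    proof (rule Lim_transform_eventually)
      show "eventually (\<lambda>z. 6 * G 4 + 2 * z ^ 2 * \<rho> z + (3 * G 4 * z ^ 2 + z ^ 4 * \<rho> z) ^ 2 - eis_fun (L - {0}) 4 z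
        = (\<P> z)\<^sup>2 - E 4 z) (at 0)"
        using eventually_notin_L[of 0]
      proof eventually_elim
        case (elim z)
        then have nz: "z \<noteq> 0" by auto
        have "(\<P> z)\<^sup>2 = 1 / z ^ 4 + 6 * G 4 + 2 * z ^ 2 * \<rho> z + (3 * G 4 * z ^ 2 + z ^ 4 * \<rho> z) ^ 2"
        proof -
          \<comment> \<open>With x = 1/z^2 and y = z^2 the Laurent computation becomes polynomial
            algebra modulo x y = 1.\<close>
          define x y where "x = 1 / z ^ 2" and "y = z ^ 2"
          have x: "x * y = 1" "1 / z ^ 4 = x ^ 2" "z ^ 4 = y ^ 2"
            using nz by (simp_all add: x_def y_def power_divide)
          have "(x + 3 * g * y + y ^ 2 * r) ^ 2 = x ^ 2 + 6 * g + 2 * y * r + (3 * g * y + y ^ 2 * r) ^ 2"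
            if "x * y = 1" for x y g r :: complex
            using that by Groebner_Basis.algebra
          note id = this
          have P: "\<P> z = x + 3 * G 4 * y + y ^ 2 * \<rho> z"
            unfolding x(3)[symmetric] unfolding x_def y_def by (rule r(2)[OF nz])
          show ?thesis
            unfolding P x(2) unfolding x(3) y_def[symmetric] by (rule id[OF x(1)])
        qed
        then show ?case using eis_fun_insert[OF elim, of 4] by simp
      qed
    qed
  qed
  then show ?thesis by (simp add: algebra_simps)
qed

text \<open>As \<open>E k\<close> has derivative \<open>- k * E (Suc k)\<close>, this is
  \<open>E4_eq\<close> differentiated once; differentiating again gives the next lemma.\<close>

lemma E5_eq:
  assumes z: "z \<notin> L"
  shows "E 5 z = \<P> z * E 3 z"
proof -
  have "((\<lambda>z. (\<P> z)\<^sup>2 - 5 * G 4) has_field_derivative 2 * \<P> z * (- 2 * E 3 z)) (at z)"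
    using z by (auto intro!: derivative_eq_intros wp_deriv)
  then have "(E 4 has_field_derivative 2 * \<P> z * (- 2 * E 3 z)) (at z)"
    by (rule has_field_derivative_transform_within_open[OF _ open_compl_L]) (use z E4_eq in auto)
  from DERIV_unique[OF E_deriv[OF z] this]
  have "- of_nat 4 * E (Suc 4) z = 2 * \<P> z * (- 2 * E 3 z)" by simp
  then show ?thesis by simp
qed

lemma E6_eq_E3_E4:
  assumes z: "z \<notin> L"
  shows "5 * E 6 z = 2 * (E 3 z)\<^sup>2 + 3 * \<P> z * E 4 z"
proof -
  have "((\<lambda>z. \<P> z * E 3 z) has_field_derivative - 2 * E 3 z * E 3 z + (- of_nat 3 * E (Suc 3) z) * \<P> z) (at z)"
    by (intro DERIV_mult wp_deriv E_deriv z) simp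
  then have "(E 5 has_field_derivative - 2 * E 3 z * E 3 z + (- of_nat 3 * E (Suc 3) z) * \<P> z) (at z)"
    by (rule has_field_derivative_transform_within_open[OF _ open_compl_L]) (use z E5_eq in auto)
  from DERIV_unique[OF E_deriv[OF z] this]
  have "- of_nat 5 * E (Suc 5) z = - 2 * E 3 z * E 3 z + (- of_nat 3 * E (Suc 3) z) * \<P> z" by simp
  then show ?thesis by (simp add: algebra_simps power2_eq_square)
qed

end

section \<open>The differential equation and the addition formula\<close>

context complex_lattice
begin

text \<open>The first equation is the classical one divided by 4, because the derivative of the
  Weierstrass function is \<open>- 2 * E 3\<close>. By \<open>E4_eq\<close> the relevant combination
  is constant, and the constant is found by comparing terms at 0.\<close>

lemma
  assumes z: "z \<notin> L"
  shows wp_ode: "(E 3 z)\<^sup>2 = (\<P> z) ^ 3 - 15 * G 4 * \<P> z - 35 * G 6"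
    and E6_eq: "E 6 z = (\<P> z) ^ 3 - 9 * G 4 * \<P> z - 14 * G 6"
proof -
  have d: "((\<lambda>z. (E 3 z)\<^sup>2 - (\<P> z) ^ 3 + 15 * G 4 * \<P> z) has_field_derivative 0) (at z)" if "z \<notin> L" for z
  proof -
    have "((\<lambda>z. (E 3 z)\<^sup>2 - (\<P> z) ^ 3 + 15 * G 4 * \<P> z) has_field_derivative
        2 * E 3 z * (- of_nat 3 * E (Suc 3) z) - 3 * (\<P> z)\<^sup>2 * (- 2 * E 3 z) + 15 * G 4 * (- 2 * E 3 z)) (at z)"
      by (rule derivative_eq_intros wp_deriv E_deriv that refl | simp)+
    moreover have "2 * E 3 z * (- of_nat 3 * E (Suc 3) z) - 3 * (\<P> z)\<^sup>2 * (- 2 * E 3 z) + 15 * G 4 * (- 2 * E 3 z) = 0"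
    proof -
      have e4: "E (Suc 3) z = (\<P> z)\<^sup>2 - 5 * G 4" using E4_eq[OF that] by simp
      show ?thesis unfolding e4 of_nat_numeral by Groebner_Basis.algebra
    qed
    ultimately show ?thesis by simp
  qed
  have "(\<lambda>z. (E 3 z)\<^sup>2 - (\<P> z) ^ 3 + 15 * G 4 * \<P> z) constant_on (- L)"
    by (rule has_field_derivative_0_imp_constant_on[OF d])
      (use connected_compl[OF countable] open_compl_L in auto)
  then obtain K where K: "\<And>z. z \<notin> L \<Longrightarrow> (E 3 z)\<^sup>2 - (\<P> z) ^ 3 + 15 * G 4 * \<P> z = K"
    by (force simp: constant_on_def)
  \<comment> \<open>Eliminating \<open>E 3\<close> leaves \<open>E 6\<close>, whose regular part has
    the known value \<open>G 6\<close> at 0; comparing constant terms in this relation determines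
    K.\<close>
  have E6: "5 * E 6 z = 5 * (\<P> z) ^ 3 - 45 * G 4 * \<P> z + 2 * K" if "z \<notin> L" for z
    using E6_eq_E3_E4[OF that] E4_eq[OF that] K[OF that] by Groebner_Basis.algebra
  obtain \<rho> where r: "(\<rho> \<longlongrightarrow> 5 * G 6) (at 0)"
    "\<And>z. z \<noteq> 0 \<Longrightarrow> \<P> z = 1 / z ^ 2 + 3 * G 4 * z ^ 2 + z ^ 4 * \<rho> z"
    using eventually_wp_reg_expand by blast
  \<comment> \<open>\<open>?u z\<close> is \<open>wp_reg L z / z ^ 2\<close>, and \<open>?f\<close>
    is what remains of the relation \<open>E6\<close> once the negative powers of z have
    cancelled.\<close>
  let ?u = "\<lambda>z. 3 * G 4 + z ^ 2 * \<rho> z"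
  let ?f = "\<lambda>z. 5 * (3 * \<rho> z + 3 * z ^ 2 * ?u z ^ 2 + z ^ 6 * ?u z ^ 3) - 45 * G 4 * z ^ 2 * ?u z + 2 * K
    - 5 * eis_fun (L - {0}) 6 z"
  have "(?f \<longlongrightarrow> 5 * (3 * (5 * G 6) + 3 * 0 ^ 2 * (3 * G 4 + 0 ^ 2 * (5 * G 6)) ^ 2
      + 0 ^ 6 * (3 * G 4 + 0 ^ 2 * (5 * G 6)) ^ 3) - 45 * G 4 * 0 ^ 2 * (3 * G 4 + 0 ^ 2 * (5 * G 6)) + 2 * K - 5 * G 6) (at 0)"
    by (intro tendsto_intros r tendsto_eis_fun_0) simp
  then have "(?f \<longlongrightarrow> 70 * G 6 + 2 * K) (at 0)" by simp
  moreover have "eventually (\<lambda>z. ?f z = 0) (at 0)"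
    using eventually_notin_L[of 0]
  proof eventually_elim
    case (elim z)
    then have nz: "z \<noteq> 0" by auto
    define x y where "x = 1 / z ^ 2" and "y = z ^ 2"
    have x: "x * y = 1" "1 / z ^ 6 = x ^ 3" "z ^ 4 = y ^ 2" "z ^ 6 = y ^ 3"
      using nz by (simp_all add: x_def y_def power_divide)
    have P: "\<P> z = x + 3 * G 4 * y + y ^ 2 * \<rho> z"
      unfolding x(3)[symmetric] unfolding x_def y_def by (rule r(2)[OF nz])
    have "5 * (x ^ 3 + e) = 5 * (x + 3 * g * y + y ^ 2 * r) ^ 3 - 45 * g * (x + 3 * g * y + y ^ 2 * r) + 2 * K \<Longrightarrow>
        5 * (3 * r + 3 * y * (3 * g + y * r) ^ 2 + y ^ 3 * (3 * g + y * r) ^ 3) - 45 * g * y * (3 * g + y * r) + 2 * K - 5 * e = 0"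
      if "x * y = 1" for x y g r e :: complex
      using that by Groebner_Basis.algebra
    note id = this
    have E6z: "E 6 z = x ^ 3 + eis_fun (L - {0}) 6 z"
      using eis_fun_insert[OF elim, of 6] x(2) by simp
    show ?case
      unfolding x(4) y_def[symmetric] by (rule id[OF x(1) E6[OF elim, unfolded P E6z]])
  qed
  then have "(?f \<longlongrightarrow> 0) (at 0)" by (rule tendsto_eventually)
  ultimately have "70 * G 6 + 2 * K = 0" by (rule tendsto_unique[OF at_neq_bot])
  then have K': "K = - 35 * G 6" by Groebner_Basis.algebra
  show "(E 3 z)\<^sup>2 = (\<P> z) ^ 3 - 15 * G 4 * \<P> z - 35 * G 6"
    using K[OF z] K' by (simp add: algebra_simps)
  show "E 6 z = (\<P> z) ^ 3 - 9 * G 4 * \<P> z - 14 * G 6"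
    using E6[OF z] K' by Groebner_Basis.algebra
qed

lemma tendsto_wp_times_square: "((\<lambda>w. w\<^sup>2 * \<P> w) \<longlongrightarrow> 1) (at 0)"
proof -
  obtain \<rho> where r: "(\<rho> \<longlongrightarrow> 5 * G 6) (at 0)"
    "\<And>z. z \<noteq> 0 \<Longrightarrow> \<P> z = 1 / z ^ 2 + 3 * G 4 * z ^ 2 + z ^ 4 * \<rho> z"
    using eventually_wp_reg_expand by blast
  have "((\<lambda>w. 1 + 3 * G 4 * w ^ 4 + w ^ 6 * \<rho> w) \<longlongrightarrow> 1 + 3 * G 4 * 0 ^ 4 + 0 ^ 6 * (5 * G 6)) (at 0)"
    by (intro tendsto_intros r)
  then have "((\<lambda>w. 1 + 3 * G 4 * w ^ 4 + w ^ 6 * \<rho> w) \<longlongrightarrow> 1) (at 0)" by simp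
  then show ?thesis
    by (rule Lim_transform_eventually)
      (auto simp: eventually_at_filter r(2) field_simps power2_eq_square eval_nat_numeral)
qed

text \<open>For fixed \<open>s\<close> the quotient of the two sides is a function of \<open>w\<close> with derivative zero;
  its value is the limit at \<open>w = 0\<close>.\<close>

lemma addition_fixed_sum:
  assumes s: "s \<notin> L" and w: "w \<notin> L" "s - w \<notin> L"
  shows "(\<P> s + \<P> (s - w) + \<P> w) * (\<P> (s - w) - \<P> w)\<^sup>2 = (E 3 (s - w) - E 3 w)\<^sup>2"
proof -
  define f where "f w = \<P> (s - w) - \<P> w" for w
  define N where "N w = (E 3 (s - w) - E 3 w)\<^sup>2 - (\<P> (s - w) + \<P> w) * (f w)\<^sup>2" for w
  \<comment> \<open>\<open>S\<close> collects the w at which either argument is a pole. It is closed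
    and countable, so its complement is open and connected.\<close>
  define S where "S = L \<union> (\<lambda>\<omega>. s - \<omega>) ` L"
  have im: "(\<lambda>\<omega>. s - \<omega>) ` L = (\<lambda>w. s - w) -` L"
    by (auto simp: image_iff intro!: bexI[of _ "s - _"])
  have S: "w \<in> S \<longleftrightarrow> w \<in> L \<or> s - w \<in> L" for w
    unfolding S_def im by simp
  have "open ((\<lambda>w. s - w) -` (- L))"
    by (intro open_vimage open_compl_L continuous_intros)
  then have "open (- ((\<lambda>\<omega>. s - \<omega>) ` L))" unfolding im by (simp add: vimage_Compl)
  then have opS: "open (- S)" unfolding S_def Compl_Un using open_compl_L by (rule open_Int[rotated])
  have conS: "connected (- S)"
    unfolding S_def by (intro connected_compl countable_Un countable_image countable)
  have dPs: "((\<lambda>w. \<P> (s - w)) has_field_derivative 2 * E 3 (s - w)) (at w)" if "s - w \<notin> L" for w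
  proof -
    have "((\<lambda>w. \<P> (s - w)) has_field_derivative (- 2 * E 3 (s - w)) * (- 1)) (at w)"
      by (rule DERIV_chain2[where f = "\<lambda>z. \<P> z" and g = "\<lambda>w. s - w", OF wp_deriv[OF that]]) (auto intro!: derivative_eq_intros)
    then show ?thesis by simp
  qed
  have dEs: "((\<lambda>w. E 3 (s - w)) has_field_derivative 3 * E 4 (s - w)) (at w)" if "s - w \<notin> L" for w
  proof -
    have "((\<lambda>w. E 3 (s - w)) has_field_derivative (- of_nat 3 * E (Suc 3) (s - w)) * (- 1)) (at w)"
      by (rule DERIV_chain2[where f = "E 3" and g = "\<lambda>w. s - w", OF E_deriv[OF that]]) (auto intro!: derivative_eq_intros)
    then show ?thesis by simp
  qed
  have dE: "(E 3 has_field_derivative - 3 * E 4 w) (at w)" if "w \<notin> L" for w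
    using E_deriv[OF that, of 3] by simp
  have df: "(f has_field_derivative 2 * E 3 (s - w) - (- 2 * E 3 w)) (at w)" if "w \<notin> S" for w
    unfolding f_def using that by (intro DERIV_diff dPs wp_deriv) (auto simp: S)
  have dN: "(N has_field_derivative 2 * (E 3 (s - w) - E 3 w) * (3 * E 4 (s - w) - (- 3 * E 4 w))
      - ((2 * E 3 (s - w) + - 2 * E 3 w) * (f w)\<^sup>2
        + (\<P> (s - w) + \<P> w) * (2 * f w * (2 * E 3 (s - w) - (- 2 * E 3 w))))) (at w)" if "w \<notin> S" for w
  proof -
    have 1: "s - w \<notin> L" "w \<notin> L" using that by (auto simp: S)
    show ?thesis unfolding N_def
      by (rule derivative_eq_intros dPs[OF 1(1)] dEs[OF 1(1)] dE[OF 1(2)] wp_deriv[OF 1(2)] df[OF that] refl | simp)+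
  qed
  have dg: "((\<lambda>w. N w / (f w)\<^sup>2) has_field_derivative 0) (at w)" if "w \<notin> S" "f w \<noteq> 0" for w
  proof -
    have 1: "s - w \<notin> L" "w \<notin> L" using that by (auto simp: S)
    define N' where "N' = 2 * (E 3 (s - w) - E 3 w) * (3 * E 4 (s - w) - (- 3 * E 4 w))
      - ((2 * E 3 (s - w) + - 2 * E 3 w) * (f w)\<^sup>2
        + (\<P> (s - w) + \<P> w) * (2 * f w * (2 * E 3 (s - w) - (- 2 * E 3 w))))"
    define f' where "f' = 2 * E 3 (s - w) - (- 2 * E 3 w)"
    have dN': "(N has_field_derivative N') (at w)" unfolding N'_def by (rule dN[OF that(1)])
    have df': "(f has_field_derivative f') (at w)" unfolding f'_def by (rule df[OF that(1)])
    have "((\<lambda>w. N w / (f w)\<^sup>2) has_field_derivative (N' * (f w)\<^sup>2 - N w * (2 * f w * f')) / ((f w)\<^sup>2 * (f w)\<^sup>2)) (at w)"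
      using DERIV_divide[OF dN' DERIV_power[OF df', of 2]] that(2) by (simp add: mult_ac)
    \<comment> \<open>Up to a factor \<open>f w\<close> this is the vanishing of the numerator of
      the derivative of N / f^2. It is a polynomial identity once the cubic equation holds at both
      points and \<open>E 4\<close> is expressed by squares.\<close>
    moreover have "N' * f w = 2 * N w * f'"
    proof -
      have "(2 * (a3 - b3) * (3 * a4 - (- 3 * b4)) - ((2 * a3 + - 2 * b3) * f\<^sup>2 + (a + b) * (2 * f * (2 * a3 - (- 2 * b3))))) * f
          = 2 * ((a3 - b3)\<^sup>2 - (a + b) * f\<^sup>2) * (2 * a3 - (- 2 * b3))"
        if "a3\<^sup>2 = a ^ 3 - 15 * g * a - 35 * h" "b3\<^sup>2 = b ^ 3 - 15 * g * b - 35 * h"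
          "a4 = a\<^sup>2 - 5 * g" "b4 = b\<^sup>2 - 5 * g" "f = a - b" for a b a3 b3 a4 b4 f g h :: complex
        using that by Groebner_Basis.algebra
      from this[OF wp_ode[OF 1(1)] wp_ode[OF 1(2)] E4_eq[OF 1(1)] E4_eq[OF 1(2)] f_def]
      show ?thesis unfolding N'_def N_def f'_def .
    qed
    then have "N' * (f w)\<^sup>2 - N w * (2 * f w * f') = 0"
      by (simp add: power2_eq_square algebra_simps)
    ultimately show ?thesis by simp
  qed
  have lim_s: "((\<lambda>w. \<P> (s - w)) \<longlongrightarrow> \<P> s) (at 0)"
    using DERIV_isCont[OF dPs[of 0]] s by (simp add: isCont_def)
  have lim_E: "((\<lambda>w. E 3 (s - w)) \<longlongrightarrow> E 3 s) (at 0)"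
    using DERIV_isCont[OF dEs[of 0]] s by (simp add: isCont_def)
  have lim_r: "(wp_reg L \<longlongrightarrow> 0) (at 0)"
  proof -
    have "isCont (wp_reg L) 0" by (intro analytic_at_imp_isCont wp_reg_sum) simp
    then show ?thesis by (simp add: isCont_def wp_reg_def)
  qed
  have lim_e: "(eis_fun (L - {0}) 3 \<longlongrightarrow> 0) (at 0)"
    using tendsto_eis_fun_0[of 3] eis_odd[of 3] by simp
  have "((\<lambda>w. w\<^sup>2 * \<P> (s - w) - w\<^sup>2 * \<P> w) \<longlongrightarrow> 0\<^sup>2 * \<P> s - 1) (at 0)"
    by (intro tendsto_intros lim_s tendsto_wp_times_square)
  then have lim_f: "((\<lambda>w. w\<^sup>2 * f w) \<longlongrightarrow> - 1) (at 0)"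
    by (simp add: f_def algebra_simps)
  \<comment> \<open>\<open>\<alpha>\<close> and \<open>\<beta>\<close> are the two differences with
    the poles w^-3 and w^-2 of the terms at w removed, so that \<open>?h\<close> is w^4 N without
    negative powers. Its limit is - p + 2 p = p, where p is the value of the Weierstrass function at
    s.\<close>
  define \<alpha> where "\<alpha> w = E 3 (s - w) - eis_fun (L - {0}) 3 w" for w
  define \<beta> where "\<beta> w = \<P> (s - w) - wp_reg L w" for w
  let ?h = "\<lambda>w. - 2 * w * \<alpha> w + w ^ 4 * (\<alpha> w)\<^sup>2 - (\<P> (s - w) + wp_reg L w) * (1 - w\<^sup>2 * \<beta> w)\<^sup>2 + 2 * \<beta> w - w\<^sup>2 * (\<beta> w)\<^sup>2"
  have "(?h \<longlongrightarrow> - 2 * 0 * (E 3 s - 0) + 0 ^ 4 * (E 3 s - 0)\<^sup>2 - (\<P> s + 0) * (1 - 0\<^sup>2 * (\<P> s - 0))\<^sup>2 + 2 * (\<P> s - 0) - 0\<^sup>2 * (\<P> s - 0)\<^sup>2) (at 0)"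
    unfolding \<alpha>_def \<beta>_def by (intro tendsto_intros lim_s lim_E lim_r lim_e)
  then have "(?h \<longlongrightarrow> \<P> s) (at 0)" by simp
  moreover have "eventually (\<lambda>w. ?h w = w ^ 4 * N w) (at 0)"
    using eventually_notin_L[of 0]
  proof eventually_elim
    case (elim w)
    then have nz: "w \<noteq> 0" by auto
    define x where "x = 1 / w"
    have x: "x * w = 1" "1 / w ^ 2 = x ^ 2" "1 / w ^ 3 = x ^ 3"
      using nz by (simp_all add: x_def power_divide)
    have Pw: "\<P> w = x\<^sup>2 + wp_reg L w" by (simp add: weierstrass_p_eq x)
    have Ew: "E 3 w = x ^ 3 + eis_fun (L - {0}) 3 w" using eis_fun_insert[OF elim, of 3] x by simp
    have "- 2 * w * (p - e) + w ^ 4 * (p - e)\<^sup>2 - (a + r) * (1 - w\<^sup>2 * (a - r))\<^sup>2 + 2 * (a - r) - w\<^sup>2 * (a - r)\<^sup>2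
        = w ^ 4 * ((p - (x ^ 3 + e))\<^sup>2 - (a + (x\<^sup>2 + r)) * (a - (x\<^sup>2 + r))\<^sup>2)"
      if "x * w = 1" for x w p e a r :: complex
      using that by Groebner_Basis.algebra
    note id = this
    from id[OF x(1)] show ?case
      unfolding \<alpha>_def \<beta>_def N_def f_def Pw Ew .
  qed
  ultimately have lim_N: "((\<lambda>w. w ^ 4 * N w) \<longlongrightarrow> \<P> s) (at 0)"
    by (rule Lim_transform_eventually)
  have "((\<lambda>w. (w ^ 4 * N w) / (w\<^sup>2 * f w)\<^sup>2) \<longlongrightarrow> \<P> s / (- 1)\<^sup>2) (at 0)"
    by (intro tendsto_intros lim_N lim_f) simp
  then have "((\<lambda>w. (w ^ 4 * N w) / (w\<^sup>2 * f w)\<^sup>2) \<longlongrightarrow> \<P> s) (at 0)" by simp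
  moreover have "eventually (\<lambda>w. (w ^ 4 * N w) / (w\<^sup>2 * f w)\<^sup>2 = N w / (f w)\<^sup>2) (at 0)"
    by (auto simp: eventually_at_filter power_mult_distrib power2_eq_square eval_nat_numeral)
  ultimately have lim_g: "((\<lambda>w. N w / (f w)\<^sup>2) \<longlongrightarrow> \<P> s) (at 0)"
    by (rule Lim_transform_eventually)
  have "eventually (\<lambda>w. w\<^sup>2 * f w \<noteq> 0) (at 0)"
    by (rule tendsto_imp_eventually_ne[OF lim_f]) simp
  moreover have "eventually (\<lambda>w. s - w \<notin> L) (at 0)"
  proof -
    have "eventually (\<lambda>w. w \<in> (\<lambda>w. s - w) -` (- L)) (nhds 0)"
      using s by (intro eventually_nhds_in_open open_vimage open_compl_L continuous_intros) simp
    then show ?thesis by (auto simp: eventually_at_filter elim: eventually_mono)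
  qed
  ultimately have "eventually (\<lambda>w. w \<notin> S \<and> f w \<noteq> 0) (at 0)"
    using eventually_notin_L[of 0] by eventually_elim (auto simp: S)
  then obtain e where e: "e > 0" "\<And>w. w \<noteq> 0 \<Longrightarrow> dist w 0 < e \<Longrightarrow> w \<notin> S \<and> f w \<noteq> 0"
    unfolding eventually_at by blast
  \<comment> \<open>\<open>f\<close> may vanish away from 0, so the quotient is studied on a
    punctured disc only; the identity without denominators extends to the complement of
    \<open>S\<close> by analytic continuation.\<close>
  define U where "U = ball (0::complex) e - {0}"
  have U: "w \<notin> S" "f w \<noteq> 0" if "w \<in> U" for w
    using e(2)[of w] that by (auto simp: U_def dist_commute)
  have opU: "open U" by (simp add: U_def open_delete)
  have conU: "connected U" unfolding U_def by (intro connected_open_delete) auto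
  have "(\<lambda>w. N w / (f w)\<^sup>2) constant_on U"
    by (rule has_field_derivative_0_imp_constant_on[OF dg[OF U] conU opU])
  then obtain c where c: "\<And>w. w \<in> U \<Longrightarrow> N w / (f w)\<^sup>2 = c" unfolding constant_on_def by blast
  have evU: "eventually (\<lambda>w. w \<in> U) (at 0)"
    using e(1) unfolding U_def by (auto simp: eventually_at dist_commute intro!: exI[of _ e])
  have "((\<lambda>w. N w / (f w)\<^sup>2) \<longlongrightarrow> c) (at 0)"
    using evU c by (intro tendsto_eventually) (auto elim: eventually_mono)
  then have "c = \<P> s" using lim_g by (rule tendsto_unique[OF at_neq_bot])
  then have NU: "N w - \<P> s * (f w)\<^sup>2 = 0" if "w \<in> U" for w
    using c[OF that] U[OF that] by (simp add: field_simps)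
  have "(\<lambda>w. N w - \<P> s * (f w)\<^sup>2) holomorphic_on (- S)"
  proof -
    have "N holomorphic_on (- S)" "f holomorphic_on (- S)"
      using dN df opS by (auto simp: holomorphic_on_open)
    then show ?thesis by (intro holomorphic_intros)
  qed
  moreover have "U \<noteq> {}"
  proof -
    have "of_real (e / 2) \<in> U" using e(1) by (simp add: U_def)
    then show ?thesis by blast
  qed
  moreover have "U \<subseteq> - S" using U by blast
  ultimately have "N w - \<P> s * (f w)\<^sup>2 = 0"
    by (intro analytic_continuation_open[OF opU opS _ conS, of "\<lambda>w. N w - \<P> s * (f w)\<^sup>2" "\<lambda>_. 0" w] NU)
      (use w S in simp_all)
  then show ?thesis unfolding N_def f_def by (simp add: algebra_simps)
qed

lemma addition:
  assumes "z \<notin> L" "w \<notin> L" "z + w \<notin> L"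
  shows "(\<P> (z + w) + \<P> z + \<P> w) * (\<P> z - \<P> w)\<^sup>2 = (E 3 z - E 3 w)\<^sup>2"
  using addition_fixed_sum[of "z + w" w] assms by simp

text \<open>Divide the addition formula for w and z by (w - z)^2 and let w tend to z: the difference
  quotients become the derivatives \<open>- 2 * E 3 z\<close> and
  \<open>- 3 * E 4 z\<close>.\<close>

lemma duplication:
  assumes z: "z \<notin> L" "2 * z \<notin> L"
  shows "4 * (\<P> (2 * z) + 2 * \<P> z) * (E 3 z)\<^sup>2 = 9 * (E 4 z)\<^sup>2"
proof -
  have 1: "((\<lambda>w. (\<P> w - \<P> z) / (w - z)) \<longlongrightarrow> - 2 * E 3 z) (at z)"
    using wp_deriv[OF z(1)] by (simp add: has_field_derivative_iff)
  have 2: "((\<lambda>w. (E 3 w - E 3 z) / (w - z)) \<longlongrightarrow> - 3 * E 4 z) (at z)"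
    using E_deriv[OF z(1), of 3] by (simp add: has_field_derivative_iff)
  have zz: "z + z \<notin> L" using z(2) by (simp only: mult_2 not_False_eq_True)
  have "((\<lambda>w. \<P> (w + z)) has_field_derivative - 2 * E 3 (z + z)) (at z)"
    by (rule iffD1[OF DERIV_shift wp_deriv[OF zz]])
  then have 3: "((\<lambda>w. \<P> (w + z)) \<longlongrightarrow> \<P> (2 * z)) (at z)"
    unfolding mult_2 by (rule DERIV_isCont[unfolded isCont_def])
  have 4: "((\<lambda>w. \<P> w) \<longlongrightarrow> \<P> z) (at z)"
    using DERIV_isCont[OF wp_deriv[OF z(1)]] by (simp add: isCont_def)
  have t1: "((\<lambda>w. (\<P> (w + z) + \<P> w + \<P> z) * ((\<P> w - \<P> z) / (w - z))\<^sup>2)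
      \<longlongrightarrow> (\<P> (2 * z) + \<P> z + \<P> z) * (- 2 * E 3 z)\<^sup>2) (at z)"
    by (intro tendsto_intros 1 3 4)
  have t2: "((\<lambda>w. ((E 3 w - E 3 z) / (w - z))\<^sup>2) \<longlongrightarrow> (- 3 * E 4 z)\<^sup>2) (at z)"
    by (intro tendsto_intros 2)
  have ev: "eventually (\<lambda>w. ((E 3 w - E 3 z) / (w - z))\<^sup>2 = (\<P> (w + z) + \<P> w + \<P> z) * ((\<P> w - \<P> z) / (w - z))\<^sup>2) (at z)"
  proof -
    have "eventually (\<lambda>w. w + z \<notin> L) (at z)"
    proof -
      have "eventually (\<lambda>w. w \<in> (\<lambda>w. w + z) -` (- L)) (nhds z)"
        using z by (intro eventually_nhds_in_open open_vimage open_compl_L continuous_intros) (simp add: zz)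
      then show ?thesis by (auto simp: eventually_at_filter elim: eventually_mono)
    qed
    then show ?thesis
      using eventually_notin_L[of z]
    proof eventually_elim
      case (elim w)
      then show ?case using addition[of w z] z by (simp add: power_divide)
    qed
  qed
  have "(\<P> (2 * z) + \<P> z + \<P> z) * (- 2 * E 3 z)\<^sup>2 = (- 3 * E 4 z)\<^sup>2"
    by (rule tendsto_unique[OF at_neq_bot t1 Lim_transform_eventually[OF t2 ev]])
  then show ?thesis by (simp add: power_mult_distrib algebra_simps)
qed

end

section \<open>Matrices of the regular representation\<close>

text \<open>Generic in the field, as are the matrices that follow: they serve for elements of the
  fraction field in the theorem and for complex values at single torsion points in the proof of
  independence.\<close>

definition sym_basis :: "'a::field_char_0 \<Rightarrow> 'a \<Rightarrow> 'a list" where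
  "sym_basis x y = [1, x + y, x * y, x^2 + y^2, x^2 * y^2, x^3 + y^3]"

definition rho_a :: "'a::field_char_0 \<Rightarrow> 'a \<Rightarrow> 'a mat" where
  "rho_a a b = mat_of_rows_list 6
     [[-19*a,  40*b, -30*a^2, -60*a^2, 72*a^3 - 448*b^2, -1600*a*b],
      [    0,     a,   120*b,   120*b,        -512*a*b, -1160*a^2],
      [    0,     0,    41*a,       0,       -192*a^2,     3960*b],
      [  -30,     0,       0,   -79*a,        -18*a^2,     1320*b],
      [    0,     0,     -90,    -420,          365*a,          0],
      [    0,   -40,       0,       0,          184*b,      321*a]]"

definition rho_b :: "'a::field_char_0 \<Rightarrow> 'a \<Rightarrow> 'a mat" where
  "rho_b a b = mat_of_rows_list 6
     [[-55*b, -210*a^2, -2632*a*b/3, -11032*a*b/3, 13888*a^2*b/3, 1554*a^3 - 12320*b^2],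
      [-42*a,    505*b, -1946*a^2/3,  -8036*a^2/3, 7658*a^3/3 - 3360*b^2, -13104*a*b],
      [    0,     56*a,      2185*b,       9240*b,     -9576*a*b,  -5096*a^2],
      [    0,   -182*a,       840*b,       3025*b,     -2632*a*b,   -994*a^2],
      [    0,    -1050,           0,            0,        4705*b,     7770*a],
      [  -70,        0,     658*a/3,     2212*a/3,  -2842*a^2/3,     5265*b]]"

lemma all_less_6: "(\<forall>j<6. P j) \<longleftrightarrow> P 0 \<and> P 1 \<and> P 2 \<and> P 3 \<and> P 4 \<and> P (5::nat)"
  by (simp add: numeral_eq_Suc All_less_Suc) blast

lemma sum_less_6: "(\<Sum>i<6. f i) = f 0 + f 1 + f 2 + f 3 + f 4 + f (5::nat)" for f :: "nat \<Rightarrow> 'a::comm_monoid_add"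
  by (simp add: eval_nat_numeral add.assoc)

text \<open>The two relations between \<open>s = x + y\<close> and \<open>p = x y\<close> have weights 6 and 8 when \<open>s\<close>, \<open>p\<close>
  have weights 2 and 4, so they cut out \<open>6 = 6 \<sqdot> 8 / (2 \<sqdot> 4)\<close> points; all columns
  follow from them.\<close>

definition torsion_rel :: "'a::field_char_0 \<Rightarrow> 'a \<Rightarrow> 'a \<Rightarrow> 'a \<Rightarrow> bool" where
  "torsion_rel a b x y \<longleftrightarrow>
     (x + y)^3 - 6 * (x * y) * (x + y) - 2 * a * (x + y) - 4 * b = 0 \<and>
     x * y * (x + y)^2 - 5 * (x * y)^2 + 2 * a * (x * y) - a^2 + 4 * b * (x + y) = 0"

context
  fixes a b x y :: "'a::field_char_0"
  assumes rel: "torsion_rel a b x y"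
begin

private definition "s = x + y"
private definition "p = x * y"

private lemma R: "s^3 - 6 * p * s - 2 * a * s - 4 * b = 0" "p * s^2 - 5 * p^2 + 2 * a * p - a^2 + 4 * b * s = 0"
  using rel unfolding torsion_rel_def s_def[symmetric] p_def[symmetric] by simp_all

private lemma power_sums: "x^2 + y^2 = s^2 - 2 * p" "x^3 + y^3 = s^3 - 3 * p * s" "x^2 * y^2 = p^2"
  unfolding s_def p_def by Groebner_Basis.algebra+

private lemma basis: "sym_basis x y = [1, s, p, s^2 - 2 * p, p^2, s^3 - 3 * p * s]"
  unfolding sym_basis_def power_sums s_def[symmetric] p_def[symmetric] ..

lemma rho_a_columns:
  assumes "a' = - 19 * a - 30 * (x^2 + y^2)"
  shows "\<forall>j<6. a' * sym_basis x y ! j = (\<Sum>i<6. rho_a a b $$ (i, j) * sym_basis x y ! i)"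
proof -
  have a': "a' = - 19 * a - 30 * (s^2 - 2 * p)" using assms by (simp only: power_sums)
  \<comment> \<open>Column 0 is the formula for \<open>a'\<close> itself; every other column is a
    membership in the ideal of the two relations, decided by a Groebner basis.\<close>
  have "a' * s = 40 * b + a * s - 40 * (s^3 - 3 * p * s)"
    using R a' by Groebner_Basis.algebra
  moreover have "a' * p = - 30 * a^2 + 120 * b * s + 41 * a * p - 90 * p^2"
    using R a' by Groebner_Basis.algebra
  moreover have "a' * (s^2 - 2 * p) = - 60 * a^2 + 120 * b * s - 79 * a * (s^2 - 2 * p) - 420 * p^2"
    using R a' by Groebner_Basis.algebra
  moreover have "a' * p^2 = 72 * a^3 - 448 * b^2 - 512 * a * b * s - 192 * a^2 * p - 18 * a^2 * (s^2 - 2 * p)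
      + 365 * a * p^2 + 184 * b * (s^3 - 3 * p * s)"
    using R a' by Groebner_Basis.algebra
  moreover have "a' * (s^3 - 3 * p * s) = - 1600 * a * b - 1160 * a^2 * s + 3960 * b * p + 1320 * b * (s^2 - 2 * p)
      + 321 * a * (s^3 - 3 * p * s)"
    using R a' by Groebner_Basis.algebra
  ultimately show ?thesis
    unfolding basis rho_a_def all_less_6 sum_less_6
    by (simp add: mat_of_rows_list_def a')
qed

lemma rho_b_columns:
  assumes "b' = - 55 * b - 42 * a * (x + y) - 70 * (x^3 + y^3)"
  shows "\<forall>j<6. b' * sym_basis x y ! j = (\<Sum>i<6. rho_b a b $$ (i, j) * sym_basis x y ! i)"
proof -
  have b': "b' = - 55 * b - 42 * a * s - 70 * (s^3 - 3 * p * s)" using assms by (simp only: power_sums s_def)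
  \<comment> \<open>The Groebner basis argument works with ring operations, so division by 3 is
    replaced by a variable \<open>t\<close> with 3 t = 1.\<close>
  define t :: 'a where "t = 1 / 3"
  have t: "3 * t = 1" and div3: "u / 3 = u * t" for u by (simp_all add: t_def)
  have "b' * s = - 210 * a^2 + 505 * b * s + 56 * a * p - 182 * a * (s^2 - 2 * p) - 1050 * p^2"
    using R b' by Groebner_Basis.algebra
  moreover have "b' * p = - 2632 * a * b / 3 + (- 1946 * a^2 / 3) * s + 2185 * b * p + 840 * b * (s^2 - 2 * p)
      + 658 * a / 3 * (s^3 - 3 * p * s)"
    unfolding div3 using R b' t by Groebner_Basis.algebra
  moreover have "b' * (s^2 - 2 * p) = - 11032 * a * b / 3 + (- 8036 * a^2 / 3) * s + 9240 * b * p + 3025 * b * (s^2 - 2 * p)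
      + 2212 * a / 3 * (s^3 - 3 * p * s)"
    unfolding div3 using R b' t by Groebner_Basis.algebra
  moreover have "b' * p^2 = 13888 * a^2 * b / 3 + (7658 * a^3 / 3 - 3360 * b^2) * s - 9576 * a * b * p
      - 2632 * a * b * (s^2 - 2 * p) + 4705 * b * p^2 + (- 2842 * a^2 / 3) * (s^3 - 3 * p * s)"
    unfolding div3 using R b' t by Groebner_Basis.algebra
  moreover have "b' * (s^3 - 3 * p * s) = 1554 * a^3 - 12320 * b^2 - 13104 * a * b * s - 5096 * a^2 * p
      - 994 * a^2 * (s^2 - 2 * p) + 7770 * a * p^2 + 5265 * b * (s^3 - 3 * p * s)"
    using R b' by Groebner_Basis.algebra
  ultimately show ?thesis
    unfolding basis rho_b_def all_less_6 sum_less_6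
    by (simp add: mat_of_rows_list_def b')
qed

end

section \<open>Points of order five\<close>

text \<open>The lattice \<open>L + \<int> z\<close> for a 5-torsion point \<open>z\<close> modulo \<open>L\<close>.\<close>

definition superlattice :: "complex set \<Rightarrow> complex \<Rightarrow> complex set" where
  "superlattice L z = (\<Union>j<5::nat. (\<lambda>\<omega>. of_nat j * z + \<omega>) ` L)"

text \<open>Since 5 is prime, the assumptions say that z has order exactly 5 modulo L. The powers of
  pi in the definitions make \<open>x1\<close>, \<open>x2\<close>, \<open>a\<close>,
  \<open>b\<close> the values of the given forms when L = Z + Z \<tau> and z = 1/5.\<close>

locale torsion_point = complex_lattice +
  fixes z :: complex
  assumes z5: "5 * z \<in> L" and z_notin: "z \<notin> L"
begin

definition "x1 = - (1 / of_real pi ^ 2) * \<P> z"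
definition "x2 = - (1 / of_real pi ^ 2) * \<P> (2 * z)"
definition "a = - 15 / of_real pi ^ 4 * G 4"
definition "b = 35 / of_real pi ^ 6 * G 6"

lemma z2_notin: "2 * z \<notin> L"
proof
  assume "2 * z \<in> L"
  then have "5 * z - (2 * z + 2 * z) \<in> L" by (intro diff_in add_in z5)
  with z_notin show False by (simp add: algebra_simps)
qed

lemma z3: "3 * z = - (2 * z) + 5 * z" and z4: "4 * z = - z + 5 * z" "2 * (2 * z) = - z + 5 * z"
  by (simp_all add: algebra_simps)

lemma z3_notin: "3 * z \<notin> L" and z4_notin: "4 * z \<notin> L"
  unfolding z3 z4 using z5 z_notin z2_notin by (simp_all only: add_in_iff uminus_in_iff not_False_eq_True)

lemma wp_3: "\<P> (3 * z) = \<P> (2 * z)" and E_3: "E k (3 * z) = (-1) ^ k * E k (2 * z)"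
  unfolding z3 using z2_notin z5 by (simp_all only: wp_periodic uminus_in_iff eis_fun_periodic wp_uminus eis_fun_uminus not_False_eq_True)

lemma wp_4: "\<P> (4 * z) = \<P> z" "\<P> (2 * (2 * z)) = \<P> z" and E_4: "E k (4 * z) = (-1) ^ k * E k z"
  unfolding z4 using z_notin z5 by (simp_all only: wp_periodic uminus_in_iff eis_fun_periodic wp_uminus eis_fun_uminus not_False_eq_True)

text \<open>The first is the sum of the addition formulas for 2 z + z, which is - 2 z modulo L, and
  for 2 z - z; the mixed products of \<open>E 3 z\<close> and \<open>E 3 (2 * z)\<close> cancel. The
  others are duplication at z and at 2 z, where 4 z is - z modulo L.\<close>

lemma torsion_identities:
  "3 * (\<P> z + \<P> (2 * z)) * (\<P> z - \<P> (2 * z))\<^sup>2 = 2 * (E 3 z)\<^sup>2 + 2 * (E 3 (2 * z))\<^sup>2"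
  "4 * (\<P> (2 * z) + 2 * \<P> z) * (E 3 z)\<^sup>2 = 9 * (E 4 z)\<^sup>2"
  "4 * (\<P> z + 2 * \<P> (2 * z)) * (E 3 (2 * z))\<^sup>2 = 9 * (E 4 (2 * z))\<^sup>2"
proof -
  have *: "2 * z + z = 3 * z" "2 * z + - z = z" "2 * (2 * z) = 4 * z" by simp_all
  have "(\<P> (2 * z) + \<P> (2 * z) + \<P> z) * (\<P> (2 * z) - \<P> z)\<^sup>2 = (E 3 (2 * z) - E 3 z)\<^sup>2"
    using addition[of "2 * z" z] z_notin z2_notin z3_notin unfolding * wp_3 by blast
  moreover have "(\<P> z + \<P> (2 * z) + \<P> z) * (\<P> (2 * z) - \<P> z)\<^sup>2 = (E 3 (2 * z) + E 3 z)\<^sup>2"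
    using addition[of "2 * z" "- z"] z_notin z2_notin unfolding * wp_uminus eis_fun_uminus by simp
  ultimately show "3 * (\<P> z + \<P> (2 * z)) * (\<P> z - \<P> (2 * z))\<^sup>2 = 2 * (E 3 z)\<^sup>2 + 2 * (E 3 (2 * z))\<^sup>2"
    by Groebner_Basis.algebra
  show "4 * (\<P> (2 * z) + 2 * \<P> z) * (E 3 z)\<^sup>2 = 9 * (E 4 z)\<^sup>2"
    by (rule duplication[OF z_notin z2_notin])
  show "4 * (\<P> z + 2 * \<P> (2 * z)) * (E 3 (2 * z))\<^sup>2 = 9 * (E 4 (2 * z))\<^sup>2"
    using duplication[OF z2_notin] z4_notin unfolding *(3) wp_4 by blast
qed

lemma wp_eis_eq:
  "\<P> z = - (of_real pi ^ 2) * x1" "\<P> (2 * z) = - (of_real pi ^ 2) * x2"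
  "15 * G 4 = - (of_real pi ^ 4) * a" "35 * G 6 = of_real pi ^ 6 * b"
  by (simp_all add: x1_def x2_def a_def b_def)

lemma torsion_relation: "torsion_rel a b x1 x2"
proof -
  define q :: complex where "q = of_real pi ^ 2"
  have q0: "q \<noteq> 0" by (simp add: q_def)
  have qp: "of_real pi ^ 4 = q ^ 2" "of_real pi ^ 6 = q ^ 3" by (simp_all add: q_def flip: power_mult)
  note t = wp_eis_eq[unfolded qp, folded q_def]
  \<comment> \<open>In normalised coordinates the differential equation becomes the curve y^2 = x^3
    + a x + b, up to the factor - q^3.\<close>
  have ode: "(E 3 z)\<^sup>2 = - (q ^ 3) * (x1 ^ 3 + a * x1 + b)"
    "(E 3 (2 * z))\<^sup>2 = - (q ^ 3) * (x2 ^ 3 + a * x2 + b)"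
    using wp_ode[OF z_notin] wp_ode[OF z2_notin] t by Groebner_Basis.algebra+
  have e4: "3 * E 4 z = q ^ 2 * (3 * x1 ^ 2 + a)" "3 * E 4 (2 * z) = q ^ 2 * (3 * x2 ^ 2 + a)"
    using E4_eq[OF z_notin] E4_eq[OF z2_notin] t by Groebner_Basis.algebra+
  have "q ^ 3 * (3 * (x1 + x2) * (x1 - x2) ^ 2 - 2 * (x1 ^ 3 + a * x1 + b) - 2 * (x2 ^ 3 + a * x2 + b)) = 0"
    using torsion_identities(1) ode t(1,2) by Groebner_Basis.algebra
  then have 1: "3 * (x1 + x2) * (x1 - x2) ^ 2 - 2 * (x1 ^ 3 + a * x1 + b) - 2 * (x2 ^ 3 + a * x2 + b) = 0"
    using q0 by simp
  have "q ^ 4 * (4 * (x2 + 2 * x1) * (x1 ^ 3 + a * x1 + b) - (3 * x1 ^ 2 + a) ^ 2) = 0"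
    using torsion_identities(2) ode(1) e4(1) t(1,2) by Groebner_Basis.algebra
  then have 2: "4 * (x2 + 2 * x1) * (x1 ^ 3 + a * x1 + b) - (3 * x1 ^ 2 + a) ^ 2 = 0"
    using q0 by simp
  have "q ^ 4 * (4 * (x1 + 2 * x2) * (x2 ^ 3 + a * x2 + b) - (3 * x2 ^ 2 + a) ^ 2) = 0"
    using torsion_identities(3) ode(2) e4(2) t(1,2) by Groebner_Basis.algebra
  then have 3: "4 * (x1 + 2 * x2) * (x2 ^ 3 + a * x2 + b) - (3 * x2 ^ 2 + a) ^ 2 = 0"
    using q0 by simp
  have R1: "(x1 + x2)^3 - 6 * (x1 * x2) * (x1 + x2) - 2 * a * (x1 + x2) - 4 * b = 0"
    using 1 by Groebner_Basis.algebra
  \<comment> \<open>The sum of facts \<open>2\<close> and \<open>3\<close>, plus x1 + x2 times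
    \<open>R1\<close>, is twice the second relation.\<close>
  have "2 * (x1 * x2 * (x1 + x2)^2 - 5 * (x1 * x2)^2 + 2 * a * (x1 * x2) - a^2 + 4 * b * (x1 + x2)) = 0"
    using 2 3 R1 by Groebner_Basis.algebra
  then have "x1 * x2 * (x1 + x2)^2 - 5 * (x1 * x2)^2 + 2 * a * (x1 * x2) - a^2 + 4 * b * (x1 + x2) = 0"
    by Groebner_Basis.algebra
  then show ?thesis unfolding torsion_rel_def using R1 by blast
qed

lemma torsion_cancel:
  assumes "d < 5" "of_nat d * z \<in> L"
  shows "d = 0"
proof (rule ccontr)
  assume "d \<noteq> 0"
  with assms(1) consider "d = 1" | "d = 2" | "d = 3" | "d = 4" by linarith
  then show False
    using assms(2) z_notin z2_notin z3_notin z4_notin by cases simp_all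
qed

lemma eis_superlattice:
  assumes k: "k \<ge> 3" "even k"
  shows "eis (superlattice L z) k = G k + 2 * E k z + 2 * E k (2 * z)"
proof -
  define S where "S j = (\<lambda>\<omega>. of_nat j * z + \<omega>) ` L" for j :: nat
  \<comment> \<open>Only the coset j = 0 contains the origin, which the Eisenstein series omits; the
    coset of j z sums to \<open>E k\<close> at j z after a reflection of the lattice
    variable.\<close>
  define T where "T j = (if j = 0 then L - {0} else S j)" for j
  have jz: "of_nat j * z \<notin> L" if "j < 5" "j \<noteq> 0" for j
    using torsion_cancel[of j] that by blast
  have disj: "S i \<inter> S j = {}" if "i < j" "j < 5" for i j
  proof (rule ccontr)
    assume "S i \<inter> S j \<noteq> {}"
    then obtain u v where uv: "u \<in> L" "v \<in> L" "of_nat i * z + u = of_nat j * z + v" unfolding S_def by blast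
    then have "of_nat (j - i) * z = u - v" using that by (simp add: of_nat_diff algebra_simps)
    then have "of_nat (j - i) * z \<in> L" using uv diff_in by simp
    then have "j - i = 0" using that by (intro torsion_cancel) simp
    then show False using that by simp
  qed
  have "((\<lambda>\<omega>. 1 / \<omega> ^ k) has_sum (if j = 0 then G k else E k (of_nat j * z))) (T j)" if "j < 5" for j
  proof (cases "j = 0")
    case True
    then show ?thesis using eis_has_sum[OF k(1)] by (simp add: T_def)
  next
    case False
    have "((\<lambda>\<omega>. 1 / (of_nat j * z - \<omega>) ^ k) has_sum E k (of_nat j * z)) L"
      using jz[OF that False] k by (intro eis_fun_has_sum) auto
    also have "?this \<longleftrightarrow> ((\<lambda>\<omega>. 1 / \<omega> ^ k) has_sum E k (of_nat j * z)) (S j)"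
      by (rule has_sum_reindex_bij_witness[of _ "\<lambda>w. of_nat j * z - w" "\<lambda>w. of_nat j * z - w"])
        (auto simp: S_def image_iff intro!: bexI[of _ "- _"])
    finally show ?thesis using False by (simp add: T_def)
  qed
  then have "((\<lambda>\<omega>. 1 / \<omega> ^ k) has_sum (\<Sum>j<5. if j = 0 then G k else E k (of_nat j * z))) (\<Union>j\<in>{..<5}. T j)"
  proof (intro sum_has_sum)
    show "T i \<inter> T j = {}" if "i \<in> {..<5}" "j \<in> {..<5}" "i \<noteq> j" for i j
    proof -
      have "T i \<subseteq> S i" for i by (auto simp: T_def S_def)
      moreover have "S i \<inter> S j = {}" using disj[of i j] disj[of j i] that by (auto simp: neq_iff)
      ultimately show ?thesis by blast
    qed
  qed auto
  moreover have "(\<Union>j\<in>{..<5}. T j) = superlattice L z - {0}"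
  proof -
    have "0 \<notin> S j" if "j < 5" "j \<noteq> 0" for j
    proof
      assume "0 \<in> S j"
      then obtain w where "w \<in> L" "of_nat j * z = - w" by (auto simp: S_def eq_neg_iff_add_eq_0)
      then show False using jz[OF that] by simp
    qed
    moreover have "S 0 = L" by (simp add: S_def)
    ultimately have "T j = S j - {0}" if "j < 5" for j using that by (auto simp: T_def)
    then show ?thesis unfolding superlattice_def S_def by auto
  qed
  ultimately have "eis (superlattice L z) k = (\<Sum>j<5. if j = 0 then G k else E k (of_nat j * z))"
    unfolding eis_def by (simp add: infsumI)
  also have "\<dots> = G k + E k z + E k (2 * z) + E k (3 * z) + E k (4 * z)"
    by (simp add: eval_nat_numeral(2) lessThan_Suc lessThan_nat_numeral numeral_eq_Suc)
  finally show ?thesis using k by (simp add: E_3 E_4)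
qed

text \<open>The left-hand side belongs to the curve of L + Z z, so this and the next lemma are
  Velu's formulas for the quotient by a subgroup of order 5: a - 10 sum (3 x^2 + a) and b - 7 sum
  (10 x^3 + 6 a x + 4 b), summed over x = x1, x2.\<close>

lemma velu_a: "- 15 / of_real pi ^ 4 * eis (superlattice L z) 4 = - 19 * a - 30 * (x1^2 + x2^2)"
proof -
  define q :: complex where "q = of_real pi ^ 2"
  have q0: "q \<noteq> 0" by (simp add: q_def)
  have qp: "of_real pi ^ 4 = q ^ 2" "of_real pi ^ 6 = q ^ 3" by (simp_all add: q_def flip: power_mult)
  note t = wp_eis_eq[unfolded qp, folded q_def]
  have "- 15 * eis (superlattice L z) 4 = q ^ 2 * (- 19 * a - 30 * (x1^2 + x2^2))"
    using eis_superlattice[of 4] E4_eq[OF z_notin] E4_eq[OF z2_notin] t by simp Groebner_Basis.algebra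
  then show ?thesis using q0 unfolding qp by (simp add: field_simps)
qed

lemma velu_b: "35 / of_real pi ^ 6 * eis (superlattice L z) 6 = - 55 * b - 42 * a * (x1 + x2) - 70 * (x1^3 + x2^3)"
proof -
  define q :: complex where "q = of_real pi ^ 2"
  have q0: "q \<noteq> 0" by (simp add: q_def)
  have qp: "of_real pi ^ 4 = q ^ 2" "of_real pi ^ 6 = q ^ 3" by (simp_all add: q_def flip: power_mult)
  note t = wp_eis_eq[unfolded qp, folded q_def]
  have "35 * eis (superlattice L z) 6 = q ^ 3 * (- 55 * b - 42 * a * (x1 + x2) - 70 * (x1^3 + x2^3))"
    using eis_superlattice[of 6] E6_eq[OF z_notin] E6_eq[OF z2_notin] t by simp Groebner_Basis.algebra
  then show ?thesis using q0 unfolding qp by (simp add: field_simps)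
qed

end

section \<open>The lattices of the upper half-plane\<close>

text \<open>Integer pairs give the lattices of all \<tau> one common index set, as termwise
  holomorphy in \<tau> requires.\<close>

definition lat_point :: "complex \<Rightarrow> int \<times> int \<Rightarrow> complex" where
  "lat_point \<tau> p = of_int (fst p) + of_int (snd p) * \<tau>"

definition lat_size :: "int \<times> int \<Rightarrow> real" where
  "lat_size p = \<bar>of_int (fst p)\<bar> + \<bar>of_int (snd p)\<bar>"

lemma in_uhp: "\<tau> \<in> upper_half_plane \<longleftrightarrow> Im \<tau> > 0"
  by (simp add: upper_half_plane_def)

text \<open>The imaginary part controls y, and then the real part controls x, uniformly on a
  half-strip. Real x and y are allowed because the distance from l/5 to lattice points is estimated
  in the same way.\<close>

lemma lattice_norm_bound:
  fixes x y X Y :: real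
  assumes "\<bar>Re \<tau>\<bar> \<le> X" "Im \<tau> \<ge> Y" "Y > 0"
  shows "\<bar>x\<bar> + \<bar>y\<bar> \<le> (1 + (X + 1) / Y) * norm (of_real x + of_real y * \<tau>)"
proof -
  let ?N = "norm (of_real x + of_real y * \<tau>)"
  have X: "X \<ge> 0" using assms(1) by linarith
  have "\<bar>y\<bar> * Y \<le> \<bar>y\<bar> * Im \<tau>" using assms by (intro mult_left_mono) auto
  also have "\<dots> = \<bar>Im (of_real x + of_real y * \<tau>)\<bar>" using assms by (simp add: abs_mult)
  also have "\<dots> \<le> ?N" by (rule abs_Im_le_cmod)
  finally have y: "\<bar>y\<bar> \<le> ?N / Y" using assms by (simp add: field_simps)
  have "\<bar>x\<bar> - \<bar>y\<bar> * \<bar>Re \<tau>\<bar> \<le> \<bar>x + y * Re \<tau>\<bar>" by (simp add: abs_mult flip: abs_mult)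
  also have "\<dots> = \<bar>Re (of_real x + of_real y * \<tau>)\<bar>" by simp
  also have "\<dots> \<le> ?N" by (rule abs_Re_le_cmod)
  finally have "\<bar>x\<bar> \<le> ?N + \<bar>y\<bar> * \<bar>Re \<tau>\<bar>" by simp
  also have "\<dots> \<le> ?N + (?N / Y) * X" using y assms(1) by (intro add_left_mono mult_mono) auto
  finally have "\<bar>x\<bar> + \<bar>y\<bar> \<le> ?N + (?N / Y) * X + ?N / Y" using y by linarith
  then show ?thesis by (simp add: algebra_simps add_divide_distrib)
qed

lemma lat_size_le:
  assumes "\<bar>Re \<tau>\<bar> \<le> X" "Im \<tau> \<ge> Y" "Y > 0"
  shows "lat_size p \<le> (1 + (X + 1) / Y) * norm (lat_point \<tau> p)"
  using lattice_norm_bound[OF assms, of "of_int (fst p)" "of_int (snd p)"]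
  by (simp add: lat_size_def lat_point_def)

lemma lat_size_ge_1: "p \<noteq> (0, 0) \<Longrightarrow> lat_size p \<ge> 1"
  by (cases p) (auto simp: lat_size_def abs_if)

section \<open>Convergence of sums over pairs of integers\<close>

lemma summable_int_powr: "(\<lambda>m::int. (1 + \<bar>of_int m\<bar>) powr (-3/2) :: real) summable_on UNIV"
proof -
  let ?f = "\<lambda>m::int. (1 + \<bar>of_int m\<bar>) powr (-3/2) :: real"
  have "summable (\<lambda>n. of_nat (Suc n) powr (-3/2) :: real)"
    using summable_real_powr_iff[of "-3/2"] by (subst summable_Suc_iff) simp
  then have "(\<lambda>n. of_nat (Suc n) powr (-3/2) :: real) summable_on UNIV"
    by (subst summable_on_UNIV_nonneg_real_iff) auto
  moreover have "(?f \<circ> int) = (\<lambda>n. of_nat (Suc n) powr (-3/2))" "(?f \<circ> (\<lambda>n. - int n)) = (\<lambda>n. of_nat (Suc n) powr (-3/2))"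
    by (simp_all add: fun_eq_iff add.commute)
  ultimately have "(?f \<circ> int) summable_on UNIV" "(?f \<circ> (\<lambda>n. - int n)) summable_on UNIV"
    by (simp_all only:)
  moreover have "inj int" "inj (\<lambda>n. - int n)" by (simp_all add: inj_def)
  ultimately have "?f summable_on range int" "?f summable_on range (\<lambda>n. - int n)"
    by (simp_all only: summable_on_reindex)
  then have *: "?f summable_on (range int \<union> range (\<lambda>n. - int n))"
    by (rule summable_on_union)
  have "range int \<union> range (\<lambda>n. - int n) = UNIV"
    by (auto simp: image_iff intro: int_cases2)
  from *[unfolded this] show ?thesis .
qed

text \<open>Both 1 + |m| and 1 + |n| are at most twice the size of (m, n). Splitting the exponent 3
  evenly bounds the summand by 8 times a product of one-dimensional terms of exponent 3/2 >
  1.\<close>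

lemma summable_lat_size_3: "(\<lambda>p. 1 / lat_size p ^ 3) summable_on (UNIV - {(0, 0)})"
proof -
  let ?g = "\<lambda>m::int. (1 + \<bar>of_int m\<bar>) powr (-3/2) :: real"
  have "(\<lambda>p. 8 * (?g (fst p) * ?g (snd p))) summable_on (UNIV \<times> UNIV)"
  proof (intro summable_on_cmult_right summable_on_SigmaI)
    show "((\<lambda>y. ?g (fst (x, y)) * ?g (snd (x, y))) has_sum ?g x * infsum ?g UNIV) UNIV" for x
      unfolding fst_conv snd_conv by (intro has_sum_cmult_right has_sum_infsum summable_int_powr)
    show "(\<lambda>x. ?g x * infsum ?g UNIV) summable_on UNIV"
      by (intro summable_on_cmult_left summable_int_powr)
  qed auto
  then have "(\<lambda>p. 8 * (?g (fst p) * ?g (snd p))) summable_on (UNIV - {(0, 0)})"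
    by (rule summable_on_subset_banach) auto
  then show ?thesis
  proof (rule summable_on_comparison_test)
    fix p :: "int \<times> int" assume p: "p \<in> UNIV - {(0, 0)}"
    let ?s = "lat_size p"
    let ?u = "1 + \<bar>of_int (fst p)\<bar> :: real" and ?v = "1 + \<bar>of_int (snd p)\<bar> :: real"
    have s: "?s \<ge> 1" using lat_size_ge_1 p by simp
    have "?u \<le> 2 * ?s" using s abs_ge_zero[of "real_of_int (snd p)"] unfolding lat_size_def by argo
    moreover have "?v \<le> 2 * ?s" using s abs_ge_zero[of "real_of_int (fst p)"] unfolding lat_size_def by argo
    ultimately have "?u powr (3/2) * ?v powr (3/2) \<le> (2 * ?s) powr (3/2) * (2 * ?s) powr (3/2)"
      by (intro mult_mono powr_mono2) auto
    also have "\<dots> = (2 * ?s) powr (3/2 + 3/2)" by (rule powr_add[symmetric])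
    also have "\<dots> = (2 * ?s) ^ 3" using s by (simp add: powr_numeral)
    finally have "?u powr (3/2) * ?v powr (3/2) \<le> 8 * ?s ^ 3" by (simp add: power_mult_distrib)
    then have "8 / (8 * ?s ^ 3) \<le> 8 / (?u powr (3/2) * ?v powr (3/2))"
      using s by (intro divide_left_mono mult_pos_pos) auto
    also have "\<dots> = 8 * (?g (fst p) * ?g (snd p))" by (simp add: powr_minus_divide)
    finally show "1 / ?s ^ 3 \<le> 8 * (?g (fst p) * ?g (snd p))" by simp
    show "0 \<le> 1 / ?s ^ 3" using s by simp
  qed
qed

lemma summable_lat_size:
  assumes "k \<ge> 3"
  shows "(\<lambda>p. C / lat_size p ^ k) summable_on (UNIV - {(0, 0)})"
proof -
  have "(\<lambda>p. 1 / lat_size p ^ k) summable_on (UNIV - {(0, 0)})"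
    using summable_lat_size_3
  proof (rule summable_on_comparison_test)
    fix p :: "int \<times> int" assume p: "p \<in> UNIV - {(0, 0)}"
    then have s: "lat_size p \<ge> 1" using lat_size_ge_1 by simp
    then show "1 / lat_size p ^ k \<le> 1 / lat_size p ^ 3"
      using assms by (intro divide_left_mono power_increasing) auto
    show "0 \<le> 1 / lat_size p ^ k" using s by simp
  qed
  then have "(\<lambda>p. C * (1 / lat_size p ^ k)) summable_on (UNIV - {(0, 0)})"
    by (rule summable_on_cmult_right)
  then show ?thesis by simp
qed

lemma std_lattice_eq: "std_lattice \<tau> = range (lat_point \<tau>)"
proof (intro equalityI subsetI)
  fix w assume "w \<in> std_lattice \<tau>"
  then obtain m n where "w = of_int m + of_int n * \<tau>" unfolding std_lattice_def by blast
  then show "w \<in> range (lat_point \<tau>)"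
    by (intro image_eqI[of _ _ "(m, n)"]) (simp_all add: lat_point_def)
qed (auto simp: std_lattice_def lat_point_def)

lemma lat_point_eq_0:
  assumes "Im \<tau> > 0" "lat_point \<tau> p = 0"
  shows "p = (0, 0)"
proof -
  have "Im (lat_point \<tau> p) = 0" using assms by simp
  then have 1: "snd p = 0" using assms(1) by (simp add: lat_point_def)
  then have "fst p = 0" using assms(2) by (simp add: lat_point_def)
  with 1 show ?thesis by (simp add: prod_eq_iff)
qed

lemma inj_lat_point:
  assumes "Im \<tau> > 0"
  shows "inj (lat_point \<tau>)"
proof (rule injI)
  fix p q assume "lat_point \<tau> p = lat_point \<tau> q"
  then have "lat_point \<tau> (fst p - fst q, snd p - snd q) = 0"
    by (simp add: lat_point_def algebra_simps)
  from lat_point_eq_0[OF assms this] show "p = q" by (simp add: prod_eq_iff)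
qed

lemma std_lattice_minus_0:
  assumes "Im \<tau> > 0"
  shows "std_lattice \<tau> - {0} = lat_point \<tau> ` (UNIV - {(0, 0)})"
proof -
  have "lat_point \<tau> (0, 0) = 0" by (simp add: lat_point_def)
  then have "lat_point \<tau> ` {(0, 0)} = {0}" by simp
  then show ?thesis unfolding std_lattice_eq image_set_diff[OF inj_lat_point[OF assms]] by simp
qed

lemma complex_lattice_std:
  assumes "Im \<tau> > 0"
  shows "complex_lattice (std_lattice \<tau>)"
proof
  show "0 \<in> std_lattice \<tau>"
    unfolding std_lattice_eq by (rule image_eqI[of _ _ "(0, 0)"]) (simp_all add: lat_point_def)
  show "x - y \<in> std_lattice \<tau>" if xy: "x \<in> std_lattice \<tau>" "y \<in> std_lattice \<tau>" for x y
  proof -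
    obtain p q where "x = lat_point \<tau> p" "y = lat_point \<tau> q" using xy unfolding std_lattice_eq by blast
    then show ?thesis
      unfolding std_lattice_eq
      by (intro image_eqI[of _ _ "(fst p - fst q, snd p - snd q)"]) (simp_all add: lat_point_def algebra_simps)
  qed
  define D where "D = 1 + (\<bar>Re \<tau>\<bar> + 1) / Im \<tau>"
  have D: "D > 0" using assms by (simp add: D_def add_pos_nonneg)
  have "(\<lambda>p. 1 / norm (lat_point \<tau> p) ^ 3) summable_on (UNIV - {(0, 0)})"
    using summable_lat_size[OF order_refl, of "D ^ 3"]
  proof (rule summable_on_comparison_test)
    fix p :: "int \<times> int" assume p: "p \<in> UNIV - {(0, 0)}"
    have s: "lat_size p \<le> D * norm (lat_point \<tau> p)"
      unfolding D_def using assms by (intro lat_size_le) auto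
    have s1: "lat_size p \<ge> 1" using lat_size_ge_1 p by simp
    have "lat_size p ^ 3 \<le> (D * norm (lat_point \<tau> p)) ^ 3" using s s1 by (intro power_mono) auto
    moreover have "norm (lat_point \<tau> p) > 0" using lat_point_eq_0[OF assms, of p] p by auto
    ultimately show "1 / norm (lat_point \<tau> p) ^ 3 \<le> D ^ 3 / lat_size p ^ 3"
      using s1 by (simp add: field_simps power_mult_distrib)
  qed simp
  then show "(\<lambda>\<omega>. 1 / norm \<omega> ^ 3) summable_on (std_lattice \<tau> - {0})"
    unfolding std_lattice_minus_0[OF assms]
    by (subst summable_on_reindex) (auto intro: inj_on_subset[OF inj_lat_point[OF assms]] simp: o_def)
  show "\<exists>R. \<forall>z. \<exists>\<omega>\<in>std_lattice \<tau>. norm (z - \<omega>) \<le> R"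
  proof (intro exI allI)
    fix z
    \<comment> \<open>The lattice point comes from rounding the coordinates of z down, first along
      \<tau> and then along 1.\<close>
    define n where "n = \<lfloor>Im z / Im \<tau>\<rfloor>"
    define m where "m = \<lfloor>Re z - of_int n * Re \<tau>\<rfloor>"
    let ?w = "lat_point \<tau> (m, n)"
    have re: "\<bar>Re (z - ?w)\<bar> \<le> 1" unfolding lat_point_def m_def by simp linarith
    have "\<bar>Im z / Im \<tau> - of_int n\<bar> \<le> 1" unfolding n_def by linarith
    then have "\<bar>Im z / Im \<tau> - of_int n\<bar> * Im \<tau> \<le> Im \<tau>" using assms by simp
    then have "\<bar>(Im z / Im \<tau> - of_int n) * Im \<tau>\<bar> \<le> Im \<tau>" using assms by (simp add: abs_mult)
    moreover have "(Im z / Im \<tau> - of_int n) * Im \<tau> = Im (z - ?w)"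
      using assms by (simp add: lat_point_def left_diff_distrib)
    ultimately have "\<bar>Im (z - ?w)\<bar> \<le> Im \<tau>" by simp
    with re have "norm (z - ?w) \<le> 1 + Im \<tau>" using cmod_le[of "z - ?w"] by linarith
    moreover have "?w \<in> std_lattice \<tau>" unfolding std_lattice_eq by blast
    ultimately show "\<exists>\<omega>\<in>std_lattice \<tau>. norm (z - \<omega>) \<le> 1 + Im \<tau>" by blast
  qed
qed

lemma infsum_std_lattice:
  assumes "Im \<tau> > 0"
  shows "(\<Sum>\<^sub>\<infinity>\<omega>\<in>std_lattice \<tau> - {0}. f \<omega>) = (\<Sum>\<^sub>\<infinity>p\<in>UNIV - {(0, 0)}. f (lat_point \<tau> p))"
  unfolding std_lattice_minus_0[OF assms]
  by (subst infsum_reindex) (auto intro: inj_on_subset[OF inj_lat_point[OF assms]] simp: o_def)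

lemma uhp_local_bound:
  assumes "Im \<tau>0 > 0"
  obtains A D where "open A" "\<tau>0 \<in> A" "D > 0" "\<And>\<tau>. \<tau> \<in> A \<Longrightarrow> Im \<tau> > 0"
    "\<And>\<tau> x y. \<tau> \<in> A \<Longrightarrow> \<bar>x\<bar> + \<bar>y\<bar> \<le> D * norm (of_real x + of_real y * \<tau>)"
proof
  define A where "A = {\<tau>. Im \<tau> > Im \<tau>0 / 2} \<inter> ball \<tau>0 1"
  show "open A" unfolding A_def by (intro open_Int open_halfspace_Im_gt open_ball)
  show "\<tau>0 \<in> A" using assms by (simp add: A_def)
  show im: "Im \<tau> > 0" if "\<tau> \<in> A" for \<tau> using that assms by (simp add: A_def)
  show "1 + (\<bar>Re \<tau>0\<bar> + 1 + 1) / (Im \<tau>0 / 2) > 0" using assms by (simp add: add_pos_nonneg)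
  show "\<bar>x\<bar> + \<bar>y\<bar> \<le> (1 + (\<bar>Re \<tau>0\<bar> + 1 + 1) / (Im \<tau>0 / 2)) * norm (of_real x + of_real y * \<tau>)" if "\<tau> \<in> A" for \<tau> x y
  proof (rule lattice_norm_bound)
    have "\<bar>Re (\<tau> - \<tau>0)\<bar> \<le> norm (\<tau> - \<tau>0)" by (rule abs_Re_le_cmod)
    also have "\<dots> < 1" using that by (simp add: A_def dist_norm norm_minus_commute)
    finally show "\<bar>Re \<tau>\<bar> \<le> \<bar>Re \<tau>0\<bar> + 1" by simp
  qed (use that assms in \<open>auto simp: A_def\<close>)
qed

section \<open>Holomorphic dependence on \<tau>\<close>

lemma holomorphic_on_uhpI:
  assumes "\<And>\<tau>. Im \<tau> > 0 \<Longrightarrow> f analytic_on {\<tau>}"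
  shows "f holomorphic_on upper_half_plane"
proof (rule analytic_imp_holomorphic)
  show "f analytic_on upper_half_plane"
    by (subst analytic_on_analytic_at) (use assms in \<open>auto simp: in_uhp\<close>)
qed

lemma holomorphic_eis:
  assumes k: "k \<ge> 3"
  shows "(\<lambda>\<tau>. eis (std_lattice \<tau>) k) holomorphic_on upper_half_plane"
proof (rule holomorphic_on_uhpI)
  fix \<tau>0 :: complex assume "Im \<tau>0 > 0"
  then obtain A D where A: "open A" "\<tau>0 \<in> A" "D > 0" and im: "\<And>\<tau>. \<tau> \<in> A \<Longrightarrow> Im \<tau> > 0"
    and bd: "\<And>\<tau> x y. \<tau> \<in> A \<Longrightarrow> \<bar>x\<bar> + \<bar>y\<bar> \<le> D * norm (of_real x + of_real y * \<tau>)"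
    using uhp_local_bound by blast
  have "(\<lambda>\<tau>. \<Sum>\<^sub>\<infinity>p\<in>UNIV - {(0, 0)}. 1 / lat_point \<tau> p ^ k) analytic_on {\<tau>0}"
  proof (rule infsum_holomorphic_uniform(1)[OF A(1) _ _ summable_lat_size[OF k] A(2)])
    fix p :: "int \<times> int" assume p: "p \<in> UNIV - {(0, 0)}"
    have nz: "lat_point \<tau> p \<noteq> 0" if "\<tau> \<in> A" for \<tau>
      using lat_point_eq_0[OF im[OF that], of p] p by auto
    then show "(\<lambda>\<tau>. 1 / lat_point \<tau> p ^ k) holomorphic_on A"
      unfolding lat_point_def by (intro holomorphic_intros) auto
    fix \<tau> assume t: "\<tau> \<in> A"
    have "lat_size p \<le> D * norm (lat_point \<tau> p)"
      using bd[OF t, of "of_int (fst p)" "of_int (snd p)"] by (simp add: lat_size_def lat_point_def)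
    moreover have s1: "lat_size p \<ge> 1" using lat_size_ge_1 p by simp
    ultimately have "lat_size p ^ k \<le> (D * norm (lat_point \<tau> p)) ^ k" by (intro power_mono) auto
    then show "norm (1 / lat_point \<tau> p ^ k) \<le> D ^ k / lat_size p ^ k"
      using s1 nz[OF t] by (simp add: norm_divide norm_power field_simps power_mult_distrib)
  qed
  moreover have "eventually (\<lambda>\<tau>. \<tau> \<in> A) (nhds \<tau>0)" using A by (intro eventually_nhds_in_open)
  then have "eventually (\<lambda>\<tau>. (\<Sum>\<^sub>\<infinity>p\<in>UNIV - {(0, 0)}. 1 / lat_point \<tau> p ^ k) = eis (std_lattice \<tau>) k) (nhds \<tau>0)"
    by eventually_elim (simp add: eis_def infsum_std_lattice[OF im])
  from analytic_at_cong[OF this refl] have "(\<lambda>\<tau>. \<Sum>\<^sub>\<infinity>p\<in>UNIV - {(0, 0)}. 1 / lat_point \<tau> p ^ k) analytic_on {\<tau>0}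
      \<longleftrightarrow> (\<lambda>\<tau>. eis (std_lattice \<tau>) k) analytic_on {\<tau>0}" .
  ultimately show "(\<lambda>\<tau>. eis (std_lattice \<tau>) k) analytic_on {\<tau>0}"
    by blast
qed

lemma holomorphic_x_form:
  assumes l: "l = 1 \<or> l = 2"
  shows "x_form l holomorphic_on upper_half_plane"
proof (rule holomorphic_on_uhpI)
  fix \<tau>0 :: complex assume "Im \<tau>0 > 0"
  then obtain A D where A: "open A" "\<tau>0 \<in> A" "D > 0" and im: "\<And>\<tau>. \<tau> \<in> A \<Longrightarrow> Im \<tau> > 0"
    and bd: "\<And>\<tau> x y. \<tau> \<in> A \<Longrightarrow> \<bar>x\<bar> + \<bar>y\<bar> \<le> D * norm (of_real x + of_real y * \<tau>)"
    using uhp_local_bound by blast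
  define z :: complex where "z = of_nat l / 5"
  have zr: "z = of_real (real l / 5)" by (simp add: z_def)
  have l5: "0 < real l / 5" "real l / 5 \<le> 2 / 5" using l by auto
  have nz: "norm z \<le> 2 / 5" unfolding zr norm_of_real using l5 by simp
  have "(\<lambda>\<tau>. \<Sum>\<^sub>\<infinity>p\<in>UNIV - {(0, 0)}. 1 / (z - lat_point \<tau> p)\<^sup>2 - 1 / (lat_point \<tau> p)\<^sup>2) analytic_on {\<tau>0}"
  proof (rule infsum_holomorphic_uniform(1)[OF A(1) _ _ summable_lat_size[OF order_refl] A(2)])
    fix p :: "int \<times> int" assume p: "p \<in> UNIV - {(0, 0)}"
    have s1: "lat_size p \<ge> 1" using lat_size_ge_1 p by simp
    have b1: "lat_size p \<le> D * norm (lat_point \<tau> p)" if "\<tau> \<in> A" for \<tau>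
      using bd[OF that, of "of_int (fst p)" "of_int (snd p)"] by (simp add: lat_size_def lat_point_def)
    \<comment> \<open>Since l/5 \<le> 2/5, a nonzero integer m satisfies |m - l/5| \<ge> |m| - 2/5
      \<ge> (3/5) |m|. This keeps l/5 away from the nonzero lattice points uniformly in
      \<tau>.\<close>
    have b2: "3 / 5 * lat_size p \<le> D * norm (z - lat_point \<tau> p)" if "\<tau> \<in> A" for \<tau>
    proof -
      have "3 / 5 * lat_size p \<le> \<bar>of_int (fst p) - real l / 5\<bar> + \<bar>of_int (snd p)\<bar>"
      proof -
        have "3 / 5 * \<bar>of_int m\<bar> \<le> \<bar>of_int m - real l / 5\<bar>" for m :: int
        proof -
          consider "m = 0" | "m \<ge> 1" | "m \<le> - 1" by linarith
          then show ?thesis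
          proof cases
            case 2
            then have "real_of_int m \<ge> 1" by simp
            then show ?thesis using l5 by linarith
          next
            case 3
            then have "real_of_int m \<le> - 1" by linarith
            then show ?thesis using l5 by linarith
          qed (use l5 in simp)
        qed
        from this[of "fst p"] show ?thesis
          using abs_ge_zero[of "real_of_int (snd p)"] unfolding lat_size_def by argo
      qed
      also have "\<dots> \<le> D * norm (of_real (of_int (fst p) - real l / 5) + of_real (of_int (snd p)) * \<tau>)"
        by (rule bd[OF that])
      also have "of_real (of_int (fst p) - real l / 5) + of_real (of_int (snd p)) * \<tau> = - (z - lat_point \<tau> p)"
        by (simp add: zr lat_point_def)
      finally show ?thesis by (simp add: norm_minus_commute)
    qed
    have n1: "norm (lat_point \<tau> p) > 0" and n2: "norm (z - lat_point \<tau> p) > 0" if "\<tau> \<in> A" for \<tau>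

    proof -
      have "D * norm (lat_point \<tau> p) > 0" "D * norm (z - lat_point \<tau> p) > 0"
        using b1[OF that] b2[OF that] s1 by (auto intro: order.strict_trans2)
      then show "norm (lat_point \<tau> p) > 0" "norm (z - lat_point \<tau> p) > 0"
        using A(3) by (auto simp: zero_less_mult_iff)
    qed
    show "(\<lambda>\<tau>. 1 / (z - lat_point \<tau> p)\<^sup>2 - 1 / (lat_point \<tau> p)\<^sup>2) holomorphic_on A"
      using n1 n2 unfolding lat_point_def by (intro holomorphic_intros) auto
    fix \<tau> assume t: "\<tau> \<in> A"
    let ?w = "lat_point \<tau> p"
    define u where "u = 1 / norm ?w"
    define v where "v = 1 / norm (z - ?w)"
    have w0: "?w \<noteq> 0" "z - ?w \<noteq> 0" using n1[OF t] n2[OF t] by auto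
    \<comment> \<open>With d = z - w the factor w + d is z, so the difference is a bounded factor
      times terms of total degree - 3. The constant below is 16/9 = (2/5) (25/9 + 5/3).\<close>
    have *: "1 / d\<^sup>2 - 1 / w\<^sup>2 = (w + d) * (1 / (w * d\<^sup>2) - 1 / (w\<^sup>2 * d))"
      if "w \<noteq> 0" "d \<noteq> 0" for w d :: complex
      using that by (simp add: field_simps power2_eq_square)
    have "1 / (z - ?w)\<^sup>2 - 1 / ?w\<^sup>2 = z * (1 / (?w * (z - ?w)\<^sup>2) - 1 / (?w\<^sup>2 * (z - ?w)))"
      using *[OF w0] by simp
    then have "norm (1 / (z - ?w)\<^sup>2 - 1 / ?w\<^sup>2) \<le> norm z * (norm (1 / (?w * (z - ?w)\<^sup>2)) + norm (1 / (?w\<^sup>2 * (z - ?w))))"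
      by (simp only: norm_mult) (intro mult_left_mono norm_triangle_ineq4 norm_ge_zero)
    also have "\<dots> = norm z * (u * v\<^sup>2 + u\<^sup>2 * v)"
      by (simp add: u_def v_def norm_divide norm_mult norm_power power_divide)
    also have "\<dots> \<le> 2 / 5 * ((D / lat_size p) * (5 / 3 * D / lat_size p)\<^sup>2 + (D / lat_size p)\<^sup>2 * (5 / 3 * D / lat_size p))"
    proof -
      have "u \<le> D / lat_size p" using b1[OF t] s1 n1[OF t] by (simp add: u_def field_simps)
      moreover have "v \<le> 5 / 3 * D / lat_size p" using b2[OF t] s1 n2[OF t] by (simp add: v_def field_simps)
      moreover have "0 \<le> u" "0 \<le> v" by (simp_all add: u_def v_def)
      ultimately show ?thesis
        using nz s1 A(3) by (intro mult_mono add_mono power_mono) auto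
    qed
    also have "\<dots> = 16 / 9 * (D ^ 3 / lat_size p ^ 3)"
      using s1 by (simp add: power2_eq_square power3_eq_cube field_simps)
    also have "\<dots> \<le> 3 * D ^ 3 / lat_size p ^ 3"
      using mult_right_mono[of "16 / 9" 3 "D ^ 3 / lat_size p ^ 3"] s1 A(3) by simp
    finally show "norm (1 / (z - lat_point \<tau> p)\<^sup>2 - 1 / (lat_point \<tau> p)\<^sup>2) \<le> 3 * D ^ 3 / lat_size p ^ 3" .
  qed
  then have an: "(\<lambda>\<tau>. - (1 / of_real pi ^ 2) * (1 / z\<^sup>2 + (\<Sum>\<^sub>\<infinity>p\<in>UNIV - {(0, 0)}. 1 / (z - lat_point \<tau> p)\<^sup>2 - 1 / (lat_point \<tau> p)\<^sup>2)))
    analytic_on {\<tau>0}"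
    by (intro analytic_intros) (use l in \<open>auto simp: z_def\<close>)
  have "eventually (\<lambda>\<tau>. \<tau> \<in> A) (nhds \<tau>0)" using A by (intro eventually_nhds_in_open)
  then have "eventually (\<lambda>\<tau>. - (1 / of_real pi ^ 2) * (1 / z\<^sup>2 + (\<Sum>\<^sub>\<infinity>p\<in>UNIV - {(0, 0)}. 1 / (z - lat_point \<tau> p)\<^sup>2 - 1 / (lat_point \<tau> p)\<^sup>2))
      = x_form l \<tau>) (nhds \<tau>0)"
    by eventually_elim (simp add: x_form_def weierstrass_p_def infsum_std_lattice[OF im] z_def)
  from analytic_at_cong[OF this refl] an show "x_form l analytic_on {\<tau>0}" by blast
qed

section \<open>Homogeneity and the action of the modular group on lattices\<close>

lemma eis_scale:
  assumes "c \<noteq> 0"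
  shows "eis ((\<lambda>w. c * w) ` L) k = eis L k / c ^ k"
proof -
  have "(\<lambda>w. c * w) ` L - {0} = (\<lambda>w. c * w) ` (L - {0})" using assms by auto
  then have "eis ((\<lambda>w. c * w) ` L) k = (\<Sum>\<^sub>\<infinity>w\<in>L - {0}. 1 / (c * w) ^ k)"
    unfolding eis_def using assms by (simp add: infsum_reindex inj_on_def o_def)
  also have "\<dots> = (\<Sum>\<^sub>\<infinity>w\<in>L - {0}. (1 / c ^ k) * (1 / w ^ k))"
    by (simp add: power_mult_distrib)
  also have "\<dots> = 1 / c ^ k * eis L k"
    unfolding eis_def by (rule infsum_cmult_right')
  finally show ?thesis by simp
qed

lemma weierstrass_p_scale:
  assumes "c \<noteq> 0"
  shows "weierstrass_p (c * z) ((\<lambda>w. c * w) ` L) = weierstrass_p z L / c\<^sup>2"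
proof -
  have *: "1 / (c * z - c * w)\<^sup>2 - 1 / (c * w)\<^sup>2 = 1 / c\<^sup>2 * (1 / (z - w)\<^sup>2 - 1 / w\<^sup>2)" for w
    unfolding right_diff_distrib[symmetric] power_mult_distrib by (simp add: right_diff_distrib)
  have "(\<lambda>w. c * w) ` L - {0} = (\<lambda>w. c * w) ` (L - {0})" using assms by auto
  then have "(\<Sum>\<^sub>\<infinity>\<omega>\<in>(\<lambda>w. c * w) ` L - {0}. 1 / (c * z - \<omega>)\<^sup>2 - 1 / \<omega>\<^sup>2)
      = (\<Sum>\<^sub>\<infinity>w\<in>L - {0}. 1 / (c * z - c * w)\<^sup>2 - 1 / (c * w)\<^sup>2)"
    using assms by (simp add: infsum_reindex inj_on_def o_def)
  also have "\<dots> = 1 / c\<^sup>2 * (\<Sum>\<^sub>\<infinity>w\<in>L - {0}. 1 / (z - w)\<^sup>2 - 1 / w\<^sup>2)"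
    unfolding * by (rule infsum_cmult_right')
  finally show ?thesis
    unfolding weierstrass_p_def by (simp add: power_mult_distrib add_divide_distrib)
qed

definition automorphy :: "int mat \<Rightarrow> complex \<Rightarrow> complex" where
  "automorphy \<gamma> \<tau> = of_int (\<gamma> $$ (1, 0)) * \<tau> + of_int (\<gamma> $$ (1, 1))"

lemma slash_eq: "slash k f \<gamma> \<tau> = f (mobius_act \<gamma> \<tau>) / automorphy \<gamma> \<tau> ^ k"
  by (simp add: slash_def automorphy_def)

lemma det_2x2:
  assumes "A \<in> carrier_mat 2 2"
  shows "Determinant.det A = A $$ (0, 0) * A $$ (1, 1) - A $$ (0, 1) * A $$ (1, 0)"
proof -
  have "Determinant.det (mat_delete A i 0) = mat_delete A i 0 $$ (0, 0)" if "i < 2" for i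
    by (rule det_single) (use assms that in \<open>simp add: mat_delete_def\<close>)
  then show ?thesis
    using assms unfolding laplace_expansion_column[OF assms, of 0, simplified]
    by (simp add: numeral_2_eq_2 cofactor_def mat_delete_def algebra_simps)
qed

lemma SL2Z_det:
  assumes "\<gamma> \<in> SL2Z"
  shows "\<gamma> $$ (0, 0) * \<gamma> $$ (1, 1) - \<gamma> $$ (0, 1) * \<gamma> $$ (1, 0) = 1"
  using assms det_2x2[of \<gamma>] by (simp add: SL2Z_def)

lemma automorphy_nz:
  assumes "\<gamma> \<in> SL2Z" "Im \<tau> > 0"
  shows "automorphy \<gamma> \<tau> \<noteq> 0"
proof
  assume 0: "automorphy \<gamma> \<tau> = 0"
  then have "Im (automorphy \<gamma> \<tau>) = 0" by simp
  then have "\<gamma> $$ (1, 0) = 0" using assms(2) by (simp add: automorphy_def)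
  moreover from this 0 have "\<gamma> $$ (1, 1) = 0" by (simp add: automorphy_def)
  ultimately show False using SL2Z_det[OF assms(1)] by simp
qed

text \<open>The matrix \<gamma> turns the basis (\<tau>, 1) into another basis of the same lattice,
  and dividing by the automorphy factor normalises it. With homogeneity, every slash of a lattice
  sum becomes a sum over the lattice of \<tau>.\<close>

lemma std_lattice_mobius:
  assumes \<gamma>: "\<gamma> \<in> SL2Z" and \<tau>: "Im \<tau> > 0"
  shows "std_lattice \<tau> = (\<lambda>w. automorphy \<gamma> \<tau> * w) ` std_lattice (mobius_act \<gamma> \<tau>)"
proof -
  define A B C D where "A = \<gamma> $$ (0, 0)" and "B = \<gamma> $$ (0, 1)" and "C = \<gamma> $$ (1, 0)" and "D = \<gamma> $$ (1, 1)"
  define j where "j = automorphy \<gamma> \<tau>"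
  have det: "A * D - B * C = 1" using SL2Z_det[OF \<gamma>] by (simp add: A_def B_def C_def D_def)
  then have det': "of_int A * of_int D - of_int B * of_int C = (1 :: complex)"
    by (simp flip: of_int_mult of_int_diff)
  have j: "j = of_int C * \<tau> + of_int D" by (simp add: j_def automorphy_def C_def D_def)
  have jm: "j * mobius_act \<gamma> \<tau> = of_int A * \<tau> + of_int B"
    using automorphy_nz[OF \<gamma> \<tau>] unfolding mobius_act_def j_def automorphy_def A_def B_def by simp
  have img: "j * (of_int m + of_int n * mobius_act \<gamma> \<tau>) = of_int (m * D + n * B) + of_int (m * C + n * A) * \<tau>" for m n
  proof -
    have "j * (of_int m + of_int n * mobius_act \<gamma> \<tau>) = of_int m * j + of_int n * (j * mobius_act \<gamma> \<tau>)"
      by (simp add: algebra_simps)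
    then show ?thesis unfolding jm unfolding j by (simp add: algebra_simps)
  qed
  show ?thesis unfolding j_def[symmetric]
  proof (intro equalityI subsetI)
    fix w assume "w \<in> std_lattice \<tau>"
    then obtain m n where w: "w = of_int m + of_int n * \<tau>" unfolding std_lattice_def by blast
    \<comment> \<open>The new coordinates come from the inverse of \<gamma>, which is integral
      because the determinant is 1.\<close>
    have "(m * A - n * B) * D + (n * D - m * C) * B = m" "(m * A - n * B) * C + (n * D - m * C) * A = n"
      using det by Groebner_Basis.algebra+
    then have "w = j * (of_int (m * A - n * B) + of_int (n * D - m * C) * mobius_act \<gamma> \<tau>)"
      unfolding img w by (simp only:)
    then show "w \<in> (\<lambda>w. j * w) ` std_lattice (mobius_act \<gamma> \<tau>)"
      unfolding std_lattice_def by blast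
  next
    fix w assume "w \<in> (\<lambda>w. j * w) ` std_lattice (mobius_act \<gamma> \<tau>)"
    then obtain m n where "w = j * (of_int m + of_int n * mobius_act \<gamma> \<tau>)" unfolding std_lattice_def by blast
    then show "w \<in> std_lattice \<tau>" unfolding img std_lattice_def by blast
  qed
qed

lemma Im_mobius_pos:
  assumes \<gamma>: "\<gamma> \<in> SL2Z" and \<tau>: "Im \<tau> > 0"
  shows "Im (mobius_act \<gamma> \<tau>) > 0"
proof -
  define A B C D where "A = real_of_int (\<gamma> $$ (0, 0))" and "B = real_of_int (\<gamma> $$ (0, 1))"
    and "C = real_of_int (\<gamma> $$ (1, 0))" and "D = real_of_int (\<gamma> $$ (1, 1))"
  have det: "A * D - B * C = 1"
    using SL2Z_det[OF \<gamma>] unfolding A_def B_def C_def D_def by (simp flip: of_int_mult of_int_diff)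
  define j where "j = automorphy \<gamma> \<tau>"
  have j0: "j \<noteq> 0" using automorphy_nz[OF assms] by (simp add: j_def)
  have j: "j = of_real C * \<tau> + of_real D" by (simp add: j_def automorphy_def C_def D_def)
  have m: "mobius_act \<gamma> \<tau> = (of_real A * \<tau> + of_real B) / j"
    by (simp add: mobius_act_def j A_def B_def C_def D_def)
  have "Im (mobius_act \<gamma> \<tau>) = (A * D - B * C) * Im \<tau> / (cmod j)\<^sup>2"
    unfolding m Im_divide cmod_power2 by (simp add: j algebra_simps)
  then show ?thesis using det \<tau> j0 by simp
qed

text \<open>Reducing j modulo 5 changes j z by an element of L. The union of five cosets is thus the
  group L + Z z, and the lattice computations below become linear.\<close>

lemma (in complex_lattice) superlattice_iff:
  assumes "5 * z \<in> L"
  shows "w \<in> superlattice L z \<longleftrightarrow> (\<exists>j::int. \<exists>v\<in>L. w = of_int j * z + v)"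
proof
  assume "w \<in> superlattice L z"
  then obtain j v where "v \<in> L" "w = of_nat j * z + v" unfolding superlattice_def by blast
  then show "\<exists>j::int. \<exists>v\<in>L. w = of_int j * z + v" by (intro exI[of _ "int j"] bexI[of _ v]) simp_all
next
  assume "\<exists>j::int. \<exists>v\<in>L. w = of_int j * z + v"
  then obtain j v where jv: "v \<in> L" "w = of_int j * z + v" by blast
  have nat_mult: "of_nat n * u \<in> L" if "u \<in> L" for n u
    using that by (induction n) (auto simp: distrib_right intro: add_in)
  have int_mult: "of_int n * u \<in> L" if "u \<in> L" for n u
    using nat_mult[OF that, of "nat n"] nat_mult[OF that, of "nat (- n)"]
    by (cases "n \<ge> 0") (auto simp: of_nat_nat)
  define i where "i = nat (j mod 5)"
  have i: "i < 5" "int i = j mod 5" by (simp_all add: i_def)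
  have j: "j = 5 * (j div 5) + int i" using i by simp
  have "of_int j = of_int (j div 5) * 5 + (of_nat i :: complex)"
    by (subst j) simp
  then have "w = of_nat i * z + (of_int (j div 5) * (5 * z) + v)"
    by (simp add: jv(2) algebra_simps)
  moreover have "of_int (j div 5) * (5 * z) + v \<in> L"
    using jv assms by (intro add_in int_mult)
  ultimately show "w \<in> superlattice L z" using i unfolding superlattice_def by blast
qed

lemma superlattice_scale: "superlattice ((\<lambda>w. c * w) ` L) (c * z) = (\<lambda>w. c * w) ` superlattice L z"
proof -
  have "(\<lambda>\<omega>. of_nat j * (c * z) + \<omega>) ` (\<lambda>w. c * w) ` L = (\<lambda>w. c * w) ` (\<lambda>\<omega>. of_nat j * z + \<omega>) ` L" for j :: nat
    unfolding image_image by (rule image_cong[OF refl]) (simp add: distrib_left mult_ac)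
  then show ?thesis unfolding superlattice_def image_UN by simp
qed

lemma std_latticeI: "of_int m + of_int n * \<tau> \<in> std_lattice \<tau>"
  unfolding std_lattice_def by blast

lemma superlattice_std_iff:
  assumes "Im \<tau> > 0" "5 * z \<in> std_lattice \<tau>"
  shows "w \<in> superlattice (std_lattice \<tau>) z \<longleftrightarrow> (\<exists>j m n. w = of_int j * z + (of_int m + of_int n * \<tau>))"
  unfolding complex_lattice.superlattice_iff[OF complex_lattice_std[OF assms(1)] assms(2)]
  by (auto simp: std_lattice_def)

lemma five_torsion_std: "5 * ((of_int m + of_int n * \<tau>) / 5) \<in> std_lattice \<tau>"
  by (subst times_divide_eq_right, subst nonzero_mult_div_cancel_left) (simp_all only: std_latticeI, simp)

text \<open>The origin of the factors 5^4 and 5^6 in a' and b': scaling a lattice by 1/5 multiplies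
  its Eisenstein series of weight k by 5^k.\<close>

lemma superlattice_std_fifth:
  assumes "Im \<tau> > 0"
  shows "superlattice (std_lattice \<tau>) (1 / 5) = (\<lambda>w. 1 / 5 * w) ` std_lattice (5 * \<tau>)"
proof -
  have t5: "5 * (1 / 5 :: complex) \<in> std_lattice \<tau>" using five_torsion_std[of 1 0 \<tau>] by simp
  show ?thesis
  proof (intro equalityI subsetI)
    fix w assume "w \<in> superlattice (std_lattice \<tau>) (1 / 5)"
    then obtain j m n where "w = of_int j * (1 / 5) + (of_int m + of_int n * \<tau>)"
      unfolding superlattice_std_iff[OF assms t5] by blast
    then have "w = 1 / 5 * (of_int (j + 5 * m) + of_int n * (5 * \<tau>))" by (simp add: field_simps)
    then show "w \<in> (\<lambda>w. 1 / 5 * w) ` std_lattice (5 * \<tau>)" unfolding std_lattice_def by blast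
  next
    fix w assume "w \<in> (\<lambda>w. 1 / 5 * w) ` std_lattice (5 * \<tau>)"
    then obtain m n where "w = 1 / 5 * (of_int m + of_int n * (5 * \<tau>))" unfolding std_lattice_def by blast
    then have "w = of_int m * (1 / 5) + (of_int 0 + of_int n * \<tau>)" by (simp add: field_simps)
    then show "w \<in> superlattice (std_lattice \<tau>) (1 / 5)"
      unfolding superlattice_std_iff[OF assms t5] by blast
  qed
qed

text \<open>For k = 0, ..., 4 these are the other five subgroups of order 5; they account for the
  arguments (\<tau> + k) / 5 of the conjugates of a'.\<close>

lemma superlattice_std_shift:
  assumes "Im \<tau> > 0"
  shows "superlattice (std_lattice \<tau>) ((\<tau> + of_int k) / 5) = std_lattice ((\<tau> + of_int k) / 5)"
proof -
  define z where "z = (\<tau> + of_int k) / 5"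
  have t5: "5 * z \<in> std_lattice \<tau>" using five_torsion_std[of k 1 \<tau>] by (simp add: z_def add.commute)
  have tz: "\<tau> = 5 * z - of_int k" by (simp add: z_def field_simps)
  have "superlattice (std_lattice \<tau>) z = std_lattice z"
  proof (intro equalityI subsetI)
    fix w assume "w \<in> superlattice (std_lattice \<tau>) z"
    then obtain j m n where "w = of_int j * z + (of_int m + of_int n * \<tau>)"
      unfolding superlattice_std_iff[OF assms t5] by blast
    then have "w = of_int (m - n * k) + of_int (j + 5 * n) * z" unfolding tz by (simp add: algebra_simps)
    then show "w \<in> std_lattice z" unfolding std_lattice_def by blast
  next
    fix w assume "w \<in> std_lattice z"
    then obtain m n where "w = of_int m + of_int n * z" unfolding std_lattice_def by blast
    then have "w = of_int n * z + (of_int m + of_int 0 * \<tau>)" by simp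
    then show "w \<in> superlattice (std_lattice \<tau>) z"
      unfolding superlattice_std_iff[OF assms t5] by blast
  qed
  then show ?thesis unfolding z_def .
qed

text \<open>The subgroup generated by \<open>(c \<tau> + d) / 5\<close> only depends on \<open>c\<close>, \<open>d\<close> up to units modulo 5.\<close>

lemma superlattice_Gamma0:
  assumes \<tau>: "Im \<tau> > 0" and \<gamma>: "\<gamma> \<in> Gamma0 5"
  shows "superlattice (std_lattice \<tau>) (automorphy \<gamma> \<tau> / 5) = superlattice (std_lattice \<tau>) (1 / 5)"
proof -
  define D where "D = \<gamma> $$ (1, 1)"
  obtain c where c: "\<gamma> $$ (1, 0) = 5 * c" using \<gamma> by (auto simp: Gamma0_def elim: dvdE)
  have det: "\<gamma> $$ (0, 0) * D - \<gamma> $$ (0, 1) * (5 * c) = 1"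
    using SL2Z_det[of \<gamma>] \<gamma> c by (simp add: Gamma0_def D_def)
  define A where "A = \<gamma> $$ (0, 0)"
  define B where "B = \<gamma> $$ (0, 1) * c"
  \<comment> \<open>\<open>A\<close> is an inverse of \<open>D\<close> modulo 5. It recovers 1/5
    from z, which is D/5 modulo the lattice.\<close>
  have AD: "A * D - 5 * B = 1" using det by (simp add: A_def B_def mult_ac)
  define z where "z = automorphy \<gamma> \<tau> / 5"
  have z: "z = of_int c * \<tau> + of_int D * (1 / 5)"
    using c by (simp add: z_def automorphy_def D_def field_simps)
  have t5: "5 * (1 / 5 :: complex) \<in> std_lattice \<tau>" using five_torsion_std[of 1 0 \<tau>] by simp
  have tz5: "5 * z \<in> std_lattice \<tau>"
    using std_latticeI[of D "5 * c" \<tau>] by (simp add: z algebra_simps)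
  have "superlattice (std_lattice \<tau>) z = superlattice (std_lattice \<tau>) (1 / 5)"
  proof (intro equalityI subsetI)
    fix w assume "w \<in> superlattice (std_lattice \<tau>) z"
    then obtain j m n where "w = of_int j * z + (of_int m + of_int n * \<tau>)"
      unfolding superlattice_std_iff[OF \<tau> tz5] by blast
    then have "w = of_int (j * D) * (1 / 5) + (of_int m + of_int (n + j * c) * \<tau>)"
      unfolding z by (simp add: algebra_simps)
    then show "w \<in> superlattice (std_lattice \<tau>) (1 / 5)"
      unfolding superlattice_std_iff[OF \<tau> t5] by blast
  next
    fix w assume "w \<in> superlattice (std_lattice \<tau>) (1 / 5)"
    then obtain j m n where w: "w = of_int j * (1 / 5) + (of_int m + of_int n * \<tau>)"
      unfolding superlattice_std_iff[OF \<tau> t5] by blast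
    have "of_int A * of_int D - 5 * of_int B = (1 :: complex)"
      using AD by (metis of_int_1 of_int_diff of_int_mult of_int_numeral)
    then have "w = of_int (j * A) * z + (of_int (m - j * B) + of_int (n - j * A * c) * \<tau>)"
      unfolding z w of_int_mult of_int_diff by Groebner_Basis.algebra
    then show "w \<in> superlattice (std_lattice \<tau>) z"
      unfolding superlattice_std_iff[OF \<tau> tz5] by blast
  qed
  then show ?thesis unfolding z_def .
qed

lemma superlattice_subset:
  assumes \<tau>: "Im \<tau> > 0" and u: "5 * u \<in> std_lattice \<tau>"
  shows "superlattice (std_lattice \<tau>) u \<subseteq> (\<lambda>w. 1 / 5 * w) ` std_lattice \<tau>"
proof
  fix w assume "w \<in> superlattice (std_lattice \<tau>) u"
  then obtain j m n where w: "w = of_int j * u + (of_int m + of_int n * \<tau>)"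
    unfolding superlattice_std_iff[OF \<tau> u] by blast
  obtain m' n' where u': "5 * u = of_int m' + of_int n' * \<tau>" using u unfolding std_lattice_def by blast
  have "w = 1 / 5 * (of_int j * (5 * u) + 5 * (of_int m + of_int n * \<tau>))" unfolding w by (simp add: algebra_simps)
  also have "\<dots> = 1 / 5 * (of_int (j * m' + 5 * m) + of_int (j * n' + 5 * n) * \<tau>)"
    unfolding u' by (simp add: algebra_simps)
  finally show "w \<in> (\<lambda>w. 1 / 5 * w) ` std_lattice \<tau>" unfolding std_lattice_def by blast
qed

lemma std_lattice_shift: "std_lattice (\<tau> + of_int k) = std_lattice \<tau>"
proof (intro equalityI subsetI)
  fix w assume "w \<in> std_lattice (\<tau> + of_int k)"
  then obtain m n where "w = of_int m + of_int n * (\<tau> + of_int k)" unfolding std_lattice_def by blast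
  then have "w = of_int (m + n * k) + of_int n * \<tau>" by (simp add: algebra_simps)
  then show "w \<in> std_lattice \<tau>" unfolding std_lattice_def by blast
next
  fix w assume "w \<in> std_lattice \<tau>"
  then obtain m n where "w = of_int m + of_int n * \<tau>" unfolding std_lattice_def by blast
  then have "w = of_int (m - n * k) + of_int n * (\<tau> + of_int k)" by (simp add: algebra_simps)
  then show "w \<in> std_lattice (\<tau> + of_int k)" unfolding std_lattice_def by blast
qed

text \<open>The bound depends on the ambient lattice L/5 alone and not on the subset, so it applies
  to all slashes of a form and covers all cusps at once.\<close>

lemma eis_bounded:
  assumes k: "k \<ge> 3"
  shows "\<exists>B. \<forall>\<tau> S. Im \<tau> \<ge> 1 \<longrightarrow> S \<subseteq> (\<lambda>w. 1 / 5 * w) ` std_lattice \<tau> \<longrightarrow> norm (eis S k) \<le> B"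
proof -
  \<comment> \<open>15 is 3 times 5: \<open>lat_size_le\<close> with X = Y = 1 gives 3, and 5 comes
    from the scaling by 1/5.\<close>
  define M where "M p = 15 ^ k / lat_size p ^ k" for p
  have M: "M summable_on (UNIV - {(0, 0)})" unfolding M_def by (rule summable_lat_size[OF k])
  have main: "norm (eis S k) \<le> infsum M (UNIV - {(0, 0)})"
    if \<tau>: "Im \<tau> \<ge> 1" "\<bar>Re \<tau>\<bar> \<le> 1" and S: "S \<subseteq> (\<lambda>w. 1 / 5 * w) ` std_lattice \<tau>" for \<tau> S
  proof -
    have pos: "Im \<tau> > 0" using \<tau> by simp
    define I where "I = {p \<in> UNIV - {(0, 0)}. 1 / 5 * lat_point \<tau> p \<in> S}"
    have inj: "inj_on (\<lambda>p. 1 / 5 * lat_point \<tau> p) I"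
      using inj_lat_point[OF pos] by (auto simp: inj_on_def)
    have SI: "S - {0} = (\<lambda>p. 1 / 5 * lat_point \<tau> p) ` I"
    proof (intro equalityI subsetI)
      fix w assume w: "w \<in> S - {0}"
      then obtain p where p: "w = 1 / 5 * lat_point \<tau> p" using S unfolding std_lattice_eq by blast
      then have "lat_point \<tau> p \<noteq> 0" using w by auto
      then have "p \<noteq> (0, 0)" by (auto simp: lat_point_def)
      then show "w \<in> (\<lambda>p. 1 / 5 * lat_point \<tau> p) ` I" using p w unfolding I_def by blast
    next
      fix w assume "w \<in> (\<lambda>p. 1 / 5 * lat_point \<tau> p) ` I"
      then obtain p where p: "w = 1 / 5 * lat_point \<tau> p" "p \<noteq> (0, 0)" "w \<in> S" unfolding I_def by blast
      then show "w \<in> S - {0}" using lat_point_eq_0[OF pos, of p] by auto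
    qed
    have MI: "M summable_on I" using M by (rule summable_on_subset_banach) (auto simp: I_def)
    have bd: "norm (1 / (1 / 5 * lat_point \<tau> p) ^ k) \<le> M p" if "p \<in> I" for p
    proof -
      have p: "p \<noteq> (0, 0)" using that by (auto simp: I_def)
      have s: "lat_size p \<le> 3 * norm (lat_point \<tau> p)" using lat_size_le[of \<tau> 1 1 p] \<tau> by simp
      have s1: "lat_size p \<ge> 1" by (rule lat_size_ge_1[OF p])
      have "(lat_size p / 15) ^ k \<le> (norm (lat_point \<tau> p) / 5) ^ k" using s s1 by (intro power_mono) auto
      then have "1 / (norm (lat_point \<tau> p) / 5) ^ k \<le> 1 / (lat_size p / 15) ^ k"
        using s s1 by (intro divide_left_mono mult_pos_pos zero_less_power) auto
      then show ?thesis by (simp add: M_def norm_divide norm_power norm_mult power_divide)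
    qed
    have "eis S k = (\<Sum>\<^sub>\<infinity>p\<in>I. 1 / (1 / 5 * lat_point \<tau> p) ^ k)"
      unfolding eis_def SI by (subst infsum_reindex[OF inj]) (simp add: o_def)
    moreover have "(\<lambda>p. norm (1 / (1 / 5 * lat_point \<tau> p) ^ k)) summable_on I"
      by (rule Infinite_Sum.abs_summable_on_comparison_test'[OF MI bd])
    then have "(\<lambda>p. 1 / (1 / 5 * lat_point \<tau> p) ^ k) summable_on I"
      by (rule abs_summable_summable)
    then have "((\<lambda>p. 1 / (1 / 5 * lat_point \<tau> p) ^ k) has_sum (\<Sum>\<^sub>\<infinity>p\<in>I. 1 / (1 / 5 * lat_point \<tau> p) ^ k)) I"
      by (rule has_sum_infsum)
    ultimately have "norm (eis S k) \<le> infsum M I"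
      using norm_infsum_le[OF _ has_sum_infsum[OF MI] bd] by simp
    also have "\<dots> \<le> infsum M (UNIV - {(0, 0)})"
    proof (rule infsum_mono2[OF MI M])
      show "I \<subseteq> UNIV - {(0, 0)}" unfolding I_def by blast
      show "0 \<le> M p" for p unfolding M_def lat_size_def by simp
    qed
    finally show ?thesis .
  qed
  show ?thesis
  proof (intro exI allI impI)
    fix \<tau> S assume \<tau>: "1 \<le> Im \<tau>" and S: "S \<subseteq> (\<lambda>w. 1 / 5 * w) ` std_lattice \<tau>"
    \<comment> \<open>An integral translation preserves the lattice and moves \<tau> into the strip
      where the estimate is uniform.\<close>
    let ?t = "\<tau> + of_int (- \<lfloor>Re \<tau>\<rfloor>)"
    have "\<bar>Re ?t\<bar> \<le> 1" by simp linarith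
    moreover have "std_lattice ?t = std_lattice \<tau>" by (rule std_lattice_shift)
    ultimately show "norm (eis S k) \<le> infsum M (UNIV - {(0, 0)})"
      using main[of ?t S] \<tau> S by simp
  qed
qed

section \<open>Eisenstein series as q-series\<close>

text \<open>For k > 0 this is the polylogarithm of order - k; the operator x d/dx raises k by 1. For
  k = 0 the term d = 0 is 0^0 = 1, so the sum is 1 / (1 - x).\<close>

definition power_sum_series :: "nat \<Rightarrow> complex \<Rightarrow> complex" where
  "power_sum_series k x = (\<Sum>d. of_nat d ^ k * x ^ d)"

lemma summable_power_sum_series:
  fixes x :: "'a :: {real_normed_field, banach}"
  assumes "norm x < 1"
  shows "summable (\<lambda>d. of_nat d ^ k * x ^ d)"
  using assms
proof (induction k arbitrary: x)
  case 0
  then show ?case by (simp add: summable_geometric)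
next
  case (Suc k)
  have "summable (\<lambda>n. diffs (\<lambda>d. of_nat d ^ k) n * x ^ n)"
    using Suc.prems Suc.IH by (rule termdiff_converges)
  then have "summable (\<lambda>n. x * (diffs (\<lambda>d. of_nat d ^ k) n * x ^ n))"
    by (rule summable_mult)
  also have "(\<lambda>n. x * (diffs (\<lambda>d. of_nat d ^ k) n * x ^ n)) = (\<lambda>n. of_nat (Suc n) ^ Suc k * x ^ Suc n)"
    by (simp add: diffs_def fun_eq_iff mult_ac del: of_nat_Suc)
  finally show ?case by (subst (asm) summable_Suc_iff)
qed

lemma power_sum_series_deriv:
  assumes "norm x < 1"
  obtains D where "(power_sum_series k has_field_derivative D) (at x)" "x * D = power_sum_series (Suc k) x"
proof
  let ?D = "\<Sum>n. diffs (\<lambda>d. of_nat d ^ k) n * x ^ n :: complex"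
  show "(power_sum_series k has_field_derivative ?D) (at x)"
    unfolding power_sum_series_def
    by (rule termdiffs_strong'[OF summable_power_sum_series assms])
  have "summable (\<lambda>n. diffs (\<lambda>d. of_nat d ^ k) n * x ^ n)"
    using assms summable_power_sum_series by (rule termdiff_converges)
  then have "x * ?D = (\<Sum>n. x * (diffs (\<lambda>d. of_nat d ^ k) n * x ^ n))"
    by (rule suminf_mult[symmetric])
  also have "\<dots> = (\<Sum>n. of_nat (Suc n) ^ Suc k * x ^ Suc n)"
    by (simp add: diffs_def mult_ac del: of_nat_Suc)
  also have "\<dots> = power_sum_series (Suc k) x"
    unfolding power_sum_series_def
    using suminf_split_head[OF summable_power_sum_series[OF assms, of "Suc k"]] by simp
  finally show "x * ?D = power_sum_series (Suc k) x" .
qed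

section \<open>Derivatives of the cotangent as q-series\<close>

lemma norm_nome: "norm (nome \<tau>) = exp (- (2 * pi * Im \<tau>))"
  by (simp add: nome_def)

lemma norm_nome_less_1: "Im \<tau> > 0 \<Longrightarrow> norm (nome \<tau>) < 1"
  by (simp add: norm_nome)

lemma nome_deriv: "(nome has_field_derivative 2 * of_real pi * \<i> * nome z) (at z)"
  unfolding nome_def by (auto intro!: derivative_eq_intros)

lemma power_sum_nome_deriv:
  assumes "Im z > 0"
  shows "((\<lambda>z. power_sum_series k (nome z)) has_field_derivative
    2 * of_real pi * \<i> * power_sum_series (Suc k) (nome z)) (at z)"
proof -
  obtain D where D: "(power_sum_series k has_field_derivative D) (at (nome z))"
    "nome z * D = power_sum_series (Suc k) (nome z)"
    using power_sum_series_deriv[OF norm_nome_less_1[OF assms]] by blast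
  show ?thesis
    using DERIV_chain2[OF D(1) nome_deriv] by (simp add: D(2)[symmetric] mult_ac)
qed

text \<open>The derivative of order m of pi cot (pi z), in the form that the reflection formula
  yields. For m > 0 the polygamma series turn it into a sum over all integers.\<close>

definition cot_deriv :: "nat \<Rightarrow> complex \<Rightarrow> complex" where
  "cot_deriv m z = (-1) ^ m * Polygamma m (1 - z) - Polygamma m z"

lemma not_nonpos_Int: "Im z \<noteq> 0 \<Longrightarrow> z \<notin> \<int>\<^sub>\<le>\<^sub>0"
  by (auto elim!: nonpos_Ints_cases)

lemma cot_deriv_deriv:
  assumes "Im z > 0"
  shows "(cot_deriv m has_field_derivative cot_deriv (Suc m) z) (at z)"
proof -
  have z: "z \<notin> \<int>\<^sub>\<le>\<^sub>0" "1 - z \<notin> \<int>\<^sub>\<le>\<^sub>0" using assms by (auto intro!: not_nonpos_Int)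
  have "((\<lambda>z. Polygamma m (1 - z)) has_field_derivative Polygamma (Suc m) (1 - z) * (- 1)) (at z)"
    by (rule DERIV_chain2[where f = "Polygamma m" and g = "\<lambda>z. 1 - z", OF has_field_derivative_Polygamma[OF z(2)]]) (auto intro!: derivative_eq_intros)
  from DERIV_diff[OF DERIV_cmult[OF this, of "(-1) ^ m"] has_field_derivative_Polygamma[OF z(1), of m]]
  show ?thesis unfolding cot_deriv_def by simp
qed

text \<open>The logarithmic derivative of the reflection formula \<open>\<Gamma>(z) \<Gamma>(1 - z) = \<pi> / sin (\<pi> z)\<close>
  expresses \<open>\<pi> cot (\<pi> z)\<close> through the digamma function.\<close>

lemma cot_deriv_0:
  assumes "Im z > 0"
  shows "cot_deriv 0 z = of_real pi * \<i> - 2 * of_real pi * \<i> / (1 - nome z)"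
proof -
  have z: "z \<notin> \<int>\<^sub>\<le>\<^sub>0" "1 - z \<notin> \<int>\<^sub>\<le>\<^sub>0" using assms by (auto intro!: not_nonpos_Int)
  define e where "e = exp (\<i> * of_real pi * z)"
  have e0: "e \<noteq> 0" by (simp add: e_def)
  have u: "nome z = e\<^sup>2" by (simp add: e_def nome_def power2_eq_square mult_ac flip: exp_add)
  have u1: "e\<^sup>2 \<noteq> 1" using norm_nome_less_1[OF assms] unfolding u by auto
  have sin: "sin (of_real pi * z) = (e - 1 / e) / (2 * \<i>)"
    by (simp add: sin_exp_eq e_def exp_minus inverse_eq_divide mult_ac)
  have cos: "cos (of_real pi * z) = (e + 1 / e) / 2"
    by (simp add: cos_exp_eq e_def exp_minus inverse_eq_divide mult_ac)
  have "((\<lambda>z. rGamma (1 - z)) has_field_derivative (- rGamma (1 - z) * Digamma (1 - z)) * (- 1)) (at z)"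
    by (rule DERIV_chain2[where f = rGamma and g = "\<lambda>z. 1 - z", OF has_field_derivative_rGamma_no_nonpos_int[OF z(2)]]) (auto intro!: derivative_eq_intros)
  from DERIV_mult[OF has_field_derivative_rGamma_no_nonpos_int[OF z(1)] this]
  have "((\<lambda>z. rGamma z * rGamma (1 - z)) has_field_derivative rGamma z * rGamma (1 - z) * cot_deriv 0 z) (at z)"
    by (simp add: cot_deriv_def algebra_simps)
  then have "((\<lambda>z. sin (of_real pi * z) / of_real pi) has_field_derivative
      sin (of_real pi * z) / of_real pi * cot_deriv 0 z) (at z)"
    unfolding rGamma_reflection_complex .
  moreover have "((\<lambda>z. sin (of_real pi * z) / of_real pi) has_field_derivative cos (of_real pi * z)) (at z)"
    by (auto intro!: derivative_eq_intros)
  ultimately have "sin (of_real pi * z) / of_real pi * cot_deriv 0 z = cos (of_real pi * z)"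
    by (rule DERIV_unique)
  then have *: "(e - 1 / e) / (2 * \<i>) / of_real pi * cot_deriv 0 z = (e + 1 / e) / 2"
    unfolding sin cos .
  have "(e - 1 / e) * cot_deriv 0 z = (e - 1 / e) / (2 * \<i>) / of_real pi * cot_deriv 0 z * (2 * \<i> * of_real pi)"
  proof -
    have "a * c = a / q * c * q" if "q \<noteq> 0" for a c q :: complex using that by simp
    then show ?thesis unfolding divide_divide_eq_left by simp
  qed
  also have "\<dots> = (e + 1 / e) * (\<i> * of_real pi)" unfolding * by simp
  finally have "e * ((e - 1 / e) * cot_deriv 0 z) = e * ((e + 1 / e) * (\<i> * of_real pi))" by simp
  then have "(e\<^sup>2 - 1) * cot_deriv 0 z = of_real pi * \<i> * (e\<^sup>2 + 1)"
    using e0 by (simp add: algebra_simps power2_eq_square)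
  moreover have "e\<^sup>2 - 1 \<noteq> 0" using u1 by simp
  ultimately have "cot_deriv 0 z = of_real pi * \<i> * (e\<^sup>2 + 1) / (e\<^sup>2 - 1)"
    by (metis nonzero_mult_div_cancel_left)
  also have "\<dots> = of_real pi * \<i> - 2 * of_real pi * \<i> / (1 - e\<^sup>2)"
    using u1 by (simp add: divide_simps) (simp add: algebra_simps)
  finally show ?thesis unfolding u .
qed

lemma open_Im_gt_0: "open {z. Im z > 0}"
  by (rule open_halfspace_Im_gt)

lemma cot_deriv_unique:
  assumes "Im z > 0" "\<And>z. Im z > 0 \<Longrightarrow> cot_deriv m z = f z" "(f has_field_derivative D) (at z)"
  shows "cot_deriv (Suc m) z = D"
proof -
  have "(cot_deriv m has_field_derivative D) (at z)"
    by (rule has_field_derivative_transform_within_open[OF assms(3) open_Im_gt_0]) (use assms in auto)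
  then show ?thesis using cot_deriv_deriv[OF assms(1)] DERIV_unique by blast
qed

text \<open>The cotangent is a constant minus 2 pi i times a geometric series in q, and each
  derivative multiplies the term at q^d by 2 pi i d. The constant disappears with the first
  derivative, hence the start at \<open>Suc m\<close>.\<close>

lemma cot_deriv_eq_series:
  assumes "Im z > 0"
  shows "cot_deriv (Suc m) z = - ((2 * of_real pi * \<i>) ^ (m + 2)) * power_sum_series (Suc m) (nome z)"
  using assms
proof (induction m arbitrary: z)
  case 0
  have *: "cot_deriv 0 z = of_real pi * \<i> - 2 * of_real pi * \<i> * power_sum_series 0 (nome z)" if "Im z > 0" for z
  proof -
    have "power_sum_series 0 (nome z) = 1 / (1 - nome z)"
      unfolding power_sum_series_def using suminf_geometric[OF norm_nome_less_1[OF that]] by simp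
    then show ?thesis using cot_deriv_0[OF that] by simp
  qed
  have "((\<lambda>z. of_real pi * \<i> - 2 * of_real pi * \<i> * power_sum_series 0 (nome z)) has_field_derivative
      0 - 2 * of_real pi * \<i> * (2 * of_real pi * \<i> * power_sum_series (Suc 0) (nome z))) (at z)"
    by (intro DERIV_diff DERIV_const DERIV_cmult power_sum_nome_deriv 0)
  from cot_deriv_unique[OF 0 * this] show ?case by (simp add: power2_eq_square)
next
  case (Suc m)
  have "((\<lambda>z. - ((2 * of_real pi * \<i>) ^ (m + 2)) * power_sum_series (Suc m) (nome z)) has_field_derivative
      - ((2 * of_real pi * \<i>) ^ (m + 2)) * (2 * of_real pi * \<i> * power_sum_series (Suc (Suc m)) (nome z))) (at z)"
    by (intro DERIV_cmult power_sum_nome_deriv Suc.prems)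
  from cot_deriv_unique[OF Suc.prems Suc.IH this] show ?case by simp
qed

text \<open>Since \<open>c = \<pi> cot (\<pi> z)\<close> satisfies \<open>c' = - (\<pi>\<^sup>2 + c\<^sup>2)\<close>, its higher derivatives are
  polynomials in \<open>c\<close>.\<close>

lemma cot_deriv_ode:
  assumes z: "Im z > 0"
  shows "cot_deriv 3 z = - (2 * of_real pi ^ 2 + 6 * cot_deriv 0 z ^ 2) * (of_real pi ^ 2 + cot_deriv 0 z ^ 2)"
    and "cot_deriv 5 z = - (16 * of_real pi ^ 4 + 120 * of_real pi ^ 2 * cot_deriv 0 z ^ 2 + 120 * cot_deriv 0 z ^ 4)
      * (of_real pi ^ 2 + cot_deriv 0 z ^ 2)"
proof -
  define p :: complex where "p = of_real pi ^ 2"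
  have p4: "of_real pi ^ 4 = p ^ 2" by (simp add: p_def flip: power_mult)
  let ?c = "cot_deriv 0"
  have 1: "cot_deriv 1 z = - (p + ?c z ^ 2)" if z: "Im z > 0" for z
  proof -
    have u1: "1 - nome z \<noteq> 0" using norm_nome_less_1[OF z] by auto
    have "((\<lambda>z. of_real pi * \<i> - 2 * of_real pi * \<i> / (1 - nome z)) has_field_derivative
        - (2 * of_real pi * \<i>) * (2 * of_real pi * \<i> * nome z) / ((1 - nome z) * (1 - nome z))) (at z)"
      using u1 by (auto intro!: derivative_eq_intros nome_deriv)
    from cot_deriv_unique[OF z cot_deriv_0 this]
    have "cot_deriv 1 z = - (2 * of_real pi * \<i>) * (2 * of_real pi * \<i> * nome z) / ((1 - nome z) * (1 - nome z))" by simp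
    also have "\<dots> = - (p + ?c z ^ 2)"
      unfolding cot_deriv_0[OF z] p_def using u1
      by (simp add: divide_simps power2_eq_square) (simp add: algebra_simps)
    finally show ?thesis .
  qed
  have d: "(?c has_field_derivative - (p + ?c z ^ 2)) (at z)" if "Im z > 0" for z
    using cot_deriv_deriv[OF that, of 0] 1[OF that] by simp
  have 2: "cot_deriv 2 z = 2 * ?c z * (p + ?c z ^ 2)" if z: "Im z > 0" for z
  proof -
    have "((\<lambda>z. - (p + ?c z ^ 2)) has_field_derivative 2 * ?c z * (p + ?c z ^ 2)) (at z)"
      using d[OF z] by (auto intro!: derivative_eq_intros simp: algebra_simps)
    from cot_deriv_unique[OF z 1 this] show ?thesis by (simp add: numeral_2_eq_2)
  qed
  have 3: "cot_deriv 3 z = - (2 * p + 6 * ?c z ^ 2) * (p + ?c z ^ 2)" if z: "Im z > 0" for z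
  proof -
    have "((\<lambda>z. 2 * ?c z * (p + ?c z ^ 2)) has_field_derivative - (2 * p + 6 * ?c z ^ 2) * (p + ?c z ^ 2)) (at z)"
      using d[OF z] by (auto intro!: derivative_eq_intros simp: algebra_simps power2_eq_square)
    from cot_deriv_unique[OF z 2 this] show ?thesis by (simp add: numeral_3_eq_3 numeral_2_eq_2)
  qed
  have 4: "cot_deriv 4 z = (16 * p * ?c z + 24 * ?c z ^ 3) * (p + ?c z ^ 2)" if z: "Im z > 0" for z
  proof -
    have "((\<lambda>z. - (2 * p + 6 * ?c z ^ 2) * (p + ?c z ^ 2)) has_field_derivative (16 * p * ?c z + 24 * ?c z ^ 3) * (p + ?c z ^ 2)) (at z)"
      using d[OF z] by (auto intro!: derivative_eq_intros simp: algebra_simps power2_eq_square power3_eq_cube)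
    from cot_deriv_unique[OF z 3 this] show ?thesis by (simp add: eval_nat_numeral)
  qed
  have 5: "cot_deriv 5 z = - (16 * p ^ 2 + 120 * p * ?c z ^ 2 + 120 * ?c z ^ 4) * (p + ?c z ^ 2)" if z: "Im z > 0" for z
  proof -
    have "((\<lambda>z. (16 * p * ?c z + 24 * ?c z ^ 3) * (p + ?c z ^ 2)) has_field_derivative
        - (16 * p ^ 2 + 120 * p * ?c z ^ 2 + 120 * ?c z ^ 4) * (p + ?c z ^ 2)) (at z)"
      using d[OF z] by (auto intro!: derivative_eq_intros simp: algebra_simps eval_nat_numeral)
    from cot_deriv_unique[OF z 4 this] show ?thesis by (simp add: eval_nat_numeral)
  qed
  show "cot_deriv 3 z = - (2 * of_real pi ^ 2 + 6 * cot_deriv 0 z ^ 2) * (of_real pi ^ 2 + cot_deriv 0 z ^ 2)"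
    using 3[OF z] unfolding p_def .
  show "cot_deriv 5 z = - (16 * of_real pi ^ 4 + 120 * of_real pi ^ 2 * cot_deriv 0 z ^ 2 + 120 * cot_deriv 0 z ^ 4)
      * (of_real pi ^ 2 + cot_deriv 0 z ^ 2)"
    unfolding p4 using 5[OF z] unfolding p_def .
qed

section \<open>The values zeta(4) and zeta(6) as polygamma values\<close>

definition coth' :: "real \<Rightarrow> real" where "coth' s = (1 + exp (- 2 * s)) / (1 - exp (- 2 * s))"

text \<open>On the imaginary axis the cotangent is - i times the real function \<open>coth'\<close>,
  the hyperbolic cotangent, so limits at 0 become real asymptotics in one variable.\<close>

lemma cot_deriv_0_imag:
  assumes "y > 0"
  shows "cot_deriv 0 (\<i> * of_real y) = - \<i> * of_real (pi * coth' (pi * y))"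
proof -
  have n: "nome (\<i> * of_real y) = of_real (exp (- 2 * (pi * y)))"
    by (simp add: nome_def mult_ac exp_of_real[symmetric])
  have "exp (- 2 * (pi * y)) < 1" using assms by simp
  then have ne: "1 - complex_of_real (exp (- 2 * (pi * y))) \<noteq> 0" by (metis less_irrefl of_real_1 of_real_eq_iff right_minus_eq)
  show ?thesis
    using cot_deriv_0[of "\<i> * of_real y"] assms ne unfolding n coth'_def
    by (simp add: divide_simps) (simp add: algebra_simps)
qed

lemma tendsto_Polygamma_sym:
  "((\<lambda>y. Polygamma m (1 - \<i> * of_real y) + Polygamma m (1 + \<i> * of_real y)) \<longlongrightarrow> 2 * Polygamma m (1::complex)) (at_right 0)"
proof -
  have 1: "(1::complex) \<notin> \<int>\<^sub>\<le>\<^sub>0" by simp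
  have c: "isCont (Polygamma m) (1::complex)" by (rule isCont_Polygamma[OF continuous_ident 1])
  have "((\<lambda>y. 1 - \<i> * complex_of_real y) \<longlongrightarrow> 1 - \<i> * of_real 0) (at_right 0)"
    "((\<lambda>y. 1 + \<i> * complex_of_real y) \<longlongrightarrow> 1 + \<i> * of_real 0) (at_right 0)"
    by (intro tendsto_intros)+
  then have "((\<lambda>y. 1 - \<i> * complex_of_real y) \<longlongrightarrow> 1) (at_right 0)"
    "((\<lambda>y. 1 + \<i> * complex_of_real y) \<longlongrightarrow> 1) (at_right 0)" by simp_all
  from tendsto_add[OF isCont_tendsto_compose[OF c this(1)] isCont_tendsto_compose[OF c this(2)]]
  show ?thesis by simp
qed

text \<open>This is 3! zeta(4) with zeta(4) = pi^4/90. For z = i y the values at 1 - z and 1 + z sum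
  to - \<open>cot_deriv 3 z\<close> - 6/z^4, which the differential equation expresses through
  \<open>coth'\<close>; at y = 0 the sum tends to twice the wanted value.\<close>

lemma Polygamma_3_1: "Polygamma 3 (1::complex) = of_real (pi ^ 4 / 15)"
proof -
  have lim: "((\<lambda>s. (2 - 6 * coth' s ^ 2) * (1 - coth' s ^ 2) - 6 / s ^ 4) \<longlongrightarrow> 2 / 15) (at_right 0)"
    unfolding coth'_def by real_asymp
  have "filterlim (\<lambda>y. pi * y) (at_right 0) (at_right 0)" by real_asymp
  from filterlim_compose[OF lim this]
  have "((\<lambda>y. pi ^ 4 * ((2 - 6 * coth' (pi * y) ^ 2) * (1 - coth' (pi * y) ^ 2) - 6 / (pi * y) ^ 4)) \<longlongrightarrow> pi ^ 4 * (2 / 15)) (at_right 0)"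
    by (intro tendsto_intros)
  then have "((\<lambda>y. complex_of_real (pi ^ 4 * ((2 - 6 * coth' (pi * y) ^ 2) * (1 - coth' (pi * y) ^ 2) - 6 / (pi * y) ^ 4)))
      \<longlongrightarrow> of_real (pi ^ 4 * (2 / 15))) (at_right 0)"
    by (rule tendsto_of_real)
  moreover have "eventually (\<lambda>y. complex_of_real (pi ^ 4 * ((2 - 6 * coth' (pi * y) ^ 2) * (1 - coth' (pi * y) ^ 2) - 6 / (pi * y) ^ 4))
      = Polygamma 3 (1 - \<i> * of_real y) + Polygamma 3 (1 + \<i> * of_real y)) (at_right 0)"
    using eventually_at_right_less[of "0::real"]
  proof eventually_elim
    case (elim y)
    define t where "t = coth' (pi * y)"
    have z: "Im (\<i> * of_real y) > 0" "\<i> * of_real y \<noteq> 0" using elim by simp_all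
    have c0: "cot_deriv 0 (\<i> * of_real y) ^ 2 = - of_real (pi\<^sup>2 * t\<^sup>2)"
      unfolding cot_deriv_0_imag[OF elim] t_def by (simp add: power_mult_distrib)
    have "Polygamma 3 (1 - \<i> * of_real y) + Polygamma 3 (1 + \<i> * of_real y)
      = - cot_deriv 3 (\<i> * of_real y) + (-1) ^ 3 * fact 3 / (\<i> * of_real y) ^ Suc 3"
      using Polygamma_plus1[OF z(2), of 3] by (simp add: cot_deriv_def add.commute)
    also have "\<dots> = of_real (pi ^ 4 * ((2 - 6 * t\<^sup>2) * (1 - t\<^sup>2) - 6 / (pi * y) ^ 4))"
      unfolding cot_deriv_ode(1)[OF z(1)] c0 using elim
      by (simp add: field_simps eval_nat_numeral)
    finally show ?case unfolding t_def ..
  qed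
  ultimately have "((\<lambda>y. Polygamma 3 (1 - \<i> * of_real y) + Polygamma 3 (1 + \<i> * of_real y)) \<longlongrightarrow> of_real (pi ^ 4 * (2 / 15))) (at_right 0)"
    by (rule Lim_transform_eventually)
  from tendsto_unique[OF _ tendsto_Polygamma_sym this] show ?thesis by (simp add: mult.commute)
qed

text \<open>The same limit for 5! zeta(6) with zeta(6) = pi^6/945. Here i^6 = -1 makes the pole term
  positive.\<close>

lemma Polygamma_5_1: "Polygamma 5 (1::complex) = of_real (8 * pi ^ 6 / 63)"
proof -
  have lim: "((\<lambda>s. (16 - 120 * coth' s ^ 2 + 120 * coth' s ^ 4) * (1 - coth' s ^ 2) + 120 / s ^ 6) \<longlongrightarrow> 16 / 63) (at_right 0)"
    unfolding coth'_def by real_asymp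
  have "filterlim (\<lambda>y. pi * y) (at_right 0) (at_right 0)" by real_asymp
  from filterlim_compose[OF lim this]
  have "((\<lambda>y. pi ^ 6 * ((16 - 120 * coth' (pi * y) ^ 2 + 120 * coth' (pi * y) ^ 4) * (1 - coth' (pi * y) ^ 2) + 120 / (pi * y) ^ 6)) \<longlongrightarrow> pi ^ 6 * (16 / 63)) (at_right 0)"
    by (intro tendsto_intros)
  then have "((\<lambda>y. complex_of_real (pi ^ 6 * ((16 - 120 * coth' (pi * y) ^ 2 + 120 * coth' (pi * y) ^ 4) * (1 - coth' (pi * y) ^ 2) + 120 / (pi * y) ^ 6)))
      \<longlongrightarrow> of_real (pi ^ 6 * (16 / 63))) (at_right 0)"
    by (rule tendsto_of_real)
  moreover have "eventually (\<lambda>y. complex_of_real (pi ^ 6 * ((16 - 120 * coth' (pi * y) ^ 2 + 120 * coth' (pi * y) ^ 4) * (1 - coth' (pi * y) ^ 2) + 120 / (pi * y) ^ 6))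
      = Polygamma 5 (1 - \<i> * of_real y) + Polygamma 5 (1 + \<i> * of_real y)) (at_right 0)"
    using eventually_at_right_less[of "0::real"]
  proof eventually_elim
    case (elim y)
    define t where "t = coth' (pi * y)"
    have z: "Im (\<i> * of_real y) > 0" "\<i> * of_real y \<noteq> 0" using elim by simp_all
    have c0: "cot_deriv 0 (\<i> * of_real y) ^ 2 = - of_real (pi\<^sup>2 * t\<^sup>2)"
      unfolding cot_deriv_0_imag[OF elim] t_def by (simp add: power_mult_distrib)
    have c4: "cot_deriv 0 (\<i> * of_real y) ^ 4 = of_real (pi ^ 4 * t ^ 4)"
      unfolding cot_deriv_0_imag[OF elim] t_def by (simp add: power_mult_distrib)
    have "Polygamma 5 (1 - \<i> * of_real y) + Polygamma 5 (1 + \<i> * of_real y)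
      = - cot_deriv 5 (\<i> * of_real y) + (-1) ^ 5 * fact 5 / (\<i> * of_real y) ^ Suc 5"
      using Polygamma_plus1[OF z(2), of 5] by (simp add: cot_deriv_def add.commute)
    also have "\<dots> = of_real (pi ^ 6 * ((16 - 120 * t\<^sup>2 + 120 * t ^ 4) * (1 - t\<^sup>2) + 120 / (pi * y) ^ 6))"
      unfolding cot_deriv_ode(2)[OF z(1)] c0 c4 using elim
      by (simp add: field_simps eval_nat_numeral)
    finally show ?case unfolding t_def ..
  qed
  ultimately have "((\<lambda>y. Polygamma 5 (1 - \<i> * of_real y) + Polygamma 5 (1 + \<i> * of_real y)) \<longlongrightarrow> of_real (pi ^ 6 * (16 / 63))) (at_right 0)"
    by (rule Lim_transform_eventually)
  from tendsto_unique[OF _ tendsto_Polygamma_sym this] show ?thesis by (simp add: mult.commute)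
qed

section \<open>Rows of the lattice sum and Lambert series\<close>

lemma summable_lat_point:
  assumes \<tau>: "Im \<tau> > 0" and k: "k \<ge> 3"
  shows "(\<lambda>p. 1 / lat_point \<tau> p ^ k) summable_on (UNIV - {(0, 0)})"
proof -
  have "(\<lambda>\<omega>. 1 / \<omega> ^ k) summable_on (std_lattice \<tau> - {0})"
    using complex_lattice.eis_has_sum[OF complex_lattice_std[OF \<tau>] k] by (rule has_sum_imp_summable)
  then show ?thesis
    unfolding std_lattice_minus_0[OF \<tau>]
    by (subst (asm) summable_on_reindex) (auto intro: inj_on_subset[OF inj_lat_point[OF \<tau>]] simp: o_def)
qed

lemma Int_UNIV_split: "(UNIV :: int set) = range int \<union> range (\<lambda>n. - 1 - int n)"
proof -
  have "x \<in> range int \<union> range (\<lambda>n. - 1 - int n)" for x :: int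
  proof (cases "x \<ge> 0")
    case True
    then show ?thesis by (intro UnI1 image_eqI[of _ _ "nat x"]) auto
  next
    case False
    then show ?thesis by (intro UnI2 image_eqI[of _ _ "nat (- 1 - x)"]) auto
  qed
  then show ?thesis by blast
qed

lemma infsum_nat: "f summable_on UNIV \<Longrightarrow> infsum f (UNIV :: nat set) = (suminf f :: complex)"
  using has_sum_imp_sums[OF has_sum_infsum] sums_unique by metis

text \<open>Lipschitz' formula. The terms with n \<ge> 0 and n < 0 form the polygamma series at z
  and at 1 - z; for odd m the exponent is even, so the signs drop out and the two combine to -
  \<open>cot_deriv m z\<close>.\<close>

lemma row_sum:
  assumes z: "Im z > 0" and m: "odd m" "m \<ge> 3"
  shows "(\<lambda>n. 1 / (of_int n + z) ^ Suc m) summable_on (UNIV :: int set)"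
    and "fact m * (\<Sum>\<^sub>\<infinity>n\<in>UNIV. 1 / (of_int n + z) ^ Suc m) = (2 * of_real pi * \<i>) ^ Suc m * power_sum_series m (nome z)"
proof -
  let ?f = "\<lambda>n::int. 1 / (of_int n + z) ^ Suc m"
  \<comment> \<open>Summability is inherited: the row is part of the sum over the lattice of z
    itself.\<close>
  have "(\<lambda>p. 1 / lat_point z p ^ Suc m) summable_on (\<lambda>n. (n, 1)) ` (UNIV :: int set)"
    by (rule summable_on_subset_banach[OF summable_lat_point[OF z]]) (use m in auto)
  then show summ: "?f summable_on UNIV"
    by (subst (asm) summable_on_reindex) (auto simp: inj_on_def o_def lat_point_def)
  have s1: "?f summable_on range int" and s2: "?f summable_on range (\<lambda>n. - 1 - int n)"
    by (rule summable_on_subset_banach[OF summ], simp)+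
  have inj: "inj int" "inj (\<lambda>n. - 1 - int n)" by (auto simp: inj_def)
  have e1: "(?f \<circ> int) = (\<lambda>k. inverse ((z + of_nat k) ^ Suc m))"
    by (simp add: fun_eq_iff inverse_eq_divide add.commute)
  have e2: "(?f \<circ> (\<lambda>n. - 1 - int n)) = (\<lambda>k. inverse ((1 - z + of_nat k) ^ Suc m))"
  proof
    fix k
    have "of_int (- 1 - int k) + z = - (1 - z + of_nat k)" by simp
    then have "(of_int (- 1 - int k) + z) ^ Suc m = (1 - z + of_nat k) ^ Suc m"
      using m by (metis even_Suc power_minus_even)
    then show "(?f \<circ> (\<lambda>n. - 1 - int n)) k = inverse ((1 - z + of_nat k) ^ Suc m)"
      unfolding o_def inverse_eq_divide by (simp only:)
  qed
  have "infsum ?f UNIV = infsum ?f (range int) + infsum ?f (range (\<lambda>n. - 1 - int n))"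
    by (subst Int_UNIV_split, rule infsum_Un_disjoint[OF s1 s2]) auto
  also have "infsum ?f (range int) = (\<Sum>k. inverse ((z + of_nat k) ^ Suc m))"
    unfolding infsum_reindex[OF inj(1)] e1
    using s1 unfolding summable_on_reindex[OF inj(1)] e1 by (rule infsum_nat)
  also have "infsum ?f (range (\<lambda>n. - 1 - int n)) = (\<Sum>k. inverse ((1 - z + of_nat k) ^ Suc m))"
    unfolding infsum_reindex[OF inj(2)] e2
    using s2 unfolding summable_on_reindex[OF inj(2)] e2 by (rule infsum_nat)
  finally have "fact m * infsum ?f UNIV = Polygamma m z + Polygamma m (1 - z)"
    using m by (auto simp: Polygamma_def distrib_left simp del: power_Suc)
  also have "\<dots> = - cot_deriv m z" using m by (simp add: cot_deriv_def)
  also have "cot_deriv m z = - ((2 * of_real pi * \<i>) ^ Suc m) * power_sum_series m (nome z)"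
    using cot_deriv_eq_series[OF z, of "m - 1"] m by simp
  finally show "fact m * infsum ?f UNIV = (2 * of_real pi * \<i>) ^ Suc m * power_sum_series m (nome z)"
    by simp
qed

lemma zero_row_sum:
  assumes m: "odd m" "m \<ge> 3"
  shows "(\<lambda>n. 1 / of_int n ^ Suc m :: complex) summable_on (UNIV - {0})"
    and "fact m * (\<Sum>\<^sub>\<infinity>n\<in>UNIV - {0}. 1 / of_int n ^ Suc m) = 2 * Polygamma m (1 :: complex)"
proof -
  let ?f = "\<lambda>n::int. 1 / of_int n ^ Suc m :: complex"
  have "(\<lambda>p. 1 / lat_point \<i> p ^ Suc m) summable_on (\<lambda>n. (n, 0)) ` (UNIV - {0})"
    by (rule summable_on_subset_banach[OF summable_lat_point]) (use m in auto)
  then show summ: "?f summable_on (UNIV - {0})"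
    by (subst (asm) summable_on_reindex) (auto simp: inj_on_def o_def lat_point_def)
  have split: "(UNIV - {0} :: int set) = range (\<lambda>n. 1 + int n) \<union> range (\<lambda>n. - 1 - int n)"
  proof -
    have "x \<in> range (\<lambda>n. 1 + int n) \<union> range (\<lambda>n. - 1 - int n)" if "x \<noteq> 0" for x :: int
    proof (cases "x > 0")
      case True
      then show ?thesis by (intro UnI1 image_eqI[of _ _ "nat (x - 1)"]) auto
    next
      case False
      with that show ?thesis by (intro UnI2 image_eqI[of _ _ "nat (- 1 - x)"]) auto
    qed
    then show ?thesis by auto
  qed
  have s1: "?f summable_on range (\<lambda>n. 1 + int n)"
    by (rule summable_on_subset_banach[OF summ]) auto
  have s2: "?f summable_on range (\<lambda>n. - 1 - int n)"
    by (rule summable_on_subset_banach[OF summ]) auto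
  have inj: "inj (\<lambda>n. 1 + int n)" "inj (\<lambda>n. - 1 - int n)" by (auto simp: inj_def)
  have e1: "(?f \<circ> (\<lambda>n. 1 + int n)) = (\<lambda>k. inverse ((1 + of_nat k) ^ Suc m))"
    by (simp add: fun_eq_iff inverse_eq_divide)
  have e2: "(?f \<circ> (\<lambda>n. - 1 - int n)) = (\<lambda>k. inverse ((1 + of_nat k) ^ Suc m))"
  proof
    fix k
    have "of_int (- 1 - int k) = - (1 + of_nat k :: complex)" by simp
    then have "(of_int (- 1 - int k)) ^ Suc m = (1 + of_nat k :: complex) ^ Suc m"
      using m by (metis even_Suc power_minus_even)
    then show "(?f \<circ> (\<lambda>n. - 1 - int n)) k = inverse ((1 + of_nat k) ^ Suc m)"
      unfolding o_def inverse_eq_divide by (simp only:)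
  qed
  have "infsum ?f (UNIV - {0}) = infsum ?f (range (\<lambda>n. 1 + int n)) + infsum ?f (range (\<lambda>n. - 1 - int n))"
    by (subst split, rule infsum_Un_disjoint[OF s1 s2]) auto
  also have "infsum ?f (range (\<lambda>n. 1 + int n)) = (\<Sum>k. inverse ((1 + of_nat k) ^ Suc m))"
    unfolding infsum_reindex[OF inj(1)] e1
    using s1 unfolding summable_on_reindex[OF inj(1)] e1 by (rule infsum_nat)
  also have "infsum ?f (range (\<lambda>n. - 1 - int n)) = (\<Sum>k. inverse ((1 + of_nat k) ^ Suc m))"
    unfolding infsum_reindex[OF inj(2)] e2
    using s2 unfolding summable_on_reindex[OF inj(2)] e2 by (rule infsum_nat)
  finally show "fact m * infsum ?f (UNIV - {0}) = 2 * Polygamma m 1"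
    using m by (auto simp: Polygamma_def simp del: power_Suc)
qed

text \<open>For n, d \<ge> 1 one has n d \<ge> (n - 1) + d, so the terms are dominated by a
  geometric term in n times a power series term in d.\<close>

lemma summable_divisor_terms:
  fixes q :: complex
  assumes q: "norm q < 1"
  shows "(\<lambda>(n, d). of_nat d ^ m * q ^ (n * d)) summable_on ({1..} \<times> {1..} :: (nat \<times> nat) set)"
proof -
  define r where "r = norm q"
  have r: "0 \<le> r" "r < 1" using q by (simp_all add: r_def)
  have s1: "(\<lambda>n. r ^ (n - 1)) summable_on {1..}"
  proof -
    have "(\<lambda>n. r ^ n) summable_on UNIV"
      by (subst summable_on_UNIV_nonneg_real_iff) (use r in \<open>auto intro: summable_geometric\<close>)
    then have "((\<lambda>n. r ^ (n - 1)) \<circ> Suc) summable_on UNIV" by (simp add: o_def)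
    moreover have "range Suc = {1..}" by (auto simp: image_iff Suc_le_eq gr0_conv_Suc)
    ultimately show ?thesis
      using summable_on_reindex[of Suc UNIV "\<lambda>n. r ^ (n - 1)"] by simp
  qed
  have s2: "(\<lambda>d. real d ^ m * r ^ d) summable_on {1..}"
  proof -
    have "(\<lambda>d. real d ^ m * r ^ d) summable_on UNIV"
      using summable_power_sum_series[of r m] r by (subst summable_on_UNIV_nonneg_real_iff) auto
    then show ?thesis by (rule summable_on_subset_banach) simp
  qed
  have "(\<lambda>p. r ^ (fst p - 1) * (real (snd p) ^ m * r ^ snd p)) summable_on ({1..} \<times> {1..})"
  proof (rule summable_on_SigmaI)
    show "((\<lambda>y. r ^ (fst (x, y) - 1) * (real (snd (x, y)) ^ m * r ^ snd (x, y))) has_sum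
        r ^ (x - 1) * infsum (\<lambda>d. real d ^ m * r ^ d) {1..}) {1..}" for x
      unfolding fst_conv snd_conv by (intro has_sum_cmult_right has_sum_infsum s2)
    show "(\<lambda>x. r ^ (x - 1) * infsum (\<lambda>d. real d ^ m * r ^ d) {1..}) summable_on {1..}"
      by (intro summable_on_cmult_left s1)
  qed (use r in auto)
  then have "(\<lambda>p. norm ((\<lambda>(n, d). of_nat d ^ m * q ^ (n * d)) p)) summable_on ({1..} \<times> {1..})"
  proof (rule Infinite_Sum.abs_summable_on_comparison_test')
    fix p :: "nat \<times> nat" assume "p \<in> {1..} \<times> {1..}"
    then obtain n d where p: "p = (Suc n, Suc d)" by (cases p) (auto simp: Suc_le_eq gr0_conv_Suc)
    have "r ^ (Suc n * Suc d) \<le> r ^ (n + Suc d)" using r by (intro power_decreasing) auto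
    then have "real (Suc d) ^ m * r ^ (Suc n * Suc d) \<le> real (Suc d) ^ m * r ^ (n + Suc d)"
      by (rule mult_left_mono) simp
    also have "\<dots> = r ^ (fst p - 1) * (real (snd p) ^ m * r ^ snd p)"
      unfolding p by (simp add: power_add del: of_nat_Suc)
    also have "real (Suc d) ^ m * r ^ (Suc n * Suc d) = norm ((\<lambda>(n, d). of_nat d ^ m * q ^ (n * d)) p)"
      unfolding p r_def prod.case norm_mult norm_power norm_of_nat ..
    finally show "norm ((\<lambda>(n, d). of_nat d ^ m * q ^ (n * d)) p) \<le> r ^ (fst p - 1) * (real (snd p) ^ m * r ^ snd p)" .
  qed
  then show ?thesis by (rule abs_summable_summable)
qed

text \<open>The Lambert series: one double sum over (n, d), taken by rows n on one side and by
  products N = n d on the other, where d runs through the divisors of N.\<close>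

lemma divisor_series:
  fixes q :: complex
  assumes q: "norm q < 1" and m: "m > 0"
  shows "(\<Sum>\<^sub>\<infinity>n\<in>{1..}. power_sum_series m (q ^ n)) = (\<Sum>\<^sub>\<infinity>N\<in>{1..}. of_nat (divisor_sum m N) * q ^ N)"
    and "(\<lambda>n. power_sum_series m (q ^ n)) summable_on {1..}"
    and "(\<lambda>N. of_nat (divisor_sum m N) * q ^ N) summable_on {1..}"
proof -
  let ?f = "\<lambda>(n, d). of_nat d ^ m * q ^ (n * d)"
  note summ = summable_divisor_terms[OF q, of m]
  have row: "(\<Sum>\<^sub>\<infinity>d\<in>{1..}. of_nat d ^ m * q ^ (n * d)) = power_sum_series m (q ^ n)" if "n \<in> {1..}" for n
  proof -
    have qn: "norm (q ^ n) < 1" using q that by (simp add: norm_power power_less_one_iff)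
    have nn: "summable (\<lambda>d. norm (of_nat d ^ m * (q ^ n) ^ d))"
      using summable_power_sum_series[of "norm (q ^ n)" m] qn by (simp add: norm_mult norm_power)
    have "((\<lambda>d. of_nat d ^ m * (q ^ n) ^ d) has_sum power_sum_series m (q ^ n)) UNIV"
      unfolding power_sum_series_def
      by (intro norm_summable_imp_has_sum nn summable_sums summable_power_sum_series qn)
    also have "?this \<longleftrightarrow> ((\<lambda>d. of_nat d ^ m * q ^ (n * d)) has_sum power_sum_series m (q ^ n)) {1..}"
      by (rule has_sum_cong_neutral) (use m in \<open>auto simp: power_mult not_le\<close>)
    finally show ?thesis by (rule infsumI)
  qed
  have "(\<lambda>n. \<Sum>\<^sub>\<infinity>d\<in>{1..}. of_nat d ^ m * q ^ (n * d)) summable_on {1..}"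
    using summable_on_Sigma_banach[OF summ] .
  then show "(\<lambda>n. power_sum_series m (q ^ n)) summable_on {1..}"
    by (rule iffD1[OF summable_on_cong[OF row], rotated])
  define D where "D = (SIGMA N:{1..}. {d::nat. d dvd N})"
  let ?g = "\<lambda>(N, d). of_nat d ^ m * q ^ N :: complex"
  have re1: "(?g summable_on D) = (?f summable_on ({1..} \<times> {1..}))"
    by (rule summable_on_reindex_bij_witness[of _ "\<lambda>(n, d). (n * d, d)" "\<lambda>(N, d). (N div d, d)"])
      (auto simp: D_def Suc_le_eq dvd_pos_nat mult.commute intro!: Nat.gr0I elim!: dvdE)
  have re2: "infsum ?g D = infsum ?f ({1..} \<times> {1..})"
    by (rule infsum_reindex_bij_witness[of _ "\<lambda>(n, d). (n * d, d)" "\<lambda>(N, d). (N div d, d)"])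
      (auto simp: D_def Suc_le_eq dvd_pos_nat mult.commute intro!: Nat.gr0I elim!: dvdE)
  have gs: "?g summable_on D" using summ re1 by simp
  have inner: "(\<Sum>\<^sub>\<infinity>d\<in>{d. d dvd N}. of_nat d ^ m * q ^ N) = of_nat (divisor_sum m N) * q ^ N" if "N \<in> {1..}" for N
  proof -
    have "finite {d. d dvd N}" using that by simp
    then show ?thesis by (simp add: divisor_sum_def sum_distrib_right)
  qed
  show "(\<lambda>N. of_nat (divisor_sum m N) * q ^ N) summable_on {1..}"
    by (rule iffD1[OF summable_on_cong[OF inner] summable_on_Sigma_banach[OF gs[unfolded D_def]]])
  have "(\<Sum>\<^sub>\<infinity>n\<in>{1..}. power_sum_series m (q ^ n)) = (\<Sum>\<^sub>\<infinity>n\<in>{1..}. \<Sum>\<^sub>\<infinity>d\<in>{1..}. of_nat d ^ m * q ^ (n * d))"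
    by (rule infsum_cong) (rule row[symmetric])
  also have "\<dots> = infsum ?g D" unfolding infsum_Sigma'_banach[OF summ] re2 ..
  also have "\<dots> = (\<Sum>\<^sub>\<infinity>N\<in>{1..}. \<Sum>\<^sub>\<infinity>d\<in>{d. d dvd N}. of_nat d ^ m * q ^ N)"
    unfolding D_def by (rule infsum_Sigma'_banach[OF gs[unfolded D_def], symmetric])
  also have "\<dots> = (\<Sum>\<^sub>\<infinity>N\<in>{1..}. of_nat (divisor_sum m N) * q ^ N)"
    by (rule infsum_cong) (rule inner)
  finally show "(\<Sum>\<^sub>\<infinity>n\<in>{1..}. power_sum_series m (q ^ n)) = (\<Sum>\<^sub>\<infinity>N\<in>{1..}. of_nat (divisor_sum m N) * q ^ N)" .
qed

lemma nome_mult: "nome (of_nat n * \<tau>) = nome \<tau> ^ n"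
  by (simp add: nome_def mult_ac flip: exp_of_nat_mult)

lemma eis_q_expansion:
  assumes \<tau>: "Im \<tau> > 0" and m: "odd m" "m \<ge> 3"
  shows "fact m * eis (std_lattice \<tau>) (Suc m) = 2 * Polygamma m 1
    + 2 * (2 * of_real pi * \<i>) ^ Suc m * (\<Sum>\<^sub>\<infinity>N\<in>{1..}. of_nat (divisor_sum m N) * nome \<tau> ^ N)"
proof -
  let ?f = "\<lambda>p. 1 / lat_point \<tau> p ^ Suc m"
  \<comment> \<open>The row without \<tau> yields the constant term. The rows with positive and with
    negative multiples of \<tau> are exchanged by negation and have equal sums because the weight is
    even.\<close>
  define R0 Rp Rn where "R0 = (\<lambda>n. (n, 0 :: int)) ` (UNIV - {0 :: int})"
    and "Rp = (\<lambda>(n, k). (k, int n)) ` ({1..} \<times> (UNIV :: int set))"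
    and "Rn = (\<lambda>(n, k). (- k, - int n)) ` ({1..} \<times> (UNIV :: int set))"
  have summ: "?f summable_on (UNIV - {(0, 0)})" by (rule summable_lat_point[OF \<tau>]) (use m in simp)
  have split: "UNIV - {(0, 0)} = R0 \<union> (Rp \<union> Rn)"
  proof -
    have "(x, y) \<in> R0 \<union> (Rp \<union> Rn)" if "(x, y) \<noteq> (0, 0)" for x y
    proof -
      consider "y = 0" | "y > 0" | "y < 0" by linarith
      then show ?thesis
      proof cases
        case 1
        then show ?thesis using that by (auto simp: R0_def)
      next
        case 2
        then have "(x, y) \<in> Rp" unfolding Rp_def by (intro image_eqI[of _ _ "(nat y, x)"]) auto
        then show ?thesis by simp
      next
        case 3
        then have "(x, y) \<in> Rn" unfolding Rn_def by (intro image_eqI[of _ _ "(nat (- y), - x)"]) auto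
        then show ?thesis by simp
      qed
    qed
    moreover have "(0, 0) \<notin> R0 \<union> (Rp \<union> Rn)" by (auto simp: R0_def Rp_def Rn_def)
    ultimately show ?thesis by auto
  qed
  have sub: "?f summable_on R" if "R \<subseteq> UNIV - {(0, 0)}" for R
    by (rule summable_on_subset_banach[OF summ that])
  have s0: "?f summable_on R0" and sp: "?f summable_on Rp" and sn: "?f summable_on Rn"
    by (rule sub, unfold split, blast)+
  have disj: "R0 \<inter> (Rp \<union> Rn) = {}" "Rp \<inter> Rn = {}" by (auto simp: R0_def Rp_def Rn_def)
  have "eis (std_lattice \<tau>) (Suc m) = infsum ?f (UNIV - {(0, 0)})"
    unfolding eis_def by (rule infsum_std_lattice[OF \<tau>])
  also have "\<dots> = infsum ?f R0 + (infsum ?f Rp + infsum ?f Rn)"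
    unfolding split infsum_Un_disjoint[OF s0 summable_on_Un_disjoint[OF sp sn disj(2)] disj(1)]
      infsum_Un_disjoint[OF sp sn disj(2)] ..
  also have "infsum ?f R0 = (\<Sum>\<^sub>\<infinity>n\<in>UNIV - {0}. 1 / of_int n ^ Suc m)"
    unfolding R0_def by (subst infsum_reindex) (auto simp: inj_on_def o_def lat_point_def)
  also have "infsum ?f Rn = infsum ?f Rp"
  proof (rule infsum_reindex_bij_witness[of _ "\<lambda>(x, y). (- x, - y)" "\<lambda>(x, y). (- x, - y)"])
    fix p :: "int \<times> int"
    have "lat_point \<tau> (case p of (x, y) \<Rightarrow> (- x, - y)) = - lat_point \<tau> p"
      by (simp add: lat_point_def split: prod.split)
    then show "1 / lat_point \<tau> (case p of (x, y) \<Rightarrow> (- x, - y)) ^ Suc m = 1 / lat_point \<tau> p ^ Suc m"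
      using m by (simp only: power_minus_even even_Suc not_not not_False_eq_True)
  qed (auto simp: Rn_def Rp_def image_iff split: prod.splits)
  also have "infsum ?f Rp = (\<Sum>\<^sub>\<infinity>(n, k)\<in>{1..} \<times> UNIV. 1 / (of_int k + of_nat n * \<tau>) ^ Suc m)"
    unfolding Rp_def by (subst infsum_reindex) (auto simp: inj_on_def o_def lat_point_def intro!: infsum_cong)
  also have "\<dots> = (\<Sum>\<^sub>\<infinity>n\<in>{1..}. \<Sum>\<^sub>\<infinity>k\<in>UNIV. 1 / (of_int k + of_nat n * \<tau>) ^ Suc m)"
  proof (rule infsum_Sigma'_banach[symmetric])
    have "?f \<circ> (\<lambda>(n, k). (k, int n)) summable_on {1..} \<times> UNIV"
      using sp unfolding Rp_def by (subst (asm) summable_on_reindex) (auto simp: inj_on_def)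
    then show "(\<lambda>(n, k). 1 / (of_int k + of_nat n * \<tau>) ^ Suc m) summable_on {1..} \<times> UNIV"
      by (simp add: o_def lat_point_def case_prod_unfold)
  qed
  finally have e: "fact m * eis (std_lattice \<tau>) (Suc m) = fact m * (\<Sum>\<^sub>\<infinity>n\<in>UNIV - {0}. 1 / of_int n ^ Suc m)
      + 2 * (fact m * (\<Sum>\<^sub>\<infinity>n\<in>{1..}. \<Sum>\<^sub>\<infinity>k\<in>UNIV. 1 / (of_int k + of_nat n * \<tau>) ^ Suc m))"
    by (simp add: algebra_simps del: power_Suc)
  have "fact m * (\<Sum>\<^sub>\<infinity>n\<in>{1..}. \<Sum>\<^sub>\<infinity>k\<in>UNIV. 1 / (of_int k + of_nat n * \<tau>) ^ Suc m)
      = (\<Sum>\<^sub>\<infinity>n\<in>{1..}. fact m * (\<Sum>\<^sub>\<infinity>k\<in>UNIV. 1 / (of_int k + of_nat n * \<tau>) ^ Suc m))"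
    by (rule infsum_cmult_right'[symmetric])
  also have "\<dots> = (\<Sum>\<^sub>\<infinity>n\<in>{1..}. (2 * of_real pi * \<i>) ^ Suc m * power_sum_series m (nome \<tau> ^ n))"
  proof (rule infsum_cong)
    fix n :: nat assume "n \<in> {1..}"
    then have "Im (of_nat n * \<tau>) > 0" using \<tau> by simp
    from row_sum(2)[OF this m] show "fact m * (\<Sum>\<^sub>\<infinity>k\<in>UNIV. 1 / (of_int k + of_nat n * \<tau>) ^ Suc m)
        = (2 * of_real pi * \<i>) ^ Suc m * power_sum_series m (nome \<tau> ^ n)" unfolding nome_mult .
  qed
  also have "\<dots> = (2 * of_real pi * \<i>) ^ Suc m * (\<Sum>\<^sub>\<infinity>N\<in>{1..}. of_nat (divisor_sum m N) * nome \<tau> ^ N)"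
    using m by (subst infsum_cmult_right', subst divisor_series(1)[OF norm_nome_less_1[OF \<tau>]]) auto
  finally show ?thesis unfolding e zero_row_sum(2)[OF m] by simp
qed

text \<open>The normalisations match because 2 zeta(4) = pi^4/45 and - 15/45 = - 1/3. For
  \<open>b_form\<close> the values are 2 zeta(6) = 2 pi^6/945 and 70/945 = 2/27.\<close>

lemma a_form_eq:
  assumes \<tau>: "Im \<tau> > 0"
  shows "a_form \<tau> = - 15 / of_real pi ^ 4 * eis (std_lattice \<tau>) 4"
proof -
  define S where "S = (\<Sum>\<^sub>\<infinity>N\<in>{1..}. of_nat (divisor_sum 3 N) * nome \<tau> ^ N)"
  have "6 * eis (std_lattice \<tau>) 4 = 2 * of_real (pi ^ 4 / 15) + 2 * (2 * of_real pi * \<i>) ^ 4 * S"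
    using eis_q_expansion[OF \<tau>, of 3] unfolding Polygamma_3_1 S_def by (simp add: fact_numeral)
  then have "6 * eis (std_lattice \<tau>) 4 = of_real pi ^ 4 * (2 / 15 + 32 * S)"
    by (simp add: power_mult_distrib algebra_simps)
  then have e: "eis (std_lattice \<tau>) 4 = of_real pi ^ 4 * (2 / 15 + 32 * S) / 6" by (simp add: field_simps)
  show ?thesis unfolding a_form_def S_def[symmetric] e by (simp add: field_simps)
qed

lemma b_form_eq:
  assumes \<tau>: "Im \<tau> > 0"
  shows "b_form \<tau> = 35 / of_real pi ^ 6 * eis (std_lattice \<tau>) 6"
proof -
  define S where "S = (\<Sum>\<^sub>\<infinity>N\<in>{1..}. of_nat (divisor_sum 5 N) * nome \<tau> ^ N)"
  have i6: "\<i> ^ 6 = - 1" by (simp add: eval_nat_numeral)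
  have "120 * eis (std_lattice \<tau>) 6 = 2 * of_real (8 * pi ^ 6 / 63) + 2 * (2 * of_real pi * \<i>) ^ 6 * S"
    using eis_q_expansion[OF \<tau>, of 5] unfolding Polygamma_5_1 S_def by (simp add: fact_numeral)
  then have "120 * eis (std_lattice \<tau>) 6 = of_real pi ^ 6 * (16 / 63 - 128 * S)"
    by (simp add: power_mult_distrib i6 algebra_simps)
  then have e: "eis (std_lattice \<tau>) 6 = of_real pi ^ 6 * (16 / 63 - 128 * S) / 120" by (simp add: field_simps)
  show ?thesis unfolding b_form_def S_def[symmetric] e by (simp add: field_simps)
qed

section \<open>Modular forms as elements of the fraction field\<close>

text \<open>This makes the generic basis, relations and matrices available over the fraction
  field.\<close>

instance fract :: ("{idom, ring_char_0}") field_char_0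
proof
  show "inj (of_nat :: nat \<Rightarrow> 'a fract)"
    by (rule injI) (simp add: of_nat_fract eq_fract)
qed

lemma Rep_uhp_fun_of_nat: "\<tau> \<in> upper_half_plane \<Longrightarrow> Rep_uhp_fun (of_nat n) \<tau> = of_nat n"
  by (induction n) (simp_all add: zero_uhp_fun.rep_eq one_uhp_fun.rep_eq plus_uhp_fun.rep_eq)

instance uhp_fun :: ring_char_0
proof
  have i: "\<i> \<in> upper_half_plane" by (simp add: upper_half_plane_def)
  show "inj (of_nat :: nat \<Rightarrow> uhp_fun)"
    by (rule injI) (metis Rep_uhp_fun_of_nat[OF i] of_nat_eq_iff)
qed

lemma Rep_uhp_restrict:
  assumes "f holomorphic_on upper_half_plane"
  shows "Rep_uhp_fun (uhp_restrict f) = (\<lambda>\<tau>. if \<tau> \<in> upper_half_plane then f \<tau> else 0)"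
proof -
  have "(\<lambda>\<tau>. if \<tau> \<in> upper_half_plane then f \<tau> else 0) holomorphic_on upper_half_plane"
    using assms by (rule holomorphic_transform) simp
  then show ?thesis unfolding uhp_restrict_def by (subst Abs_uhp_fun_inverse) auto
qed

lemma uhp_fun_eqI:
  assumes "\<And>\<tau>. \<tau> \<in> upper_half_plane \<Longrightarrow> Rep_uhp_fun f \<tau> = Rep_uhp_fun g \<tau>"
  shows "f = g"
proof -
  have "Rep_uhp_fun h \<tau> = 0" if "\<tau> \<notin> upper_half_plane" for h \<tau>
    using Rep_uhp_fun[of h] that by simp
  then have "Rep_uhp_fun f = Rep_uhp_fun g" using assms by (metis ext)
  then show ?thesis by (simp add: Rep_uhp_fun_inject)
qed

section \<open>Homogeneous elements and pointwise identities\<close>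

abbreviation "uhp_hol f \<equiv> f holomorphic_on upper_half_plane"

lemma homog_cong:
  assumes "\<And>\<tau>. \<tau> \<in> upper_half_plane \<Longrightarrow> f \<tau> = g \<tau>"
  shows "homog k f = homog k g"
proof -
  have "uhp_restrict f = uhp_restrict g"
    unfolding uhp_restrict_def by (rule arg_cong[of _ _ Abs_uhp_fun]) (use assms in auto)
  then show ?thesis unfolding homog_def by simp
qed

lemma homog_add: "uhp_hol f \<Longrightarrow> uhp_hol g \<Longrightarrow> homog k f + homog k g = homog k (\<lambda>\<tau>. f \<tau> + g \<tau>)"
proof -
  assume h: "uhp_hol f" "uhp_hol g"
  have "uhp_restrict f + uhp_restrict g = uhp_restrict (\<lambda>\<tau>. f \<tau> + g \<tau>)"
    by (rule uhp_fun_eqI) (simp add: h plus_uhp_fun.rep_eq Rep_uhp_restrict holomorphic_on_add)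
  then show ?thesis by (simp add: homog_def add_monom)
qed

lemma homog_mult: "uhp_hol f \<Longrightarrow> uhp_hol g \<Longrightarrow> homog k f * homog l g = homog (k + l) (\<lambda>\<tau>. f \<tau> * g \<tau>)"
proof -
  assume h: "uhp_hol f" "uhp_hol g"
  have "uhp_restrict f * uhp_restrict g = uhp_restrict (\<lambda>\<tau>. f \<tau> * g \<tau>)"
    by (rule uhp_fun_eqI) (simp add: h times_uhp_fun.rep_eq Rep_uhp_restrict holomorphic_on_mult)
  then show ?thesis by (simp add: homog_def mult_monom)
qed

lemma homog_uminus: "uhp_hol f \<Longrightarrow> - homog k f = homog k (\<lambda>\<tau>. - f \<tau>)"
proof -
  assume h: "uhp_hol f"
  have "- uhp_restrict f = uhp_restrict (\<lambda>\<tau>. - f \<tau>)"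
    by (rule uhp_fun_eqI) (simp add: h uminus_uhp_fun.rep_eq Rep_uhp_restrict holomorphic_on_minus)
  then show ?thesis by (simp add: homog_def minus_monom)
qed

lemma homog_diff: "uhp_hol f \<Longrightarrow> uhp_hol g \<Longrightarrow> homog k f - homog k g = homog k (\<lambda>\<tau>. f \<tau> - g \<tau>)"
proof -
  assume h: "uhp_hol f" "uhp_hol g"
  have "homog k f - homog k g = homog k f + - homog k g" by simp
  also have "\<dots> = homog k (\<lambda>\<tau>. f \<tau> + - g \<tau>)"
    unfolding homog_uminus[OF h(2)] by (rule homog_add[OF h(1) holomorphic_on_minus[OF h(2)]])
  finally show ?thesis by simp
qed

lemma homog_of_nat: "homog 0 (\<lambda>_. of_nat n) = of_nat n"
proof -
  have "uhp_restrict (\<lambda>_. of_nat n) = of_nat n"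
    by (rule uhp_fun_eqI) (simp add: Rep_uhp_restrict Rep_uhp_fun_of_nat)
  then show ?thesis by (simp add: homog_def monom_0 of_nat_poly of_nat_fract)
qed

lemma homog_1: "homog 0 (\<lambda>_. 1) = 1"
  using homog_of_nat[of 1] by simp

lemma homog_0: "homog k (\<lambda>_. 0) = 0"
proof -
  have "uhp_restrict (\<lambda>_. 0) = 0"
    by (rule uhp_fun_eqI) (simp add: Rep_uhp_restrict zero_uhp_fun.rep_eq)
  then show ?thesis by (simp add: homog_def Zero_fract_def)
qed

lemma homog_numeral_mult: "uhp_hol f \<Longrightarrow> numeral n * homog k f = homog k (\<lambda>\<tau>. numeral n * f \<tau>)"
  using homog_mult[of "\<lambda>_. of_nat (numeral n)" f 0 k] unfolding homog_of_nat by simp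

lemma homog_power: "uhp_hol f \<Longrightarrow> homog k f ^ n = homog (k * n) (\<lambda>\<tau>. f \<tau> ^ n)"
  by (induction n) (simp_all add: homog_1 homog_mult holomorphic_on_power add.commute)

lemma SL2Z_mobius_in: "\<gamma> \<in> SL2Z \<Longrightarrow> \<tau> \<in> upper_half_plane \<Longrightarrow> mobius_act \<gamma> \<tau> \<in> upper_half_plane"
  using Im_mobius_pos by (simp add: in_uhp)

section \<open>Closure properties of modular forms, of their ring and of its field of
  fractions\<close>

lemma modular_forms_bounded:
  assumes "f \<in> modular_forms k \<Gamma>" "\<gamma> \<in> SL2Z"
  obtains B C where "C > 0" "\<And>\<tau>. Im \<tau> \<ge> C \<Longrightarrow> norm (slash k (Rep_uhp_fun f) \<gamma> \<tau>) \<le> B"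
proof -
  have "\<exists>B. \<exists>C>0. \<forall>\<tau>. Im \<tau> \<ge> C \<longrightarrow> norm (slash k (Rep_uhp_fun f) \<gamma> \<tau>) \<le> B"
    using assms unfolding modular_forms_def by simp
  with that show ?thesis by metis
qed

lemma modular_forms_slash:
  assumes "f \<in> modular_forms k \<Gamma>" "\<gamma> \<in> \<Gamma>" "\<tau> \<in> upper_half_plane"
  shows "slash k (Rep_uhp_fun f) \<gamma> \<tau> = Rep_uhp_fun f \<tau>"
  using assms unfolding modular_forms_def by simp

context
  fixes \<Gamma> :: "int mat set"
  assumes \<Gamma>: "\<Gamma> \<subseteq> SL2Z"
begin

lemma modular_forms_0: "0 \<in> modular_forms k \<Gamma>"
  unfolding modular_forms_def slash_def
  by (auto simp: zero_uhp_fun.rep_eq intro!: exI[of _ 1])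

lemma modular_forms_1: "1 \<in> modular_forms 0 \<Gamma>"
  unfolding modular_forms_def slash_def
  using SL2Z_mobius_in \<Gamma> by (auto simp: one_uhp_fun.rep_eq intro!: exI[of _ 1])

lemma modular_forms_uminus: "f \<in> modular_forms k \<Gamma> \<Longrightarrow> - f \<in> modular_forms k \<Gamma>"
  unfolding modular_forms_def slash_def by (simp add: uminus_uhp_fun.rep_eq)

lemma modular_forms_add:
  assumes f: "f \<in> modular_forms k \<Gamma>" and g: "g \<in> modular_forms k \<Gamma>"
  shows "f + g \<in> modular_forms k \<Gamma>"
proof -
  have s: "slash k (Rep_uhp_fun (f + g)) \<gamma> \<tau> = slash k (Rep_uhp_fun f) \<gamma> \<tau> + slash k (Rep_uhp_fun g) \<gamma> \<tau>" for \<gamma> \<tau>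
    by (simp add: slash_def plus_uhp_fun.rep_eq add_divide_distrib)
  have "\<exists>B. \<exists>C>0. \<forall>\<tau>. Im \<tau> \<ge> C \<longrightarrow> norm (slash k (Rep_uhp_fun (f + g)) \<gamma> \<tau>) \<le> B" if \<gamma>: "\<gamma> \<in> SL2Z" for \<gamma>
  proof -
    obtain B C where 1: "C > 0" "\<And>\<tau>. Im \<tau> \<ge> C \<Longrightarrow> norm (slash k (Rep_uhp_fun f) \<gamma> \<tau>) \<le> B"
      using modular_forms_bounded[OF f \<gamma>] by blast
    obtain B' C' where 2: "C' > 0" "\<And>\<tau>. Im \<tau> \<ge> C' \<Longrightarrow> norm (slash k (Rep_uhp_fun g) \<gamma> \<tau>) \<le> B'"
      using modular_forms_bounded[OF g \<gamma>] by blast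
    have "norm (slash k (Rep_uhp_fun (f + g)) \<gamma> \<tau>) \<le> B + B'" if "Im \<tau> \<ge> max C C'" for \<tau>
      unfolding s using 1(2)[of \<tau>] 2(2)[of \<tau>] that by (intro norm_triangle_le) auto
    moreover have "max C C' > 0" using 1(1) by simp
    ultimately show ?thesis by blast
  qed
  moreover have "slash k (Rep_uhp_fun (f + g)) \<gamma> \<tau> = Rep_uhp_fun (f + g) \<tau>" if "\<gamma> \<in> \<Gamma>" "\<tau> \<in> upper_half_plane" for \<gamma> \<tau>
  proof -
    have "slash k (Rep_uhp_fun f) \<gamma> \<tau> = Rep_uhp_fun f \<tau>" "slash k (Rep_uhp_fun g) \<gamma> \<tau> = Rep_uhp_fun g \<tau>"
      by (rule modular_forms_slash[OF f that] modular_forms_slash[OF g that])+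
    then show ?thesis unfolding s by (simp only: plus_uhp_fun.rep_eq)
  qed
  ultimately show ?thesis unfolding modular_forms_def by blast
qed

lemma modular_forms_mult:
  assumes f: "f \<in> modular_forms k \<Gamma>" and g: "g \<in> modular_forms l \<Gamma>"
  shows "f * g \<in> modular_forms (k + l) \<Gamma>"
proof -
  have s: "slash (k + l) (Rep_uhp_fun (f * g)) \<gamma> \<tau> = slash k (Rep_uhp_fun f) \<gamma> \<tau> * slash l (Rep_uhp_fun g) \<gamma> \<tau>" for \<gamma> \<tau>
    by (simp add: slash_def times_uhp_fun.rep_eq power_add)
  have "\<exists>B. \<exists>C>0. \<forall>\<tau>. Im \<tau> \<ge> C \<longrightarrow> norm (slash (k + l) (Rep_uhp_fun (f * g)) \<gamma> \<tau>) \<le> B" if \<gamma>: "\<gamma> \<in> SL2Z" for \<gamma>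
  proof -
    obtain B C where 1: "C > 0" "\<And>\<tau>. Im \<tau> \<ge> C \<Longrightarrow> norm (slash k (Rep_uhp_fun f) \<gamma> \<tau>) \<le> B"
      using modular_forms_bounded[OF f \<gamma>] by blast
    obtain B' C' where 2: "C' > 0" "\<And>\<tau>. Im \<tau> \<ge> C' \<Longrightarrow> norm (slash l (Rep_uhp_fun g) \<gamma> \<tau>) \<le> B'"
      using modular_forms_bounded[OF g \<gamma>] by blast
    have "norm (slash (k + l) (Rep_uhp_fun (f * g)) \<gamma> \<tau>) \<le> B * B'" if "Im \<tau> \<ge> max C C'" for \<tau>
    proof -
      have 3: "norm (slash k (Rep_uhp_fun f) \<gamma> \<tau>) \<le> B" "norm (slash l (Rep_uhp_fun g) \<gamma> \<tau>) \<le> B'"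
        using 1(2)[of \<tau>] 2(2)[of \<tau>] that by auto
      have "0 \<le> B" using 3(1) norm_ge_zero order.trans by blast
      with 3 show ?thesis unfolding s norm_mult by (intro mult_mono) auto
    qed
    moreover have "max C C' > 0" using 1(1) by simp
    ultimately show ?thesis by blast
  qed
  moreover have "slash (k + l) (Rep_uhp_fun (f * g)) \<gamma> \<tau> = Rep_uhp_fun (f * g) \<tau>" if "\<gamma> \<in> \<Gamma>" "\<tau> \<in> upper_half_plane" for \<gamma> \<tau>
  proof -
    have "slash k (Rep_uhp_fun f) \<gamma> \<tau> = Rep_uhp_fun f \<tau>" "slash l (Rep_uhp_fun g) \<gamma> \<tau> = Rep_uhp_fun g \<tau>"
      by (rule modular_forms_slash[OF f that] modular_forms_slash[OF g that])+
    then show ?thesis unfolding s by (simp only: times_uhp_fun.rep_eq)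
  qed
  ultimately show ?thesis unfolding modular_forms_def by blast
qed

lemma modular_ring_monom: "f \<in> modular_forms k \<Gamma> \<Longrightarrow> monom f k \<in> modular_ring \<Gamma>"
  unfolding modular_ring_def using modular_forms_0 by simp

lemma modular_ring_0: "0 \<in> modular_ring \<Gamma>"
  unfolding modular_ring_def using modular_forms_0 by simp

lemma modular_ring_1: "1 \<in> modular_ring \<Gamma>"
  using modular_ring_monom[OF modular_forms_1] by (simp add: monom_0 one_pCons)

lemma modular_ring_add: "p \<in> modular_ring \<Gamma> \<Longrightarrow> q \<in> modular_ring \<Gamma> \<Longrightarrow> p + q \<in> modular_ring \<Gamma>"
  unfolding modular_ring_def using modular_forms_add by simp

lemma modular_ring_uminus: "p \<in> modular_ring \<Gamma> \<Longrightarrow> - p \<in> modular_ring \<Gamma>"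
  unfolding modular_ring_def using modular_forms_uminus by simp

lemma modular_ring_mult:
  assumes p: "p \<in> modular_ring \<Gamma>" and q: "q \<in> modular_ring \<Gamma>"
  shows "p * q \<in> modular_ring \<Gamma>"
proof -
  have sum: "(\<Sum>i\<in>A. h i) \<in> modular_forms k \<Gamma>" if "finite A" "\<And>i. i \<in> A \<Longrightarrow> h i \<in> modular_forms k \<Gamma>"
    for A :: "nat set" and h k
    using that by (induction A rule: finite_induct) (auto intro: modular_forms_add modular_forms_0)
  have "coeff p i * coeff q (k - i) \<in> modular_forms k \<Gamma>" if "i \<le> k" for i k
    using modular_forms_mult[of "coeff p i" i "coeff q (k - i)" "k - i"] p q that by (simp add: modular_ring_def)
  then have "coeff (p * q) k \<in> modular_forms k \<Gamma>" for k
    unfolding coeff_mult by (intro sum) auto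
  then show ?thesis unfolding modular_ring_def by blast
qed

lemma modular_field_of_ring: "p \<in> modular_ring \<Gamma> \<Longrightarrow> Fraction_Field.Fract p 1 \<in> modular_field \<Gamma>"
  unfolding modular_field_def using modular_ring_1
  by (intro CollectI exI[of _ p] exI[of _ 1]) simp

lemma modular_fieldE:
  assumes "x \<in> modular_field \<Gamma>"
  obtains p q where "x = Fraction_Field.Fract p q" "p \<in> modular_ring \<Gamma>" "q \<in> modular_ring \<Gamma>" "q \<noteq> 0"
  using assms unfolding modular_field_def by blast

lemma modular_field_add:
  assumes "x \<in> modular_field \<Gamma>" "y \<in> modular_field \<Gamma>"
  shows "x + y \<in> modular_field \<Gamma>"
proof -
  obtain p q where 1: "x = Fraction_Field.Fract p q" "p \<in> modular_ring \<Gamma>" "q \<in> modular_ring \<Gamma>" "q \<noteq> 0"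
    using assms(1) by (rule modular_fieldE)
  obtain r s where 2: "y = Fraction_Field.Fract r s" "r \<in> modular_ring \<Gamma>" "s \<in> modular_ring \<Gamma>" "s \<noteq> 0"
    using assms(2) by (rule modular_fieldE)
  have "x + y = Fraction_Field.Fract (p * s + r * q) (q * s)" using 1 2 by simp
  moreover have "p * s + r * q \<in> modular_ring \<Gamma>" "q * s \<in> modular_ring \<Gamma>" "q * s \<noteq> 0"
    using 1 2 by (simp_all add: modular_ring_add modular_ring_mult)
  ultimately show ?thesis unfolding modular_field_def by blast
qed

lemma modular_field_uminus:
  assumes "x \<in> modular_field \<Gamma>"
  shows "- x \<in> modular_field \<Gamma>"
proof -
  obtain p q where "x = Fraction_Field.Fract p q" "p \<in> modular_ring \<Gamma>" "q \<in> modular_ring \<Gamma>" "q \<noteq> 0"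
    using assms by (rule modular_fieldE)
  then have "- x = Fraction_Field.Fract (- p) q" "- p \<in> modular_ring \<Gamma>" "q \<in> modular_ring \<Gamma>" "q \<noteq> 0"
    by (simp_all add: modular_ring_uminus)
  then show ?thesis unfolding modular_field_def by blast
qed

lemma modular_field_diff: "x \<in> modular_field \<Gamma> \<Longrightarrow> y \<in> modular_field \<Gamma> \<Longrightarrow> x - y \<in> modular_field \<Gamma>"
  using modular_field_add[OF _ modular_field_uminus, of x y] by simp

lemma modular_field_mult:
  assumes "x \<in> modular_field \<Gamma>" "y \<in> modular_field \<Gamma>"
  shows "x * y \<in> modular_field \<Gamma>"
proof -
  obtain p q where 1: "x = Fraction_Field.Fract p q" "p \<in> modular_ring \<Gamma>" "q \<in> modular_ring \<Gamma>" "q \<noteq> 0"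
    using assms(1) by (rule modular_fieldE)
  obtain r s where 2: "y = Fraction_Field.Fract r s" "r \<in> modular_ring \<Gamma>" "s \<in> modular_ring \<Gamma>" "s \<noteq> 0"
    using assms(2) by (rule modular_fieldE)
  have "x * y = Fraction_Field.Fract (p * r) (q * s)" using 1 2 by simp
  moreover have "p * r \<in> modular_ring \<Gamma>" "q * s \<in> modular_ring \<Gamma>" "q * s \<noteq> 0"
    using 1 2 by (simp_all add: modular_ring_mult)
  ultimately show ?thesis unfolding modular_field_def by blast
qed

lemma modular_field_divide:
  assumes "x \<in> modular_field \<Gamma>" "y \<in> modular_field \<Gamma>"
  shows "x / y \<in> modular_field \<Gamma>"
proof -
  have "inverse y \<in> modular_field \<Gamma>"
  proof (cases "y = 0")
    case True
    then show ?thesis using assms by simp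
  next
    case False
    obtain r s where 2: "y = Fraction_Field.Fract r s" "r \<in> modular_ring \<Gamma>" "s \<in> modular_ring \<Gamma>" "s \<noteq> 0"
      using assms(2) by (rule modular_fieldE)
    then have "inverse y = Fraction_Field.Fract s r" "r \<noteq> 0"
      using False by (auto simp: Zero_fract_def eq_fract)
    then show ?thesis using 2 unfolding modular_field_def by blast
  qed
  then show ?thesis using modular_field_mult[OF assms(1)] by (simp add: divide_inverse)
qed

lemma modular_field_1: "1 \<in> modular_field \<Gamma>"
  using modular_field_of_ring[OF modular_ring_1] by (simp add: One_fract_def)

lemma modular_field_0: "0 \<in> modular_field \<Gamma>"
  using modular_field_of_ring[OF modular_ring_0] by (simp add: Zero_fract_def)

lemma modular_field_numeral: "numeral n \<in> modular_field \<Gamma>"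
proof -
  have "of_nat m \<in> modular_field \<Gamma>" for m
    by (induction m) (auto intro: modular_field_0 modular_field_1 modular_field_add)
  from this[of "numeral n"] show ?thesis by simp
qed

lemma modular_field_power: "x \<in> modular_field \<Gamma> \<Longrightarrow> x ^ n \<in> modular_field \<Gamma>"
  by (induction n) (auto intro: modular_field_1 modular_field_mult)

text \<open>Clearing denominators turns a linear relation over the field into one over the graded
  ring, which can be compared weight by weight.\<close>

lemma modular_field_common_denominator:
  assumes "finite I" "\<And>i. i \<in> I \<Longrightarrow> c i \<in> modular_field \<Gamma>"
  obtains Q P where "Q \<noteq> 0" "\<And>i. i \<in> I \<Longrightarrow> P i \<in> modular_ring \<Gamma>"
    "\<And>i. i \<in> I \<Longrightarrow> c i * Fraction_Field.Fract Q 1 = Fraction_Field.Fract (P i) 1"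
proof -
  have "\<exists>Q P. Q \<in> modular_ring \<Gamma> \<and> Q \<noteq> 0 \<and>
    (\<forall>i\<in>I. P i \<in> modular_ring \<Gamma> \<and> c i * Fraction_Field.Fract Q 1 = Fraction_Field.Fract (P i) 1)"
    using assms
  proof (induction I rule: finite_induct)
    case empty
    show ?case using modular_ring_1 by (intro exI[of _ 1]) auto
  next
    case (insert j I)
    have "\<exists>Q P. Q \<in> modular_ring \<Gamma> \<and> Q \<noteq> 0 \<and>
        (\<forall>i\<in>I. P i \<in> modular_ring \<Gamma> \<and> c i * Fraction_Field.Fract Q 1 = Fraction_Field.Fract (P i) 1)"
      by (rule insert.IH) (rule insert.prems, rule insertI2)
    then obtain Q P where QP: "Q \<in> modular_ring \<Gamma>" "Q \<noteq> 0"
      "\<And>i. i \<in> I \<Longrightarrow> P i \<in> modular_ring \<Gamma>" "\<And>i. i \<in> I \<Longrightarrow> c i * Fraction_Field.Fract Q 1 = Fraction_Field.Fract (P i) 1"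
      by blast
    obtain p q where pq: "c j = Fraction_Field.Fract p q" "p \<in> modular_ring \<Gamma>" "q \<in> modular_ring \<Gamma>" "q \<noteq> 0"
      by (rule modular_fieldE[OF insert.prems[of j, OF insertI1]])
    define P' where "P' i = (if i = j then p * Q else P i * q)" for i
    have "P' i \<in> modular_ring \<Gamma> \<and> c i * Fraction_Field.Fract (Q * q) 1 = Fraction_Field.Fract (P' i) 1" if "i \<in> insert j I" for i
    proof (cases "i = j")
      case True
      then show ?thesis using pq QP by (simp add: P'_def modular_ring_mult eq_fract)
    next
      case False
      then have i: "i \<in> I" using that by simp
      have "c i * Fraction_Field.Fract (Q * q) 1 = (c i * Fraction_Field.Fract Q 1) * Fraction_Field.Fract q 1" by simp
      then show ?thesis using False QP(3,4)[OF i] pq by (simp add: P'_def modular_ring_mult)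
    qed
    moreover have "Q * q \<in> modular_ring \<Gamma>" "Q * q \<noteq> 0" using QP pq by (simp_all add: modular_ring_mult)
    ultimately show ?case by blast
  qed
  then show ?thesis using that by blast
qed

end

text \<open>Boundedness at every cusp follows from \<open>eis_bounded\<close> once each slash is a
  multiple of an Eisenstein sum over a subset of L/5. The set
  \<open>\<Lambda> \<gamma> \<tau>\<close> records the lattice that occurs.\<close>

lemma modular_formsI_eis:
  assumes \<Gamma>: "\<Gamma> \<subseteq> SL2Z" and k: "k \<ge> 3" and hol: "uhp_hol f"
    and f: "\<And>\<gamma> \<tau>. \<gamma> \<in> SL2Z \<Longrightarrow> Im \<tau> > 0 \<Longrightarrow> slash k f \<gamma> \<tau> = C * eis (\<Lambda> \<gamma> \<tau>) k"
    and sub: "\<And>\<gamma> \<tau>. \<gamma> \<in> SL2Z \<Longrightarrow> Im \<tau> > 0 \<Longrightarrow> \<Lambda> \<gamma> \<tau> \<subseteq> (\<lambda>w. 1 / 5 * w) ` std_lattice \<tau>"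
    and inv: "\<And>\<gamma> \<tau>. \<gamma> \<in> \<Gamma> \<Longrightarrow> Im \<tau> > 0 \<Longrightarrow> C * eis (\<Lambda> \<gamma> \<tau>) k = f \<tau>"
  shows "uhp_restrict f \<in> modular_forms k \<Gamma>"
proof -
  have s: "slash k (Rep_uhp_fun (uhp_restrict f)) \<gamma> \<tau> = C * eis (\<Lambda> \<gamma> \<tau>) k" if "\<gamma> \<in> SL2Z" "Im \<tau> > 0" for \<gamma> \<tau>
    using f[OF that] Im_mobius_pos[OF that] by (simp add: Rep_uhp_restrict[OF hol] slash_def in_uhp)
  obtain B where B: "\<And>\<tau> S. Im \<tau> \<ge> 1 \<Longrightarrow> S \<subseteq> (\<lambda>w. 1 / 5 * w) ` std_lattice \<tau> \<Longrightarrow> norm (eis S k) \<le> B"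
    using eis_bounded[OF k] by blast
  have "norm (slash k (Rep_uhp_fun (uhp_restrict f)) \<gamma> \<tau>) \<le> norm C * B" if "\<gamma> \<in> SL2Z" "Im \<tau> \<ge> 1" for \<gamma> \<tau>
  proof -
    have pos: "Im \<tau> > 0" using that by simp
    have "norm (eis (\<Lambda> \<gamma> \<tau>) k) \<le> B" by (rule B[OF that(2) sub[OF that(1) pos]])
    then show ?thesis unfolding s[OF that(1) pos] norm_mult by (intro mult_left_mono) auto
  qed
  then have "\<forall>\<gamma>\<in>SL2Z. \<exists>B. \<exists>C>0. \<forall>\<tau>. C \<le> Im \<tau> \<longrightarrow> norm (slash k (Rep_uhp_fun (uhp_restrict f)) \<gamma> \<tau>) \<le> B"
    by (intro ballI exI[of _ "norm C * B"] exI[of _ 1]) auto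
  moreover have "slash k (Rep_uhp_fun (uhp_restrict f)) \<gamma> \<tau> = Rep_uhp_fun (uhp_restrict f) \<tau>"
    if "\<gamma> \<in> \<Gamma>" "\<tau> \<in> upper_half_plane" for \<gamma> \<tau>
    using s[of \<gamma> \<tau>] inv[of \<gamma> \<tau>] that \<Gamma> by (auto simp: Rep_uhp_restrict[OF hol] in_uhp)
  ultimately show ?thesis unfolding modular_forms_def by blast
qed

lemma eis_mobius:
  assumes "\<gamma> \<in> SL2Z" "Im \<tau> > 0"
  shows "eis (std_lattice (mobius_act \<gamma> \<tau>)) k / automorphy \<gamma> \<tau> ^ k = eis (std_lattice \<tau>) k"
  unfolding std_lattice_mobius[OF assms] eis_scale[OF automorphy_nz[OF assms]] ..

text \<open>Slashing moves the point 1/5 on the lattice of \<gamma> \<tau> to (c \<tau> + d) / 5 on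
  the lattice of \<tau>; by \<open>superlattice_Gamma0\<close> the subgroup is the same for \<gamma>
  in \<open>Gamma0 5\<close>.\<close>

lemma eis_superlattice_mobius:
  assumes "\<gamma> \<in> SL2Z" "Im \<tau> > 0"
  shows "eis (superlattice (std_lattice (mobius_act \<gamma> \<tau>)) (1 / 5)) k / automorphy \<gamma> \<tau> ^ k
    = eis (superlattice (std_lattice \<tau>) (automorphy \<gamma> \<tau> / 5)) k"
proof -
  have "superlattice (std_lattice \<tau>) (automorphy \<gamma> \<tau> / 5)
    = (\<lambda>w. automorphy \<gamma> \<tau> * w) ` superlattice (std_lattice (mobius_act \<gamma> \<tau>)) (1 / 5)"
    unfolding superlattice_scale[symmetric] std_lattice_mobius[OF assms, symmetric] by simp
  then show ?thesis using eis_scale[OF automorphy_nz[OF assms]] by simp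
qed

lemma std_lattice_subset_fifth: "std_lattice \<tau> \<subseteq> (\<lambda>w. 1 / 5 * w) ` std_lattice \<tau>"
proof
  fix w assume "w \<in> std_lattice \<tau>"
  then obtain m n where "w = of_int m + of_int n * \<tau>" unfolding std_lattice_def by blast
  then have "w = 1 / 5 * (of_int (5 * m) + of_int (5 * n) * \<tau>)" by simp
  then show "w \<in> (\<lambda>w. 1 / 5 * w) ` std_lattice \<tau>" unfolding std_lattice_def by blast
qed

lemma hol_a_form: "uhp_hol a_form"
  by (rule holomorphic_transform[of "\<lambda>\<tau>. - 15 / of_real pi ^ 4 * eis (std_lattice \<tau>) 4"])
    (auto intro!: holomorphic_intros holomorphic_eis simp: a_form_eq in_uhp)

lemma hol_b_form: "uhp_hol b_form"
  by (rule holomorphic_transform[of "\<lambda>\<tau>. 35 / of_real pi ^ 6 * eis (std_lattice \<tau>) 6"])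
    (auto intro!: holomorphic_intros holomorphic_eis simp: b_form_eq in_uhp)

lemma hol_scale_5: "uhp_hol f \<Longrightarrow> uhp_hol (\<lambda>\<tau>. c * f (5 * \<tau>))"
  by (intro holomorphic_on_mult holomorphic_on_const holomorphic_on_compose_gen[of "\<lambda>\<tau>. 5 * \<tau>" _ f, unfolded o_def])
    (auto intro!: holomorphic_intros simp: in_uhp)

lemma a_form_5:
  assumes "Im \<tau> > 0"
  shows "5 ^ 4 * a_form (5 * \<tau>) = - 15 / of_real pi ^ 4 * eis (superlattice (std_lattice \<tau>) (1 / 5)) 4"
  using a_form_eq[of "5 * \<tau>"] assms
  unfolding superlattice_std_fifth[OF assms] by (subst eis_scale) (simp_all add: power_divide)

lemma b_form_5:
  assumes "Im \<tau> > 0"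
  shows "5 ^ 6 * b_form (5 * \<tau>) = 35 / of_real pi ^ 6 * eis (superlattice (std_lattice \<tau>) (1 / 5)) 6"
  using b_form_eq[of "5 * \<tau>"] assms
  unfolding superlattice_std_fifth[OF assms] by (subst eis_scale) (simp_all add: power_divide)

lemma automorphy_in: "5 * (automorphy \<gamma> \<tau> / 5) \<in> std_lattice \<tau>"
  using five_torsion_std[of "\<gamma> $$ (1, 1)" "\<gamma> $$ (1, 0)" \<tau>] by (simp only: automorphy_def add.commute)

lemma a_form_modular: "uhp_restrict a_form \<in> modular_forms 4 SL2Z"
proof (rule modular_formsI_eis[where \<Lambda> = "\<lambda>_. std_lattice" and C = "- 15 / of_real pi ^ 4"])
  fix \<gamma> \<tau> assume *: "\<gamma> \<in> SL2Z" "Im \<tau> > 0"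
  show "slash 4 a_form \<gamma> \<tau> = - 15 / of_real pi ^ 4 * eis (std_lattice \<tau>) 4"
    unfolding slash_eq a_form_eq[OF Im_mobius_pos[OF *]] eis_mobius[OF *, symmetric] by simp
qed (use hol_a_form std_lattice_subset_fifth a_form_eq in auto)

lemma b_form_modular: "uhp_restrict b_form \<in> modular_forms 6 SL2Z"
proof (rule modular_formsI_eis[where \<Lambda> = "\<lambda>_. std_lattice" and C = "35 / of_real pi ^ 6"])
  fix \<gamma> \<tau> assume *: "\<gamma> \<in> SL2Z" "Im \<tau> > 0"
  show "slash 6 b_form \<gamma> \<tau> = 35 / of_real pi ^ 6 * eis (std_lattice \<tau>) 6"
    unfolding slash_eq b_form_eq[OF Im_mobius_pos[OF *]] eis_mobius[OF *, symmetric] by simp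
qed (use hol_b_form std_lattice_subset_fifth b_form_eq in auto)

lemma Gamma0_subset: "Gamma0 N \<subseteq> SL2Z"
  by (auto simp: Gamma0_def)

lemma a_form_5_modular: "uhp_restrict (\<lambda>\<tau>. 5 ^ 4 * a_form (5 * \<tau>)) \<in> modular_forms 4 (Gamma0 5)"
proof (rule modular_formsI_eis[where \<Lambda> = "\<lambda>\<gamma> \<tau>. superlattice (std_lattice \<tau>) (automorphy \<gamma> \<tau> / 5)" and C = "- 15 / of_real pi ^ 4"])
  fix \<gamma> \<tau> assume *: "\<gamma> \<in> SL2Z" "Im \<tau> > 0"
  show "slash 4 (\<lambda>\<tau>. 5 ^ 4 * a_form (5 * \<tau>)) \<gamma> \<tau> = - 15 / of_real pi ^ 4 * eis (superlattice (std_lattice \<tau>) (automorphy \<gamma> \<tau> / 5)) 4"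
    unfolding slash_eq a_form_5[OF Im_mobius_pos[OF *]] eis_superlattice_mobius[OF *, symmetric] by simp
  show "superlattice (std_lattice \<tau>) (automorphy \<gamma> \<tau> / 5) \<subseteq> (\<lambda>w. 1 / 5 * w) ` std_lattice \<tau>"
    by (rule superlattice_subset[OF *(2) automorphy_in])
next
  fix \<gamma> \<tau> assume *: "\<gamma> \<in> Gamma0 5" "Im \<tau> > 0"
  show "- 15 / of_real pi ^ 4 * eis (superlattice (std_lattice \<tau>) (automorphy \<gamma> \<tau> / 5)) 4 = 5 ^ 4 * a_form (5 * \<tau>)"
    unfolding superlattice_Gamma0[OF *(2,1)] a_form_5[OF *(2)] ..
qed (use hol_scale_5[OF hol_a_form] Gamma0_subset in auto)

lemma b_form_5_modular: "uhp_restrict (\<lambda>\<tau>. 5 ^ 6 * b_form (5 * \<tau>)) \<in> modular_forms 6 (Gamma0 5)"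
proof (rule modular_formsI_eis[where \<Lambda> = "\<lambda>\<gamma> \<tau>. superlattice (std_lattice \<tau>) (automorphy \<gamma> \<tau> / 5)" and C = "35 / of_real pi ^ 6"])
  fix \<gamma> \<tau> assume *: "\<gamma> \<in> SL2Z" "Im \<tau> > 0"
  show "slash 6 (\<lambda>\<tau>. 5 ^ 6 * b_form (5 * \<tau>)) \<gamma> \<tau> = 35 / of_real pi ^ 6 * eis (superlattice (std_lattice \<tau>) (automorphy \<gamma> \<tau> / 5)) 6"
    unfolding slash_eq b_form_5[OF Im_mobius_pos[OF *]] eis_superlattice_mobius[OF *, symmetric] by simp
  show "superlattice (std_lattice \<tau>) (automorphy \<gamma> \<tau> / 5) \<subseteq> (\<lambda>w. 1 / 5 * w) ` std_lattice \<tau>"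
    by (rule superlattice_subset[OF *(2) automorphy_in])
next
  fix \<gamma> \<tau> assume *: "\<gamma> \<in> Gamma0 5" "Im \<tau> > 0"
  show "35 / of_real pi ^ 6 * eis (superlattice (std_lattice \<tau>) (automorphy \<gamma> \<tau> / 5)) 6 = 5 ^ 6 * b_form (5 * \<tau>)"
    unfolding superlattice_Gamma0[OF *(2,1)] b_form_5[OF *(2)] ..
qed (use hol_scale_5[OF hol_b_form] Gamma0_subset in auto)

lemma homog_in_modular_field:
  "\<Gamma> \<subseteq> SL2Z \<Longrightarrow> uhp_restrict f \<in> modular_forms k \<Gamma> \<Longrightarrow> homog k f \<in> modular_field \<Gamma>"
  unfolding homog_def by (intro modular_field_of_ring modular_ring_monom)

section \<open>The conjugates of a'\<close>

text \<open>Eigenvectors for distinct eigenvalues are independent, each being nonzero through its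
  entry 1. The matrix with these columns is then invertible, and so its transpose has trivial
  kernel.\<close>

lemma eigen_family_independent:
  fixes \<theta> :: "nat \<Rightarrow> 'a::field"
  assumes inj: "inj_on \<theta> {..<n}" and F0: "\<And>j. j < n \<Longrightarrow> F j 0 = 1"
    and eig: "\<And>j c. j < n \<Longrightarrow> c < n \<Longrightarrow> \<theta> j * F j c = (\<Sum>i<n. M i c * F j i)"
    and rel: "\<And>j. j < n \<Longrightarrow> (\<Sum>i<n. x i * F j i) = 0"
    and i: "i < n"
  shows "x i = 0"
proof -
  define A where "A = mat n n (\<lambda>(i, j). F j i)"
  have A: "A \<in> carrier_mat n n" "A\<^sup>T \<in> carrier_mat n n" by (simp_all add: A_def)
  have "Determinant.det A \<noteq> 0"
  proof
    assume "Determinant.det A = 0"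
    then obtain v where v: "v \<in> carrier_vec n" "v \<noteq> 0\<^sub>v n" "A *\<^sub>v v = 0\<^sub>v n"
      using det_0_iff_vec_prod_zero_field[OF A(1)] by blast
    define y where "y j = v $ j" for j
    have base: "(\<Sum>j<n. y j * F j i) = 0" if "i < n" for i
    proof -
      have "(A *\<^sub>v v) $ i = (\<Sum>j<n. F j i * y j)"
        using that v(1) by (simp add: A_def y_def scalar_prod_def atLeast0LessThan)
      then show ?thesis using that by (simp add: v(3) mult.commute)
    qed
    \<comment> \<open>Applying the transpose of \<open>M\<close> to a dependency k times weights its
      terms with the k-th powers of the eigenvalues.\<close>
    have pow: "\<forall>i<n. (\<Sum>j<n. y j * \<theta> j ^ k * F j i) = 0" for k
    proof (induction k)
      case 0
      then show ?case using base by simp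
    next
      case (Suc k)
      show ?case
      proof (intro allI impI)
        fix c assume c: "c < n"
        have "(\<Sum>j<n. y j * \<theta> j ^ Suc k * F j c) = (\<Sum>j<n. y j * \<theta> j ^ k * (\<Sum>i<n. M i c * F j i))"
          by (rule sum.cong) (use eig c in \<open>simp_all add: mult_ac flip: eig\<close>)
        also have "\<dots> = (\<Sum>j<n. \<Sum>i<n. M i c * (y j * \<theta> j ^ k * F j i))"
          by (simp add: sum_distrib_left mult_ac)
        also have "\<dots> = (\<Sum>i<n. \<Sum>j<n. M i c * (y j * \<theta> j ^ k * F j i))"
          by (rule sum.swap)
        also have "\<dots> = (\<Sum>i<n. M i c * (\<Sum>j<n. y j * \<theta> j ^ k * F j i))"
          by (simp add: sum_distrib_left)
        also have "\<dots> = 0" using Suc.IH by simp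
        finally show "(\<Sum>j<n. y j * \<theta> j ^ Suc k * F j c) = 0" .
      qed
    qed
    have poly0: "(\<Sum>j<n. y j * poly p (\<theta> j)) = 0" for p
    proof (cases "n = 0")
      case False
      have "(\<Sum>j<n. y j * \<theta> j ^ k) = 0" for k
        using pow[of k] False F0 by force
      have "(\<Sum>j<n. y j * poly p (\<theta> j)) = (\<Sum>j<n. \<Sum>k\<le>degree p. coeff p k * (y j * \<theta> j ^ k))"
        by (simp add: poly_altdef sum_distrib_left mult_ac)
      also have "\<dots> = (\<Sum>k\<le>degree p. \<Sum>j<n. coeff p k * (y j * \<theta> j ^ k))"
        by (rule sum.swap)
      also have "\<dots> = 0"
        using \<open>\<And>k. (\<Sum>j<n. y j * \<theta> j ^ k) = 0\<close> by (simp flip: sum_distrib_left)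
      finally show ?thesis .
    qed simp
    have "y j = 0" if j: "j < n" for j
    proof -
      \<comment> \<open>As in Lagrange interpolation, a polynomial vanishing at all eigenvalues but
        one isolates a single coefficient of the dependency.\<close>
      define p where "p = (\<Prod>l\<in>{..<n} - {j}. [:- \<theta> l, 1:])"
      have p0: "poly p (\<theta> l) = 0" if "l < n" "l \<noteq> j" for l
        using that by (auto simp: p_def poly_prod)
      have pj: "poly p (\<theta> j) \<noteq> 0"
        using j inj by (auto simp: p_def poly_prod inj_on_def)
      have "(\<Sum>l<n. y l * poly p (\<theta> l)) = (\<Sum>l\<in>{j}. y l * poly p (\<theta> l))"
        by (rule sum.mono_neutral_right) (use p0 j in auto)
      then show ?thesis using poly0[of p] pj by simp
    qed
    then have "v = 0\<^sub>v n" using v(1) by (intro eq_vecI) (auto simp: y_def)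
    with v(2) show False by simp
  qed
  then have "Determinant.det (A\<^sup>T) \<noteq> 0" using det_transpose[OF A(1)] by simp
  moreover have "A\<^sup>T *\<^sub>v vec n x = 0\<^sub>v n"
    by (rule eq_vecI) (use rel in \<open>simp_all add: A_def scalar_prod_def atLeast0LessThan mult.commute\<close>)
  ultimately have "vec n x = 0\<^sub>v n"
    using det_0_iff_vec_prod_zero_field[OF A(2)] vec_carrier by blast
  then show ?thesis using i by (metis index_vec index_zero_vec(1))
qed

section \<open>Separation of the conjugates near the cusp\<close>

definition sigma3_series :: "complex \<Rightarrow> complex" where
  "sigma3_series q = (\<Sum>N. of_nat (divisor_sum 3 N) * q ^ N)"

text \<open>Every number divides 0, and a sum over an infinite set is 0 by convention; hence the
  power series may start at N = 0.\<close>

lemma divisor_sum_0: "divisor_sum k 0 = 0"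
  by (simp add: divisor_sum_def)

lemma summable_sigma3:
  assumes "norm q < 1"
  shows "summable (\<lambda>N. of_nat (divisor_sum 3 N) * q ^ N :: complex)"
    and "(\<Sum>\<^sub>\<infinity>N\<in>{1..}. of_nat (divisor_sum 3 N) * q ^ N) = sigma3_series q"
proof -
  let ?f = "\<lambda>N. of_nat (divisor_sum 3 N) * q ^ N :: complex"
  have "(?f has_sum (\<Sum>\<^sub>\<infinity>N\<in>{1..}. ?f N)) {1..}"
    by (rule has_sum_infsum[OF divisor_series(3)[OF assms]]) simp
  also have "?this \<longleftrightarrow> (?f has_sum (\<Sum>\<^sub>\<infinity>N\<in>{1..}. ?f N)) UNIV"
    by (rule has_sum_cong_neutral) (auto simp: divisor_sum_0 not_le)
  finally have "?f sums (\<Sum>\<^sub>\<infinity>N\<in>{1..}. ?f N)" by (rule has_sum_imp_sums)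
  then show "summable ?f" "(\<Sum>\<^sub>\<infinity>N\<in>{1..}. ?f N) = sigma3_series q"
    unfolding sigma3_series_def by (simp_all add: sums_iff)
qed

lemma a_form_sigma3: "Im \<tau> > 0 \<Longrightarrow> a_form \<tau> = - (1 / 3) * (1 + 240 * sigma3_series (nome \<tau>))"
  unfolding a_form_def summable_sigma3(2)[OF norm_nome_less_1] ..

text \<open>The coefficient of q is 1, so the series is locally injective at 0. The bound 1/1000 is
  chosen to make 80 (626/1000) smaller than 208 in \<open>conj_a_distinct\<close>.\<close>

lemma sigma3_series_near_0:
  obtains r where "r > 0" "r \<le> 1" "inj_on sigma3_series (ball 0 r)"
    "\<And>q. q \<in> ball 0 r \<Longrightarrow> norm (sigma3_series q) < 1 / 1000"
proof -
  have d: "(sigma3_series has_field_derivative (\<Sum>n. diffs (\<lambda>N. of_nat (divisor_sum 3 N)) n * q ^ n)) (at q)"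
    if "norm q < 1" for q
    unfolding sigma3_series_def by (rule termdiffs_strong'[OF summable_sigma3(1) that])
  have hol: "sigma3_series holomorphic_on ball 0 1"
  proof (subst holomorphic_on_open[OF open_ball], intro ballI exI)
    fix q :: complex assume "q \<in> ball 0 1"
    then show "(sigma3_series has_field_derivative (\<Sum>n. diffs (\<lambda>N. of_nat (divisor_sum 3 N)) n * q ^ n)) (at q)"
      by (intro d) simp
  qed
  have "{d. d dvd (1::nat)} = {1}" by auto
  then have ne: "deriv sigma3_series 0 \<noteq> 0"
    using DERIV_imp_deriv[OF d[of 0]] by (simp add: diffs_def divisor_sum_def)
  have "(0::complex) \<in> ball 0 1" by simp
  from has_complex_derivative_locally_injective[OF hol this open_ball ne]
  obtain r where r: "r > 0" "ball 0 r \<subseteq> (ball 0 1 :: complex set)" "inj_on sigma3_series (ball 0 r)"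
    by blast
  have "isCont sigma3_series 0" using DERIV_isCont[OF d[of 0]] by simp
  then have "(sigma3_series \<longlongrightarrow> sigma3_series 0) (nhds 0)"
    unfolding isCont_def tendsto_at_iff_tendsto_nhds .
  then have "eventually (\<lambda>q. dist (sigma3_series q) (sigma3_series 0) < 1 / 1000) (nhds 0)"
    by (rule tendstoD) simp
  moreover have "sigma3_series 0 = 0" unfolding sigma3_series_def by (simp add: divisor_sum_0)
  ultimately have "eventually (\<lambda>q. norm (sigma3_series q) < 1 / 1000) (nhds 0)"
    by simp
  then obtain r' where r': "r' > 0" "\<And>q. dist q 0 < r' \<Longrightarrow> norm (sigma3_series q) < 1 / 1000"
    unfolding eventually_nhds_metric by blast
  show ?thesis
  proof (rule that[of "min (min r r') 1"])
    show "inj_on sigma3_series (ball 0 (min (min r r') 1))"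
      by (rule inj_on_subset[OF r(3)]) auto
    show "norm (sigma3_series q) < 1 / 1000" if "q \<in> ball 0 (min (min r r') 1)" for q
      using that by (intro r'(2)) (simp add: dist_commute)
  qed (use r(1) r'(1) in auto)
qed

text \<open>The conjugates of \<open>a'\<close> over the modular functions of level 1: the values of
  \<open>\<tau> \<mapsto> 5\<^sup>4 a(5 \<tau>)\<close> at \<open>\<tau>\<close>, slashed by representatives of the six cosets of \<open>\<Gamma>\<^sub>0(5)\<close>.\<close>

definition conj_a :: "nat \<Rightarrow> complex \<Rightarrow> complex" where
  "conj_a j \<tau> = (if j = 5 then 5 ^ 4 * a_form (5 * \<tau>) else a_form ((\<tau> + of_nat j) / 5))"

lemma nome_shift_inj:
  assumes "nome ((\<tau> + of_nat k) / 5) = nome ((\<tau> + of_nat l) / 5)" "k < 5" "l < 5"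
  shows "k = l"
proof -
  obtain n :: int where "2 * of_real pi * \<i> * ((\<tau> + of_nat k) / 5) = 2 * of_real pi * \<i> * ((\<tau> + of_nat l) / 5) + of_real (real_of_int (2 * n) * pi) * \<i>"
    using assms(1) unfolding nome_def exp_eq by blast
  then have "2 * of_real pi * \<i> / 5 * (of_nat k - of_nat l - 5 * of_int n) = 0"
    by (simp add: algebra_simps add_divide_distrib diff_divide_distrib)
  then have "of_nat k - of_nat l - 5 * of_int n = (0 :: complex)" by simp
  then have "of_int (int k - int l - 5 * n) = (0 :: complex)" by simp
  then have "int k - int l - 5 * n = 0" by (simp only: of_int_eq_0_iff)
  then show ?thesis using assms(2,3) by presburger
qed

text \<open>Near the cusp the conjugate of index 5 is close to - 625/3 and the others are close to -
  1/3, so size separates it. The other five are values of an injective series at nomes that differ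
  by fifth roots of unity.\<close>

lemma conj_a_distinct:
  obtains Y where "Y > 0" "\<And>\<tau>. Im \<tau> > Y \<Longrightarrow> inj_on (\<lambda>j. conj_a j \<tau>) {..<6}"
proof -
  obtain r where r: "r > 0" "r \<le> 1" "inj_on sigma3_series (ball 0 r)"
    "\<And>q. q \<in> ball 0 r \<Longrightarrow> norm (sigma3_series q) < 1 / 1000"
    using sigma3_series_near_0 by blast
  \<comment> \<open>At this height even the nomes at imaginary part Im \<tau> / 5 have norm below
    r.\<close>
  define Y where "Y = max 1 (- (5 * ln r) / (2 * pi))"
  have Y: "Y > 0" by (simp add: Y_def)
  have "inj_on (\<lambda>j. conj_a j \<tau>) {..<6}" if \<tau>: "Im \<tau> > Y" for \<tau>
  proof -
    have pos: "Im \<tau> > 0" using \<tau> Y by simp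
    have small: "nome t \<in> ball 0 r" if t: "Im t \<ge> Im \<tau> / 5" for t
    proof -
      have "Im \<tau> > - (5 * ln r) / (2 * pi)" using \<tau> by (simp add: Y_def)
      then have "- ln r < 2 * pi * (Im \<tau> / 5)" by (simp add: field_simps)
      also have "\<dots> \<le> 2 * pi * Im t" using t by (intro mult_left_mono) auto
      finally have "exp (- (2 * pi * Im t)) < exp (ln r)" by simp
      then show ?thesis using r(1) by (simp add: norm_nome)
    qed
    have val: "conj_a j \<tau> = - (1 / 3) * (1 + 240 * sigma3_series (nome ((\<tau> + of_nat j) / 5)))" if "j < 5" for j
      using that pos by (simp add: conj_a_def a_form_sigma3)
    have val5: "conj_a 5 \<tau> = 5 ^ 4 * (- (1 / 3) * (1 + 240 * sigma3_series (nome (5 * \<tau>))))"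
      using pos by (simp add: conj_a_def a_form_sigma3)
    have ne5: "conj_a j \<tau> \<noteq> conj_a 5 \<tau>" if j: "j < 5" for j
    proof
      assume "conj_a j \<tau> = conj_a 5 \<tau>"
      \<comment> \<open>Multiplying the equation by - 3 leaves 625 - 1 = 624 against the factor 240;
        division by 3 gives 208 and 80.\<close>
      then have "208 = 80 * (sigma3_series (nome ((\<tau> + of_nat j) / 5)) - 625 * sigma3_series (nome (5 * \<tau>)))"
        unfolding val[OF j] val5 by (simp add: algebra_simps)
      then have "norm (208 :: complex) = 80 * norm (sigma3_series (nome ((\<tau> + of_nat j) / 5)) - 625 * sigma3_series (nome (5 * \<tau>)))"
        by (metis norm_mult norm_numeral)
      also have "norm (sigma3_series (nome ((\<tau> + of_nat j) / 5)) - 625 * sigma3_series (nome (5 * \<tau>)))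
          \<le> norm (sigma3_series (nome ((\<tau> + of_nat j) / 5))) + 625 * norm (sigma3_series (nome (5 * \<tau>)))"
        using norm_triangle_ineq4[of "sigma3_series (nome ((\<tau> + of_nat j) / 5))" "625 * sigma3_series (nome (5 * \<tau>))"]
        by (simp add: norm_mult)
      also have "\<dots> < 1 / 1000 + 625 * (1 / 1000)"
        by (intro add_strict_mono mult_strict_left_mono r(4) small) (use pos in auto)
      finally show False by simp
    qed
    show ?thesis
    proof (rule inj_onI)
      fix k l :: nat assume kl: "k \<in> {..<6}" "l \<in> {..<6}" "conj_a k \<tau> = conj_a l \<tau>"
      show "k = l"
      proof (cases "k = 5 \<or> l = 5")
        case True
        then show ?thesis using kl ne5[of k] ne5[of l] by (cases "k = 5"; cases "l = 5") auto
      next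
        case False
        then have k: "k < 5" "l < 5" using kl by auto
        have "sigma3_series (nome ((\<tau> + of_nat k) / 5)) = sigma3_series (nome ((\<tau> + of_nat l) / 5))"
          using kl(3) unfolding val[OF k(1)] val[OF k(2)] by simp
        then have "nome ((\<tau> + of_nat k) / 5) = nome ((\<tau> + of_nat l) / 5)"
          using inj_onD[OF r(3)] small by simp
        then show ?thesis using nome_shift_inj k by blast
      qed
    qed
  qed
  with Y show ?thesis using that by blast
qed

section \<open>The regular representation\<close>

text \<open>The bottom row (c, d) of \<gamma> is coprime, so 5 does not divide both entries and (c
  \<tau> + d) / 5 lies outside the lattice.\<close>

lemma torsion_point_automorphy:
  assumes \<gamma>: "\<gamma> \<in> SL2Z" and \<tau>: "Im \<tau> > 0"
  shows "torsion_point (std_lattice \<tau>) (automorphy \<gamma> \<tau> / 5)"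
proof -
  interpret complex_lattice "std_lattice \<tau>" by (rule complex_lattice_std[OF \<tau>])
  have "automorphy \<gamma> \<tau> / 5 \<notin> std_lattice \<tau>"
  proof
    assume "automorphy \<gamma> \<tau> / 5 \<in> std_lattice \<tau>"
    then obtain m n where "automorphy \<gamma> \<tau> / 5 = of_int m + of_int n * \<tau>" unfolding std_lattice_def by blast
    then have "lat_point \<tau> (\<gamma> $$ (1, 1), \<gamma> $$ (1, 0)) = lat_point \<tau> (5 * m, 5 * n)"
      by (simp add: lat_point_def automorphy_def field_simps)
    then have "\<gamma> $$ (1, 1) = 5 * m" "\<gamma> $$ (1, 0) = 5 * n"
      using injD[OF inj_lat_point[OF \<tau>]] by blast+
    then have "5 * (\<gamma> $$ (0, 0) * m - \<gamma> $$ (0, 1) * n) = 1"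
      using SL2Z_det[OF \<gamma>] by (simp add: algebra_simps)
    then show False by presburger
  qed
  then show ?thesis by unfold_locales (use automorphy_in in auto)
qed

text \<open>Evaluation at \<gamma> \<tau> amounts, up to the automorphy factor, to moving to another
  point of order 5 on the unchanged lattice of \<tau>. This is how the conjugates of the basis
  arise.\<close>

lemma x_form_mobius:
  assumes \<gamma>: "\<gamma> \<in> SL2Z" and \<tau>: "Im \<tau> > 0"
  shows "x_form 1 (mobius_act \<gamma> \<tau>) = automorphy \<gamma> \<tau> ^ 2 * torsion_point.x1 (std_lattice \<tau>) (automorphy \<gamma> \<tau> / 5)"
    and "x_form 2 (mobius_act \<gamma> \<tau>) = automorphy \<gamma> \<tau> ^ 2 * torsion_point.x2 (std_lattice \<tau>) (automorphy \<gamma> \<tau> / 5)"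
proof -
  interpret torsion_point "std_lattice \<tau>" "automorphy \<gamma> \<tau> / 5"
    by (rule torsion_point_automorphy[OF assms])
  have nz: "automorphy \<gamma> \<tau> \<noteq> 0" by (rule automorphy_nz[OF assms])
  have "weierstrass_p (automorphy \<gamma> \<tau> * z) (std_lattice \<tau>) = weierstrass_p z (std_lattice (mobius_act \<gamma> \<tau>)) / automorphy \<gamma> \<tau> ^ 2" for z
    using weierstrass_p_scale[OF nz, of z "std_lattice (mobius_act \<gamma> \<tau>)"]
    unfolding std_lattice_mobius[OF assms, symmetric] .
  then have w: "weierstrass_p z (std_lattice (mobius_act \<gamma> \<tau>)) = automorphy \<gamma> \<tau> ^ 2 * weierstrass_p (automorphy \<gamma> \<tau> * z) (std_lattice \<tau>)" for z
    using nz by (simp add: field_simps)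
  show "x_form 1 (mobius_act \<gamma> \<tau>) = automorphy \<gamma> \<tau> ^ 2 * x1" "x_form 2 (mobius_act \<gamma> \<tau>) = automorphy \<gamma> \<tau> ^ 2 * x2"
    unfolding x_form_def x1_def x2_def w by (simp_all add: mult_ac)
qed

lemma one_mat_SL2Z: "1\<^sub>m 2 \<in> SL2Z"
  by (simp add: SL2Z_def)

lemma automorphy_one: "automorphy (1\<^sub>m 2) \<tau> = 1" and mobius_one: "mobius_act (1\<^sub>m 2) \<tau> = \<tau>"
  by (simp_all add: automorphy_def mobius_act_def)

lemma torsion_point_a_b:
  assumes "Im \<tau> > 0" "torsion_point (std_lattice \<tau>) z"
  shows "torsion_point.a (std_lattice \<tau>) = a_form \<tau>" "torsion_point.b (std_lattice \<tau>) = b_form \<tau>"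
  using torsion_point.a_def[OF assms(2)] torsion_point.b_def[OF assms(2)] assms(1)
  by (simp_all add: a_form_eq b_form_eq)

lemma x_form_relations:
  assumes \<tau>: "Im \<tau> > 0"
  shows "torsion_rel (a_form \<tau>) (b_form \<tau>) (x_form 1 \<tau>) (x_form 2 \<tau>)"
    and "5 ^ 4 * a_form (5 * \<tau>) = - 19 * a_form \<tau> - 30 * (x_form 1 \<tau> ^ 2 + x_form 2 \<tau> ^ 2)"
    and "5 ^ 6 * b_form (5 * \<tau>) = - 55 * b_form \<tau> - 42 * a_form \<tau> * (x_form 1 \<tau> + x_form 2 \<tau>) - 70 * (x_form 1 \<tau> ^ 3 + x_form 2 \<tau> ^ 3)"
proof -
  have tp: "torsion_point (std_lattice \<tau>) (1 / 5)"
    using torsion_point_automorphy[OF one_mat_SL2Z \<tau>] by (simp add: automorphy_one)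
  have x: "x_form 1 \<tau> = torsion_point.x1 (std_lattice \<tau>) (1 / 5)" "x_form 2 \<tau> = torsion_point.x2 (std_lattice \<tau>) (1 / 5)"
    using x_form_mobius[OF one_mat_SL2Z \<tau>] by (simp_all add: automorphy_one mobius_one)
  note ab = torsion_point_a_b[OF \<tau> tp]
  show "torsion_rel (a_form \<tau>) (b_form \<tau>) (x_form 1 \<tau>) (x_form 2 \<tau>)"
    using torsion_point.torsion_relation[OF tp] unfolding ab x .
  show "5 ^ 4 * a_form (5 * \<tau>) = - 19 * a_form \<tau> - 30 * (x_form 1 \<tau> ^ 2 + x_form 2 \<tau> ^ 2)"
    using torsion_point.velu_a[OF tp] unfolding ab x a_form_5[OF \<tau>] .
  show "5 ^ 6 * b_form (5 * \<tau>) = - 55 * b_form \<tau> - 42 * a_form \<tau> * (x_form 1 \<tau> + x_form 2 \<tau>) - 70 * (x_form 1 \<tau> ^ 3 + x_form 2 \<tau> ^ 3)"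
    using torsion_point.velu_b[OF tp] unfolding ab x b_form_5[OF \<tau>] .
qed

text \<open>Representatives of the six cosets of Gamma0(5): for j < 5 the bottom row (1, j) leads to
  the point (\<tau> + j) / 5, and the identity at index 5 to the point 1/5. The numbering agrees
  with \<open>conj_a\<close>.\<close>

definition coset_rep :: "nat \<Rightarrow> int mat" where
  "coset_rep j = (if j = 5 then 1\<^sub>m 2 else mat_of_rows_list 2 [[0, - 1], [1, int j]])"

lemma coset_rep_SL2Z: "coset_rep j \<in> SL2Z"
proof (cases "j = 5")
  case False
  have c: "mat_of_rows_list 2 [[0, - 1], [1, int j]] \<in> carrier_mat 2 2"
    by (simp add: mat_of_rows_list_def numeral_2_eq_2)
  have "Determinant.det (mat_of_rows_list 2 [[0, - 1], [1, int j]]) = 1"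
    unfolding det_2x2[OF c] by (simp add: mat_of_rows_list_def)
  with c False show ?thesis by (simp add: SL2Z_def coset_rep_def)
qed (simp add: coset_rep_def one_mat_SL2Z)

lemma automorphy_coset_rep: "automorphy (coset_rep j) \<tau> = (if j = 5 then 1 else \<tau> + of_nat j)"
  by (simp add: coset_rep_def automorphy_def mat_of_rows_list_def)

text \<open>The values of the basis forms slashed by \<open>coset_rep j\<close>, each in its own
  weight.\<close>

definition conj_basis :: "nat \<Rightarrow> complex \<Rightarrow> complex list" where
  "conj_basis j \<tau> = sym_basis (torsion_point.x1 (std_lattice \<tau>) (automorphy (coset_rep j) \<tau> / 5))
     (torsion_point.x2 (std_lattice \<tau>) (automorphy (coset_rep j) \<tau> / 5))"

lemma conj_a_superlattice:
  assumes \<tau>: "Im \<tau> > 0" and j: "j < 6"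
  shows "conj_a j \<tau> = - 15 / of_real pi ^ 4 * eis (superlattice (std_lattice \<tau>) (automorphy (coset_rep j) \<tau> / 5)) 4"
proof (cases "j = 5")
  case True
  then show ?thesis using a_form_5[OF \<tau>] by (simp add: conj_a_def automorphy_coset_rep)
next
  case False
  have "Im ((\<tau> + of_int (int j)) / 5) > 0" using \<tau> by simp
  from a_form_eq[OF this] False show ?thesis
    unfolding superlattice_std_shift[OF \<tau>, symmetric] by (simp add: conj_a_def automorphy_coset_rep)
qed

text \<open>The relations and the formula for a' hold at every point of order 5, while
  \<open>a_form\<close> and \<open>b_form\<close> depend on the lattice only; hence the six vectors
  of values share one matrix.\<close>

lemma conj_basis_eigen:
  assumes \<tau>: "Im \<tau> > 0" and j: "j < 6" and c: "c < 6"
  shows "conj_a j \<tau> * conj_basis j \<tau> ! c = (\<Sum>i<6. rho_a (a_form \<tau>) (b_form \<tau>) $$ (i, c) * conj_basis j \<tau> ! i)"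
proof -
  note tp = torsion_point_automorphy[OF coset_rep_SL2Z[of j] \<tau>]
  note ab = torsion_point_a_b[OF \<tau> tp]
  have "conj_a j \<tau> = - 19 * a_form \<tau> - 30 * (torsion_point.x1 (std_lattice \<tau>) (automorphy (coset_rep j) \<tau> / 5) ^ 2
      + torsion_point.x2 (std_lattice \<tau>) (automorphy (coset_rep j) \<tau> / 5) ^ 2)"
    using torsion_point.velu_a[OF tp] unfolding ab conj_a_superlattice[OF \<tau> j] .
  from rho_a_columns[OF torsion_point.torsion_relation[OF tp, unfolded ab] this] c
  show ?thesis unfolding conj_basis_def by blast
qed

definition basis_weight :: "nat \<Rightarrow> nat" where
  "basis_weight i = [0, 2, 4, 4, 8, 6] ! i"

lemma sym_basis_scale:
  assumes "i < 6"
  shows "sym_basis (r ^ 2 * x) (r ^ 2 * y) ! i = r ^ basis_weight i * sym_basis x y ! i"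
proof -
  have "\<forall>i<6. sym_basis (r ^ 2 * x) (r ^ 2 * y) ! i = r ^ basis_weight i * sym_basis x y ! i"
    unfolding all_less_6 sym_basis_def basis_weight_def
    by (simp add: power_mult_distrib algebra_simps flip: power_mult power_add)
  with assms show ?thesis by blast
qed

abbreviation "X\<^sub>1 \<equiv> homog 2 (x_form 1)"
abbreviation "X\<^sub>2 \<equiv> homog 2 (x_form 2)"
abbreviation "aa \<equiv> homog 4 a_form"
abbreviation "bb \<equiv> homog 6 b_form"

lemmas hol_x = holomorphic_x_form[of 1, simplified] holomorphic_x_form[of 2, simplified]

lemmas homog_simps = homog_add homog_diff homog_mult homog_power homog_numeral_mult homog_uminus
  holomorphic_on_add holomorphic_on_diff holomorphic_on_mult holomorphic_on_power holomorphic_on_minus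

text \<open>Both relations are homogeneous, of weights 6 and 8, so each left-hand side is a single
  homogeneous element whose function vanishes pointwise.\<close>

lemma fract_torsion_rel: "torsion_rel aa bb X\<^sub>1 X\<^sub>2"
proof -
  let ?x = "x_form 1" and ?y = "x_form 2"
  have "(X\<^sub>1 + X\<^sub>2)^3 - 6 * (X\<^sub>1 * X\<^sub>2) * (X\<^sub>1 + X\<^sub>2) - 2 * aa * (X\<^sub>1 + X\<^sub>2) - 4 * bb
    = homog 6 (\<lambda>\<tau>. (?x \<tau> + ?y \<tau>)^3 - 6 * (?x \<tau> * ?y \<tau>) * (?x \<tau> + ?y \<tau>) - 2 * a_form \<tau> * (?x \<tau> + ?y \<tau>) - 4 * b_form \<tau>)"
    by (simp add: homog_simps hol_x hol_a_form hol_b_form)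
  also have "\<dots> = homog 6 (\<lambda>_. 0)"
    by (rule homog_cong) (use x_form_relations(1) in \<open>simp add: torsion_rel_def in_uhp\<close>)
  finally have 1: "(X\<^sub>1 + X\<^sub>2)^3 - 6 * (X\<^sub>1 * X\<^sub>2) * (X\<^sub>1 + X\<^sub>2) - 2 * aa * (X\<^sub>1 + X\<^sub>2) - 4 * bb = 0"
    unfolding homog_0 .
  have "X\<^sub>1 * X\<^sub>2 * (X\<^sub>1 + X\<^sub>2)^2 - 5 * (X\<^sub>1 * X\<^sub>2)^2 + 2 * aa * (X\<^sub>1 * X\<^sub>2) - aa^2 + 4 * bb * (X\<^sub>1 + X\<^sub>2)
    = homog 8 (\<lambda>\<tau>. ?x \<tau> * ?y \<tau> * (?x \<tau> + ?y \<tau>)^2 - 5 * (?x \<tau> * ?y \<tau>)^2 + 2 * a_form \<tau> * (?x \<tau> * ?y \<tau>) - (a_form \<tau>)^2 + 4 * b_form \<tau> * (?x \<tau> + ?y \<tau>))"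
    by (simp add: homog_simps hol_x hol_a_form hol_b_form)
  also have "\<dots> = homog 8 (\<lambda>_. 0)"
    by (rule homog_cong) (use x_form_relations(1) in \<open>simp add: torsion_rel_def in_uhp\<close>)
  finally show ?thesis unfolding torsion_rel_def homog_0 using 1 by blast
qed

lemma fract_velu_a: "homog 4 (\<lambda>\<tau>. 5 ^ 4 * a_form (5 * \<tau>)) = - 19 * aa - 30 * (X\<^sub>1^2 + X\<^sub>2^2)"
proof -
  \<comment> \<open>\<open>homog_numeral_mult\<close> is about positive numerals, so the sign is
    first taken out of the leading coefficient.\<close>
  have "- 19 * aa - 30 * (X\<^sub>1^2 + X\<^sub>2^2) = - (19 * aa) - 30 * (X\<^sub>1^2 + X\<^sub>2^2)" by simp
  also have "\<dots> = homog 4 (\<lambda>\<tau>. - (19 * a_form \<tau>) - 30 * (x_form 1 \<tau> ^ 2 + x_form 2 \<tau> ^ 2))"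
    by (simp add: homog_simps hol_x hol_a_form)
  also have "\<dots> = homog 4 (\<lambda>\<tau>. 5 ^ 4 * a_form (5 * \<tau>))"
    by (rule homog_cong) (use x_form_relations(2) in \<open>simp add: in_uhp\<close>)
  finally show ?thesis ..
qed

lemma fract_velu_b: "homog 6 (\<lambda>\<tau>. 5 ^ 6 * b_form (5 * \<tau>)) = - 55 * bb - 42 * aa * (X\<^sub>1 + X\<^sub>2) - 70 * (X\<^sub>1^3 + X\<^sub>2^3)"
proof -
  have "- 55 * bb - 42 * aa * (X\<^sub>1 + X\<^sub>2) - 70 * (X\<^sub>1^3 + X\<^sub>2^3) = - (55 * bb) - 42 * aa * (X\<^sub>1 + X\<^sub>2) - 70 * (X\<^sub>1^3 + X\<^sub>2^3)" by simp
  also have "\<dots> = homog 6 (\<lambda>\<tau>. - (55 * b_form \<tau>) - 42 * a_form \<tau> * (x_form 1 \<tau> + x_form 2 \<tau>) - 70 * (x_form 1 \<tau> ^ 3 + x_form 2 \<tau> ^ 3))"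
    by (simp add: homog_simps hol_x hol_a_form hol_b_form)
  also have "\<dots> = homog 6 (\<lambda>\<tau>. 5 ^ 6 * b_form (5 * \<tau>))"
    by (rule homog_cong) (use x_form_relations(3) in \<open>simp add: in_uhp\<close>)
  finally show ?thesis ..
qed

section \<open>Linear independence of the basis over level 1\<close>

definition basis_fun :: "nat \<Rightarrow> complex \<Rightarrow> complex" where
  "basis_fun i \<tau> = sym_basis (x_form 1 \<tau>) (x_form 2 \<tau>) ! i"

lemma basis_fun_homog:
  assumes "i < 6"
  shows "sym_basis X\<^sub>1 X\<^sub>2 ! i = homog (basis_weight i) (basis_fun i)" "uhp_hol (basis_fun i)"
proof -
  have "\<forall>i<6. sym_basis X\<^sub>1 X\<^sub>2 ! i = homog (basis_weight i) (basis_fun i)"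
    unfolding all_less_6 basis_fun_def basis_weight_def sym_basis_def
    by (simp add: homog_simps hol_x homog_1)
  moreover have "\<forall>i<6. uhp_hol (basis_fun i)"
    unfolding all_less_6 basis_fun_def[abs_def] sym_basis_def
    by (simp add: hol_x holomorphic_on_add holomorphic_on_mult holomorphic_on_power)
  ultimately show "sym_basis X\<^sub>1 X\<^sub>2 ! i = homog (basis_weight i) (basis_fun i)" "uhp_hol (basis_fun i)"
    using assms by blast+
qed

text \<open>The part of weight k of a relation. A coefficient is zero when its basis form has weight
  above k; this is a separate hypothesis because subtraction of natural numbers truncates.\<close>

lemma forms_independent:
  assumes h: "\<And>i. i < 6 \<Longrightarrow> k \<ge> basis_weight i \<Longrightarrow> h i \<in> modular_forms (k - basis_weight i) SL2Z"
    and h0: "\<And>i. i < 6 \<Longrightarrow> k < basis_weight i \<Longrightarrow> h i = 0"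
    and rel: "(\<Sum>i<6. h i * uhp_restrict (basis_fun i)) = 0"
    and i: "i < 6"
  shows "h i = 0"
proof -
  obtain Y where Y: "Y > 0" "\<And>\<tau>. Im \<tau> > Y \<Longrightarrow> inj_on (\<lambda>j. conj_a j \<tau>) {..<6}"
    using conj_a_distinct by blast
  have Rep_sum: "Rep_uhp_fun (\<Sum>i\<in>A. f i) \<tau> = (\<Sum>i\<in>A. Rep_uhp_fun (f i) \<tau>)" if "finite A" for f \<tau> and A :: "nat set"
    using that by (induction A rule: finite_induct) (simp_all add: zero_uhp_fun.rep_eq plus_uhp_fun.rep_eq)
  have zero: "Rep_uhp_fun (h i) \<tau> = 0" if \<tau>: "Im \<tau> > Y" for \<tau>
  proof -
    have pos: "Im \<tau> > 0" using \<tau> Y(1) by simp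
    show ?thesis
    proof (rule eigen_family_independent[where n = 6 and \<theta> = "\<lambda>j. conj_a j \<tau>" and F = "\<lambda>j i. conj_basis j \<tau> ! i"
          and M = "\<lambda>i c. rho_a (a_form \<tau>) (b_form \<tau>) $$ (i, c)" and x = "\<lambda>i. Rep_uhp_fun (h i) \<tau>"])
      show "inj_on (\<lambda>j. conj_a j \<tau>) {..<6}" by (rule Y(2)[OF \<tau>])
      show "conj_basis j \<tau> ! 0 = 1" for j by (simp add: conj_basis_def sym_basis_def)
      show "conj_a j \<tau> * conj_basis j \<tau> ! c = (\<Sum>i<6. rho_a (a_form \<tau>) (b_form \<tau>) $$ (i, c) * conj_basis j \<tau> ! i)"
        if "j < 6" "c < 6" for j c
        by (rule conj_basis_eigen[OF pos that])
      show "(\<Sum>i<6. Rep_uhp_fun (h i) \<tau> * conj_basis j \<tau> ! i) = 0" for j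
      proof -
        define \<gamma> where "\<gamma> = coset_rep j"
        define r where "r = automorphy \<gamma> \<tau>"
        have \<gamma>: "\<gamma> \<in> SL2Z" by (simp add: \<gamma>_def coset_rep_SL2Z)
        have r0: "r \<noteq> 0" unfolding r_def by (rule automorphy_nz[OF \<gamma> pos])
        have up: "\<tau> \<in> upper_half_plane" "mobius_act \<gamma> \<tau> \<in> upper_half_plane"
          using pos Im_mobius_pos[OF \<gamma> pos] by (simp_all add: in_uhp)
        \<comment> \<open>The weights of coefficient and basis form add up to k, so all terms
          acquire the common factor r^k, which cancels. The coefficients, being of level 1, keep
          their values at \<tau> while the basis is conjugated.\<close>
        have summand: "Rep_uhp_fun (h i) (mobius_act \<gamma> \<tau>) * basis_fun i (mobius_act \<gamma> \<tau>) = r ^ k * (Rep_uhp_fun (h i) \<tau> * conj_basis j \<tau> ! i)"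
          if i: "i < 6" for i
        proof (cases "basis_weight i \<le> k")
          case True
          have "slash (k - basis_weight i) (Rep_uhp_fun (h i)) \<gamma> \<tau> = Rep_uhp_fun (h i) \<tau>"
            by (rule modular_forms_slash[OF h[OF i True] \<gamma> up(1)])
          then have 1: "Rep_uhp_fun (h i) (mobius_act \<gamma> \<tau>) = r ^ (k - basis_weight i) * Rep_uhp_fun (h i) \<tau>"
            using r0 unfolding slash_eq r_def by (simp add: field_simps)
          have 2: "basis_fun i (mobius_act \<gamma> \<tau>) = r ^ basis_weight i * conj_basis j \<tau> ! i"
            unfolding basis_fun_def x_form_mobius[OF \<gamma> pos] r_def[symmetric] sym_basis_scale[OF i]
            by (simp add: conj_basis_def r_def \<gamma>_def)
          have "r ^ (k - basis_weight i) * r ^ basis_weight i = r ^ k"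
            using True by (simp flip: power_add)
          then show ?thesis unfolding 1 2 by (metis (no_types, opaque_lifting) mult.assoc mult.commute mult.left_commute)
        next
          case False
          then show ?thesis using h0[OF i] by (simp add: zero_uhp_fun.rep_eq)
        qed
        have "0 = Rep_uhp_fun (\<Sum>i<6. h i * uhp_restrict (basis_fun i)) (mobius_act \<gamma> \<tau>)"
          unfolding rel by (simp add: zero_uhp_fun.rep_eq)
        also have "\<dots> = (\<Sum>i<6. Rep_uhp_fun (h i) (mobius_act \<gamma> \<tau>) * basis_fun i (mobius_act \<gamma> \<tau>))"
          using up(2) by (simp add: Rep_sum times_uhp_fun.rep_eq Rep_uhp_restrict basis_fun_homog(2))
        also have "\<dots> = (\<Sum>i<6. r ^ k * (Rep_uhp_fun (h i) \<tau> * conj_basis j \<tau> ! i))"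
          by (rule sum.cong) (use summand in auto)
        also have "\<dots> = r ^ k * (\<Sum>i<6. Rep_uhp_fun (h i) \<tau> * conj_basis j \<tau> ! i)"
          by (rule sum_distrib_left[symmetric])
        finally show ?thesis using r0 by simp
      qed
    qed (rule i)
  qed
  show ?thesis
  proof (rule uhp_fun_eqI)
    fix \<tau> assume \<tau>: "\<tau> \<in> upper_half_plane"
    \<comment> \<open>The conjugates were separated for large Im \<tau> only; the identity theorem
      carries the vanishing to the whole half-plane.\<close>
    have sub: "{\<tau>. Im \<tau> > Y} \<subseteq> upper_half_plane" using Y(1) by (auto simp: in_uhp)
    have ne: "{\<tau>. Im \<tau> > Y} \<noteq> {}"
    proof -
      have "\<i> * of_real (Y + 1) \<in> {\<tau>. Im \<tau> > Y}" by simp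
      then show ?thesis by blast
    qed
    have hol: "Rep_uhp_fun (h i) holomorphic_on upper_half_plane" using Rep_uhp_fun[of "h i"] by simp
    have "Rep_uhp_fun (h i) \<tau> = (\<lambda>_. 0) \<tau>"
      by (rule analytic_continuation_open[OF open_halfspace_Im_gt open_upper_half_plane ne connected_upper_half_plane sub hol
            holomorphic_on_const _ \<tau>]) (use zero in simp)
    then show "Rep_uhp_fun (h i) \<tau> = Rep_uhp_fun 0 \<tau>" by (simp add: zero_uhp_fun.rep_eq)
  qed
qed

text \<open>After clearing denominators the relation lives in the polynomial ring that encodes the
  grading, and each of its coefficients is a relation of the kind treated in
  \<open>forms_independent\<close>.\<close>

lemma basis_independent:
  assumes c: "\<And>i. i < 6 \<Longrightarrow> c i \<in> modular_field SL2Z"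
    and rel: "(\<Sum>i<6. c i * sym_basis X\<^sub>1 X\<^sub>2 ! i) = 0" and i: "i < 6"
  shows "c i = 0"
proof -
  obtain Q P where Q: "Q \<noteq> 0" and P: "\<And>i. i \<in> {..<6} \<Longrightarrow> P i \<in> modular_ring SL2Z"
    "\<And>i. i \<in> {..<6} \<Longrightarrow> c i * Fraction_Field.Fract Q 1 = Fraction_Field.Fract (P i) 1"
    using modular_field_common_denominator[of SL2Z "{..<6::nat}" c] c by auto
  define B where "B i = monom (uhp_restrict (basis_fun i)) (basis_weight i)" for i
  have FS: "(\<Sum>i\<in>A. Fraction_Field.Fract (f i) 1) = Fraction_Field.Fract (\<Sum>i\<in>A. f i) (1 :: uhp_fun poly)" if "finite A"
    for f and A :: "nat set"
    using that by (induction A rule: finite_induct) (simp_all add: Zero_fract_def)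
  have "0 = (\<Sum>i<6. c i * sym_basis X\<^sub>1 X\<^sub>2 ! i) * Fraction_Field.Fract Q 1" using rel by simp
  also have "\<dots> = (\<Sum>i<6. (c i * Fraction_Field.Fract Q 1) * sym_basis X\<^sub>1 X\<^sub>2 ! i)"
    unfolding sum_distrib_right by (simp only: mult_ac)
  also have "\<dots> = (\<Sum>i<6. Fraction_Field.Fract (P i * B i) 1)"
  proof (rule sum.cong[OF refl])
    fix i :: nat assume i: "i \<in> {..<6}"
    then have "sym_basis X\<^sub>1 X\<^sub>2 ! i = Fraction_Field.Fract (B i) 1"
      using basis_fun_homog(1)[of i] by (simp add: homog_def B_def)
    then show "(c i * Fraction_Field.Fract Q 1) * sym_basis X\<^sub>1 X\<^sub>2 ! i = Fraction_Field.Fract (P i * B i) 1"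
      unfolding P(2)[OF i] by simp
  qed
  also have "\<dots> = Fraction_Field.Fract (\<Sum>i<6. P i * B i) 1" by (rule FS) simp
  finally have PB: "(\<Sum>i<6. P i * B i) = 0" by (simp add: Zero_fract_def eq_fract)
  have "P i = 0"
  proof (rule poly_eqI)
    fix m
    \<comment> \<open>In this weight basis element i is paired with the coefficient of index m. In
      \<open>h\<close> the case distinction prevents truncated subtraction from selecting the
      coefficient of index 0.\<close>
    define k where "k = m + basis_weight i"
    define h where "h i = (if k < basis_weight i then 0 else coeff (P i) (k - basis_weight i))" for i
    have "h i = 0"
    proof (rule forms_independent[where k = k, OF _ _ _ i])
      show "h i \<in> modular_forms (k - basis_weight i) SL2Z" if "i < 6" "basis_weight i \<le> k" for i
        using P(1)[of i] that by (simp add: h_def modular_ring_def)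
      show "h i = 0" if "i < 6" "k < basis_weight i" for i using that by (simp add: h_def)
      have "(\<Sum>i<6. h i * uhp_restrict (basis_fun i)) = (\<Sum>i<6. coeff (P i * B i) k)"
      proof (rule sum.cong[OF refl])
        fix i :: nat
        show "h i * uhp_restrict (basis_fun i) = coeff (P i * B i) k"
        proof -
          have "coeff (P i * B i) k = coeff (monom (uhp_restrict (basis_fun i)) (basis_weight i) * P i) k"
            unfolding B_def by (rule arg_cong2[where f = coeff, OF mult.commute refl])
          then show ?thesis unfolding coeff_monom_mult by (simp add: h_def not_less mult.commute)
        qed
      qed
      also have "\<dots> = 0" using PB by (simp flip: coeff_sum)
      finally show "(\<Sum>i<6. h i * uhp_restrict (basis_fun i)) = 0" .
    qed
    then show "coeff (P i) m = coeff 0 m" by (simp add: h_def k_def)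
  qed
  then have "c i * Fraction_Field.Fract Q 1 = 0" using P(2)[of i] i by (simp add: Zero_fract_def)
  moreover have "Fraction_Field.Fract Q 1 \<noteq> 0" using Q by (simp add: Zero_fract_def eq_fract)
  ultimately show ?thesis by simp
qed

section \<open>Evaluation of the regular representation\<close>

lemma regular_rep_eqI:
  fixes fs :: "'a::field list"
  assumes f: "f \<in> L" and M: "M \<in> carrier_mat (length fs) (length fs)" and el: "elements_mat M \<subseteq> K"
    and col: "\<And>j. j < length fs \<Longrightarrow> f * fs ! j = (\<Sum>i<length fs. M $$ (i, j) * fs ! i)"
    and diff: "\<And>x y. x \<in> K \<Longrightarrow> y \<in> K \<Longrightarrow> x - y \<in> K"
    and ind: "\<And>c i. (\<And>i. i < length fs \<Longrightarrow> c i \<in> K) \<Longrightarrow> (\<Sum>i<length fs. c i * fs ! i) = 0 \<Longrightarrow> i < length fs \<Longrightarrow> c i = 0"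
  shows "regular_rep L K fs f = M"
proof -
  let ?P = "\<lambda>M. M \<in> carrier_mat (length fs) (length fs) \<and> elements_mat M \<subseteq> K \<and>
             (\<forall>j<length fs. f * fs ! j = (\<Sum>i<length fs. M $$ (i, j) * fs ! i))"
  have "N = M" if N: "?P N" for N
  proof (rule eq_matI)
    fix i j assume "i < dim_row M" "j < dim_col M"
    then have ij: "i < length fs" "j < length fs" using M by auto
    have mem: "A $$ (r, j) \<in> K" if "A \<in> carrier_mat (length fs) (length fs)" "elements_mat A \<subseteq> K" "r < length fs" for A r
      by (rule subsetD[OF that(2) elements_matI[OF that(1) that(3) ij(2) refl]])
    \<comment> \<open>Two admissible matrices express the same products, so the difference of their
      columns j is a linear relation between the basis elements with coefficients in K.\<close>
    have "N $$ (i, j) - M $$ (i, j) = 0"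
    proof (rule ind[OF _ _ ij(1)])
      show "N $$ (i, j) - M $$ (i, j) \<in> K" if "i < length fs" for i
        by (rule diff[OF mem mem]) (use that N M el in blast)+
      show "(\<Sum>i<length fs. (N $$ (i, j) - M $$ (i, j)) * fs ! i) = 0"
        using N col[OF ij(2)] ij(2) by (simp add: left_diff_distrib sum_subtractf)
    qed
    then show "N $$ (i, j) = M $$ (i, j)" by simp
  qed (use N M in auto)
  moreover have "?P M" using M el col by blast
  ultimately have "(THE M. ?P M) = M" by (intro the_equality)
  then show ?thesis using f by (simp add: regular_rep_def)
qed

lemma rho_carrier: "rho_a a b \<in> carrier_mat 6 6" "rho_b a b \<in> carrier_mat 6 6"
  unfolding rho_a_def rho_b_def mat_of_rows_list_def
  by (rule carrier_matI; simp only: dim_row_mat dim_col_mat list.size; simp)+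

lemma aa_in: "aa \<in> modular_field SL2Z" and bb_in: "bb \<in> modular_field SL2Z"
  by (intro homog_in_modular_field a_form_modular b_form_modular order_refl)+

lemma elements_mat_6:
  assumes "M \<in> carrier_mat 6 6" "\<forall>i<6. \<forall>j<6. M $$ (i, j) \<in> K"
  shows "elements_mat M \<subseteq> K"
  using assms by (auto simp: elements_mat_def)

lemmas mf_intros = modular_field_add[OF order_refl] modular_field_diff[OF order_refl] modular_field_mult[OF order_refl]
  modular_field_uminus[OF order_refl] modular_field_divide[OF order_refl] modular_field_power[OF order_refl]
  modular_field_numeral[OF order_refl] modular_field_0[OF order_refl] modular_field_1[OF order_refl] aa_in bb_in

lemma rho_elements:
  "elements_mat (rho_a aa bb) \<subseteq> modular_field SL2Z" "elements_mat (rho_b aa bb) \<subseteq> modular_field SL2Z"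
proof -
  have "\<forall>i<6. \<forall>j<6. rho_a aa bb $$ (i, j) \<in> modular_field SL2Z"
    unfolding all_less_6 rho_a_def by (simp add: mat_of_rows_list_def) (intro conjI mf_intros)
  then show "elements_mat (rho_a aa bb) \<subseteq> modular_field SL2Z"
    by (rule elements_mat_6[OF rho_carrier(1)])
  have "\<forall>i<6. \<forall>j<6. rho_b aa bb $$ (i, j) \<in> modular_field SL2Z"
    unfolding all_less_6 rho_b_def by (simp add: mat_of_rows_list_def) (intro conjI mf_intros)
  then show "elements_mat (rho_b aa bb) \<subseteq> modular_field SL2Z"
    by (rule elements_mat_6[OF rho_carrier(2)])
qed

lemma length_sym_basis: "length (sym_basis x y) = 6"
  by (simp add: sym_basis_def)

lemma regular_rep_sym_basis:
  assumes "f \<in> L" "M \<in> carrier_mat 6 6" "elements_mat M \<subseteq> modular_field SL2Z"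
    and "\<forall>j<6. f * sym_basis X\<^sub>1 X\<^sub>2 ! j = (\<Sum>i<6. M $$ (i, j) * sym_basis X\<^sub>1 X\<^sub>2 ! i)"
  shows "regular_rep L (modular_field SL2Z) (sym_basis X\<^sub>1 X\<^sub>2) f = M"
proof (rule regular_rep_eqI)
  show "c i = 0" if "\<And>i. i < length (sym_basis X\<^sub>1 X\<^sub>2) \<Longrightarrow> c i \<in> modular_field SL2Z"
    "(\<Sum>i<length (sym_basis X\<^sub>1 X\<^sub>2). c i * sym_basis X\<^sub>1 X\<^sub>2 ! i) = 0" "i < length (sym_basis X\<^sub>1 X\<^sub>2)" for c i
    by (rule basis_independent) (use that in \<open>simp_all add: length_sym_basis\<close>)
qed (use assms modular_field_diff[OF order_refl] in \<open>simp_all add: length_sym_basis\<close>)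

theorem theorem5p3:
  fixes a b a' b' xP x2P :: "uhp_fun poly fract"
    and \<rho> :: "uhp_fun poly fract \<Rightarrow> uhp_fun poly fract mat"
  defines "a \<equiv> homog 4 a_form"
    and "b \<equiv> homog 6 b_form"
    and "a' \<equiv> homog 4 (\<lambda>\<tau>. 5 ^ 4 * a_form (5 * \<tau>))"
    and "b' \<equiv> homog 6 (\<lambda>\<tau>. 5 ^ 6 * b_form (5 * \<tau>))"
    and "xP \<equiv> homog 2 (x_form 1)"
    and "x2P \<equiv> homog 2 (x_form 2)"
    and "\<rho> \<equiv> regular_rep (modular_field (Gamma0 5)) (modular_field SL2Z)
           [1, xP + x2P, xP * x2P, xP^2 + x2P^2, xP^2 * x2P^2, xP^3 + x2P^3]"
  shows
    "\<rho> a' = mat_of_rows_list 6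
       [[-19*a,  40*b, -30*a^2, -60*a^2, 72*a^3 - 448*b^2, -1600*a*b],
        [    0,     a,   120*b,   120*b,        -512*a*b, -1160*a^2],
        [    0,     0,    41*a,       0,       -192*a^2,     3960*b],
        [  -30,     0,       0,   -79*a,        -18*a^2,     1320*b],
        [    0,     0,     -90,    -420,          365*a,          0],
        [    0,   -40,       0,       0,          184*b,      321*a]] \<and>
     \<rho> b' = mat_of_rows_list 6
       [[-55*b, -210*a^2, -2632*a*b/3, -11032*a*b/3, 13888*a^2*b/3, 1554*a^3 - 12320*b^2],
        [-42*a,    505*b, -1946*a^2/3,  -8036*a^2/3, 7658*a^3/3 - 3360*b^2, -13104*a*b],
        [    0,     56*a,      2185*b,       9240*b,     -9576*a*b,  -5096*a^2],
        [    0,   -182*a,       840*b,       3025*b,     -2632*a*b,   -994*a^2],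
        [    0,    -1050,           0,            0,        4705*b,     7770*a],
        [  -70,        0,     658*a/3,     2212*a/3,  -2842*a^2/3,     5265*b]]"
  unfolding \<rho>_def a_def b_def a'_def b'_def xP_def x2P_def
    sym_basis_def[symmetric] rho_a_def[symmetric] rho_b_def[symmetric]
  by (intro conjI regular_rep_sym_basis rho_carrier rho_elements homog_in_modular_field Gamma0_subset
      a_form_5_modular b_form_5_modular rho_a_columns[OF fract_torsion_rel fract_velu_a]
      rho_b_columns[OF fract_torsion_rel fract_velu_b])

end
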